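(* Let $T>0$, $\lambda>0$, $u_0\in H^2(\mathbb{T}^3)$, and let $u$ be the solution on $[0,T)$ (in the sense of the context) of the Kuramoto-Sivashinsky equation $$\partial_t u+(u\cdot\nabla)u+\lambda\Delta u+\Delta^2u=0\ \text{ in }\mathbb{T}^3\times[0,T],\qquad u(0)=u_0 .$$ If $\nabla u\in L^2\big(0,T;\dot B^{-1}_{\infty,\infty}(\mathbb{T}^3)\big)\cap L^2\big(0,T;L^2(\mathbb{T}^3)\big)$, then the equation admits a global strong solution, i.e. $u\in L^\infty([0,T];H^2(\mathbb{T}^3))\cap L^2([0,T];H^4(\mathbb{T}^3))$.
   Context: $\mathbb{T}^3=\mathbb{R}^3/(2\pi\mathbb{Z}^3)$; $u:\mathbb{T}^3\times[0,T]\to\mathbb{R}^3$ is not assumed divergence free. Strong solution on $[0,T')$: $u\in L^\infty([0,T');H^2(\mathbb{T}^3))\cap L^2([0,T');H^4(\mathbb{T}^3))$ such that for every smooth $\psi$ on $\mathbb{T}^3$, $\langle\partial_tu,\psi\rangle+(u\cdot\nabla u,\psi)+(\Delta u,\Delta\psi)=\lambda(\nabla u,\nabla\psi)$, with $u(0)=u_0$. By "solution on $[0,T)$" we mean a function that is a strong solution on $[0,T')$ for every $0<T'<T$. Homogeneous toroidal Besov spaces (here $d=3$; applied componentwise): let $\mathcal{D}_0(\mathbb{T}^d)$ be the smooth $2\pi$-periodic functions with zero integral and $\mathcal{D}_0'(\mathbb{T}^d)$ its dual. Fix $\phi\in C^\infty(\mathbb{R}^d)$ with $0\le\phi\le1$,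 $\operatorname{supp}\phi\subset\{1/2<|\xi|<2\}$, $\sum_{j\in\mathbb{Z}}\phi(2^{-j}\xi)=1$ for $\xi\ne0$, and set $\varphi_j(x)=\sum_{m\in\mathbb{Z}^d}\phi(2^{-j}m)e^{im\cdot x}$. For $s\in\mathbb{R}$, $1\le p,q\le\infty$, $\dot B^s_{p,q}(\mathbb{T}^d)$ is the set of $f\in\mathcal{D}_0'(\mathbb{T}^d)$ with $\|f\|_{\dot B^s_{p,q}}=\big\|\big(2^{sj}\|\varphi_j*f\|_{L^p(\mathbb{T}^d)}\big)_{j\in\mathbb{Z}}\big\|_{\ell^q(\mathbb{Z})}<\infty$. *)

theory Defs
  imports "HOL-Analysis.Analysis" "HOL-Probability.Essential_Supremum"
begin

section \<open>Smooth functions and functions on the torus\<close>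

definition partial_deriv ::
    "'a::euclidean_space \<Rightarrow> ('a \<Rightarrow> 'b::real_normed_vector) \<Rightarrow> 'a \<Rightarrow> 'b" where
  "partial_deriv b f = (\<lambda>x. frechet_derivative f (at x) b)"

fun partial_derivs ::
    "'a::euclidean_space list \<Rightarrow> ('a \<Rightarrow> 'b::real_normed_vector) \<Rightarrow> 'a \<Rightarrow> 'b" where
  "partial_derivs [] f = f"
| "partial_derivs (b # bs) f = partial_deriv b (partial_derivs bs f)"

definition smooth :: "('a::euclidean_space \<Rightarrow> 'b::real_normed_vector) \<Rightarrow> bool" where
  "smooth f \<longleftrightarrow> (\<forall>bs\<in>lists Basis. \<forall>x. partial_derivs bs f differentiable (at x))"

text \<open>Functions on the torus are functions on \<open>\<real>\<^sup>d\<close> that are \<open>2\<pi>\<close>-periodic in each coordinate;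
  integrals over the torus are taken over the cell \<open>[0, 2\<pi>]\<^sup>d\<close>.\<close>

definition periodic :: "(real^'d \<Rightarrow> 'b) \<Rightarrow> bool" where
  "periodic f \<longleftrightarrow> (\<forall>i x. f (x + axis i (2 * pi)) = f x)"

definition torus :: "(real^'d) measure" where
  "torus = lebesgue_on (cbox 0 (\<chi> i. 2 * pi))"

definition torus_smooth :: "(real^'d \<Rightarrow> 'b::real_normed_vector) set" where
  "torus_smooth = {\<psi>. smooth \<psi> \<and> periodic \<psi>}"

definition torus_inner :: "(real^'d \<Rightarrow> 'b::euclidean_space) \<Rightarrow> (real^'d \<Rightarrow> 'b) \<Rightarrow> real" where
  "torus_inner f g = (LINT x|torus. f x \<bullet> g x)"


section \<open>Lebesgue and Sobolev spaces\<close>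

definition ennreal_powr :: "ennreal \<Rightarrow> real \<Rightarrow> ennreal" where
  "ennreal_powr x r = (if x = \<infinity> then \<infinity> else ennreal (enn2real x powr r))"

text \<open>The \<open>L\<^sup>p\<close> norm for \<open>1 \<le> p \<le> \<infinity>\<close>, as a function of the absolute value of the integrand.
  With counting measure on \<^typ>\<open>int\<close> it is the norm of \<open>\<ell>\<^sup>p(\<int>)\<close>.\<close>

definition Lp_norm :: "ennreal \<Rightarrow> 'a measure \<Rightarrow> ('a \<Rightarrow> ennreal) \<Rightarrow> ennreal" where
  "Lp_norm p M f =
     (if p = \<infinity> then esssup M f
      else ennreal_powr (\<integral>\<^sup>+ x. ennreal_powr (f x) (enn2real p) \<partial>M) (1 / enn2real p))"

definition torus_Lp_norm :: "ennreal \<Rightarrow> (real^'d \<Rightarrow> 'b::real_normed_vector) \<Rightarrow> ennreal" where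
  "torus_Lp_norm p f = Lp_norm p torus (\<lambda>x. ennreal (norm (f x)))"

definition torus_Lp :: "ennreal \<Rightarrow> (real^'d \<Rightarrow> 'b::euclidean_space) set" where
  "torus_Lp p = {f. periodic f \<and> f \<in> borel_measurable lebesgue \<and> torus_Lp_norm p f < \<infinity>}"

text \<open>\<open>g\<close> is the weak derivative of \<open>f\<close> on the torus in the directions \<open>bs\<close>.\<close>

definition weak_deriv ::
    "(real^'d) list \<Rightarrow> (real^'d \<Rightarrow> 'b::euclidean_space) \<Rightarrow> (real^'d \<Rightarrow> 'b) \<Rightarrow> bool" where
  "weak_deriv bs f g \<longleftrightarrow> f \<in> torus_Lp 1 \<and> g \<in> torus_Lp 1 \<and>
     (\<forall>\<psi> :: real^'d \<Rightarrow> real. \<psi> \<in> torus_smooth \<longrightarrow>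
        (LINT x|torus. partial_derivs bs \<psi> x *\<^sub>R f x)
          = (- 1) ^ length bs *\<^sub>R (LINT x|torus. \<psi> x *\<^sub>R g x))"

text \<open>The weak derivative, which is unique up to a null set.  The value is meaningful only if
  a weak derivative exists.\<close>

definition wderiv ::
    "(real^'d) list \<Rightarrow> (real^'d \<Rightarrow> 'b::euclidean_space) \<Rightarrow> real^'d \<Rightarrow> 'b" where
  "wderiv bs f = (SOME g. weak_deriv bs f g)"

definition sobolev :: "nat \<Rightarrow> (real^'d \<Rightarrow> 'b::euclidean_space) set" where
  "sobolev k = {f \<in> torus_Lp 2.
     \<forall>bs\<in>lists Basis. length bs \<le> k \<longrightarrow> (\<exists>g\<in>torus_Lp 2. weak_deriv bs f g)}"

text \<open>The square of the norm of \<open>H\<^sup>k\<close> is the sum over \<open>j \<le> k\<close> of the squared \<open>L\<^sup>2\<close> norms of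
  the tensors \<open>\<nabla>\<^sup>j f\<close>; the list \<open>bs\<close> runs through the indices of their entries.\<close>

definition sobolev_norm :: "nat \<Rightarrow> (real^'d \<Rightarrow> 'b::euclidean_space) \<Rightarrow> ennreal" where
  "sobolev_norm k f =
     ennreal_powr (\<Sum>bs | bs \<in> lists Basis \<and> length bs \<le> k. (torus_Lp_norm 2 (wderiv bs f))\<^sup>2) (1 / 2)"

definition grad :: "(real^'d \<Rightarrow> 'b::euclidean_space) \<Rightarrow> real^'d \<Rightarrow> 'b^'d" where
  "grad f x = (\<chi> i. wderiv [axis i 1] f x)"

definition laplacian :: "(real^'d \<Rightarrow> 'b::euclidean_space) \<Rightarrow> real^'d \<Rightarrow> 'b" where
  "laplacian f x = (\<Sum>i\<in>UNIV. wderiv [axis i 1, axis i 1] f x)"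

definition advect :: "(real^'d \<Rightarrow> real^'d) \<Rightarrow> (real^'d \<Rightarrow> 'b::euclidean_space) \<Rightarrow> real^'d \<Rightarrow> 'b" where
  "advect v f x = (\<Sum>i\<in>UNIV. v x $ i *\<^sub>R wderiv [axis i 1] f x)"


section \<open>Homogeneous Besov spaces on the torus\<close>

definition test0 :: "(real^'d \<Rightarrow> complex) set" where
  "test0 = {\<psi> \<in> torus_smooth. (LINT x|torus. \<psi> x) = 0}"

text \<open>Continuous linear functionals on \<^const>\<open>test0\<close>, the topology of which is given by the
  supremum norms of all derivatives.  Only the values on \<^const>\<open>test0\<close> matter.\<close>

definition dist0 :: "((real^'d \<Rightarrow> complex) \<Rightarrow> complex) set" where
  "dist0 = {F.
     (\<forall>\<psi>\<in>test0. \<forall>\<psi>'\<in>test0. \<forall>a b. F (\<lambda>x. a * \<psi> x + b * \<psi>' x) = a * F \<psi> + b * F \<psi>') \<and>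
     (\<exists>C k. \<forall>\<psi>\<in>test0.
        norm (F \<psi>) \<le> C * (\<Sum>bs | bs \<in> lists Basis \<and> length bs \<le> k. SUP x. norm (partial_derivs bs \<psi> x)))}"

definition regular_dist :: "(real^'d \<Rightarrow> real) \<Rightarrow> (real^'d \<Rightarrow> complex) \<Rightarrow> complex" where
  "regular_dist f \<psi> = (LINT x|torus. complex_of_real (f x) * \<psi> x)"

definition dyadic_cutoff :: "(real^'d \<Rightarrow> real) \<Rightarrow> bool" where
  "dyadic_cutoff \<phi> \<longleftrightarrow> smooth \<phi> \<and> (\<forall>\<xi>. 0 \<le> \<phi> \<xi> \<and> \<phi> \<xi> \<le> 1) \<and>
     closure {\<xi>. \<phi> \<xi> \<noteq> 0} \<subseteq> {\<xi>. 1 / 2 < norm \<xi> \<and> norm \<xi> < 2} \<and>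
     (\<forall>\<xi>. \<xi> \<noteq> 0 \<longrightarrow> ((\<lambda>j::int. \<phi> ((2 powi (- j)) *\<^sub>R \<xi>)) has_sum 1) UNIV)"

text \<open>The sum over the lattice has only finitely many nonzero terms.\<close>

definition dyadic_kernel :: "(real^'d \<Rightarrow> real) \<Rightarrow> int \<Rightarrow> real^'d \<Rightarrow> complex" where
  "dyadic_kernel \<phi> j x =
     (\<Sum>\<^sub>\<infinity>m\<in>{m. \<forall>i. m $ i \<in> \<int>}. complex_of_real (\<phi> ((2 powi (- j)) *\<^sub>R m)) * cis (m \<bullet> x))"

definition dyadic_block ::
    "(real^'d \<Rightarrow> real) \<Rightarrow> int \<Rightarrow> ((real^'d \<Rightarrow> complex) \<Rightarrow> complex) \<Rightarrow> real^'d \<Rightarrow> complex" where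
  "dyadic_block \<phi> j F x = F (\<lambda>y. dyadic_kernel \<phi> j (x - y))"

definition besov_norm ::
    "(real^'d \<Rightarrow> real) \<Rightarrow> real \<Rightarrow> ennreal \<Rightarrow> ennreal \<Rightarrow> ((real^'d \<Rightarrow> complex) \<Rightarrow> complex) \<Rightarrow> ennreal" where
  "besov_norm \<phi> s p q F =
     Lp_norm q (count_space (UNIV :: int set))
       (\<lambda>j. ennreal (2 powr (s * of_int j)) * torus_Lp_norm p (dyadic_block \<phi> j F))"

text \<open>Families \<open>F\<close> of distributions, the components of a vector or tensor field.\<close>

definition besov_components ::
    "(real^'d \<Rightarrow> real) \<Rightarrow> real \<Rightarrow> ennreal \<Rightarrow> ennreal \<Rightarrow> ('i::finite \<Rightarrow> (real^'d \<Rightarrow> complex) \<Rightarrow> complex) set" where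
  "besov_components \<phi> s p q = {F. \<forall>i. F i \<in> dist0 \<and> besov_norm \<phi> s p q (F i) < \<infinity>}"

definition besov_components_norm ::
    "(real^'d \<Rightarrow> real) \<Rightarrow> real \<Rightarrow> ennreal \<Rightarrow> ennreal \<Rightarrow> ('i::finite \<Rightarrow> (real^'d \<Rightarrow> complex) \<Rightarrow> complex) \<Rightarrow> ennreal" where
  "besov_components_norm \<phi> s p q F = (\<Sum>i\<in>UNIV. besov_norm \<phi> s p q (F i))"

definition grad_dist ::
    "(real^'d \<Rightarrow> real^'n) \<Rightarrow> 'd \<times> 'n \<Rightarrow> (real^'d \<Rightarrow> complex) \<Rightarrow> complex" where
  "grad_dist f = (\<lambda>(i, k). regular_dist (\<lambda>x. grad f x $ i $ k))"


section \<open>Bochner spaces\<close>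

text \<open>The space \<open>L\<^sup>p(I; X)\<close>, where \<open>X\<close> is given by its carrier and its norm \<open>N\<close>.  Since \<open>N\<close> is
  only a seminorm on the representatives, no quotient has to be taken.\<close>

definition strongly_measurable ::
    "real set \<Rightarrow> 'x::minus set \<Rightarrow> ('x \<Rightarrow> ennreal) \<Rightarrow> (real \<Rightarrow> 'x) \<Rightarrow> bool" where
  "strongly_measurable I X N u \<longleftrightarrow> (\<exists>s :: nat \<Rightarrow> real \<Rightarrow> 'x.
     (\<forall>n. finite (s n ` I) \<and> s n ` I \<subseteq> X \<and> (\<forall>v. {t \<in> I. s n t = v} \<in> sets lebesgue)) \<and>
     (AE t in lebesgue_on I. (\<lambda>n. N (s n t - u t)) \<longlonglongrightarrow> 0))"

definition bochner_Lp ::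
    "ennreal \<Rightarrow> real set \<Rightarrow> 'x::minus set \<Rightarrow> ('x \<Rightarrow> ennreal) \<Rightarrow> (real \<Rightarrow> 'x) set" where
  "bochner_Lp p I X N = {u. (AE t in lebesgue_on I. u t \<in> X) \<and> strongly_measurable I X N u \<and>
     Lp_norm p (lebesgue_on I) (\<lambda>t. N (u t)) < \<infinity>}"


section \<open>Strong solutions of the Kuramoto-Sivashinsky equation\<close>

text \<open>\<open>h\<close> is the distributional derivative of \<open>g\<close> on the open interval \<open>(0, T)\<close>.\<close>

definition weak_time_deriv :: "real \<Rightarrow> (real \<Rightarrow> real) \<Rightarrow> (real \<Rightarrow> real) \<Rightarrow> bool" where
  "weak_time_deriv T g h \<longleftrightarrow>
     (\<forall>K. compact K \<and> K \<subseteq> {0<..<T} \<longrightarrow> set_integrable lebesgue K g \<and> set_integrable lebesgue K h) \<and>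
     (\<forall>\<eta> :: real \<Rightarrow> real. smooth \<eta> \<and> closure {t. \<eta> t \<noteq> 0} \<subseteq> {0<..<T} \<longrightarrow>
        (LINT t|lebesgue_on {0<..<T}. g t * deriv \<eta> t) = - (LINT t|lebesgue_on {0<..<T}. h t * \<eta> t))"

text \<open>The pairing of the time derivative of \<open>u\<close> with \<open>\<psi>\<close> is the distributional derivative of
  \<open>t \<mapsto> (u(t), \<psi>)\<close>.  As \<open>u\<close> is determined only up to null sets of times, \<open>u(0) = u0\<close> means that
  the continuous representative of \<open>t \<mapsto> (u(t), \<psi>)\<close> has the value \<open>(u0, \<psi>)\<close> at \<open>0\<close>.
  For the smooth \<open>\<psi>\<close>, weak and classical derivatives agree almost everywhere.\<close>

definition strong_solution ::
    "real \<Rightarrow> real \<Rightarrow> (real^3 \<Rightarrow> real^3) \<Rightarrow> (real \<Rightarrow> real^3 \<Rightarrow> real^3) \<Rightarrow> bool" where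
  "strong_solution lam T u0 u \<longleftrightarrow>
     u \<in> bochner_Lp \<infinity> {0..<T} (sobolev 2) (sobolev_norm 2) \<and>
     u \<in> bochner_Lp 2 {0..<T} (sobolev 4) (sobolev_norm 4) \<and>
     (\<forall>\<psi> :: real^3 \<Rightarrow> real^3. \<psi> \<in> torus_smooth \<longrightarrow>
        weak_time_deriv T (\<lambda>t. torus_inner (u t) \<psi>)
          (\<lambda>t. lam * torus_inner (grad (u t)) (grad \<psi>)
               - torus_inner (advect (u t) (u t)) \<psi>
               - torus_inner (laplacian (u t)) (laplacian \<psi>))) \<and>
     (\<forall>\<psi> :: real^3 \<Rightarrow> real^3. \<psi> \<in> torus_smooth \<longrightarrow>
        (\<exists>g. continuous_on {0..<T} g \<and>
             (AE t in lebesgue_on {0..<T}. g t = torus_inner (u t) \<psi>) \<and>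
             g 0 = torus_inner u0 \<psi>))"

end

theory Submission
  imports Defs
begin

text \<open>
  The hypothesis \<open>\<nabla>u \<in> L\<^sup>2(0,T;L\<^sup>2)\<close> is subcritical for the fourth-order equation: in dimension three
  \<open>H\<^sup>2\<close> embeds into \<open>L\<^sup>\<infinity>\<close>, hence \<open>\<parallel>u\<cdot>\<nabla>u\<parallel>\<close> is at most \<open>C \<parallel>\<nabla>u\<parallel>\<close> times the \<open>H\<^sup>2\<close> norm of \<open>u\<close>, all other
  norms being those of \<open>L\<^sup>2\<close>.  Testing the equation with \<open>u + \<Delta>\<^sup>2u\<close> then bounds the growth rate of
  the squared \<open>H\<^sup>2\<close> norm by \<open>C (1 + \<parallel>\<nabla>u\<parallel>\<^sup>2)\<close>, which is integrable in time, and the dissipation controls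
  the \<open>L\<^sup>2(H\<^sup>4)\<close> norm.  The estimate is carried out on finitely many Fourier modes, for which the weak
  formulation is a system of ordinary differential equations.  The real orthogonal system
  \<open>cos (k\<bullet>x) + sin (k\<bullet>x)\<close>, with \<open>k\<close> in \<open>\<int>\<^sup>d\<close>, replaces the complex exponentials.
\<close>

section \<open>The period cell\<close>

text \<open>Truncation to finitely many modes does not close the estimate, because the convection
  coefficient at one frequency involves all frequencies of \<open>u\<close>. The right side of the
  energy inequality therefore contains a bound \<open>M\<close> for all truncated energies and the
  enstrophy of the whole function, not the truncated quantities. An integral inequality for a single
  truncation would not suffice; the supremum over all truncations and times is taken, and it is
  finite beforehand because \<open>u\<close> is bounded in \<open>H^2\<close> on every shorter time
  interval. The weight \<open>1 + norm k ^ 4\<close> is the symbol of 1 plus the bilaplacian: its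
  first power measures \<open>H^2\<close>, its square measures \<open>H^4\<close>. A second obstacle
  is time. Pairings of \<open>u\<close> are known only for almost every time, so the coefficients
  are replaced by continuous representatives; countability of the lattice yields one null set for
  all modes. Differentiation sends \<open>hartley k\<close> to a multiple of
  \<open>hartley (- k)\<close>. This is harmless, since squared norms are summed over arbitrary
  finite sets of frequencies, which may be reflected.\<close>

abbreviation cell :: "(real^'d) set" where
  "cell \<equiv> cbox 0 (\<chi> i. 2 * pi)"

lemma space_torus [simp]: "space (torus :: (real^'d) measure) = cell"
  by (simp add: torus_def)

lemma emeasure_torus: "emeasure (torus :: (real^'d) measure) cell = ennreal ((2 * pi) ^ CARD('d))"
proof -
  have "measure lborel (cell :: (real^'d) set) = (2 * pi) ^ CARD('d)"
    by (subst content_cbox_cart) (auto simp: box_ne_empty Basis_vec_def inner_axis)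
  moreover have "emeasure lborel (cell :: (real^'d) set) \<noteq> \<infinity>"
    using emeasure_lborel_cbox_finite by (metis infinity_ennreal_def less_irrefl)
  ultimately have "emeasure lborel (cell :: (real^'d) set) = ennreal ((2 * pi) ^ CARD('d))"
    by (subst emeasure_eq_ennreal_measure) simp_all
  then show ?thesis
    by (simp add: torus_def emeasure_restrict_space)
qed

interpretation torus: finite_measure "torus :: (real^'d) measure"
  by standard (simp add: emeasure_torus)

lemma measure_torus: "measure (torus :: (real^'d) measure) cell = (2 * pi) ^ CARD('d)"
  by (simp add: measure_def emeasure_torus)

lemma sets_lebesgue_subset_torus: "f \<in> borel_measurable lebesgue \<Longrightarrow> f \<in> borel_measurable torus"
  unfolding torus_def by (rule measurable_restrict_space1)

lemma continuous_torus_measurable: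
  "continuous_on UNIV f \<Longrightarrow> f \<in> borel_measurable (torus :: (real^'d) measure)"
  by (auto intro!: sets_lebesgue_subset_torus borel_measurable_continuous_onI measurable_completion)

lemma continuous_torus_bounded:
  fixes f :: "real^'d \<Rightarrow> 'b::real_normed_vector"
  assumes "continuous_on UNIV f"
  obtains B where "B \<ge> 0" "\<And>x. x \<in> cell \<Longrightarrow> norm (f x) \<le> B"
proof -
  have "bounded (f ` cell)"
    using assms by (intro compact_imp_bounded compact_continuous_image) (auto intro: continuous_on_subset)
  then obtain B where "\<And>x. x \<in> cell \<Longrightarrow> norm (f x) \<le> B"
    unfolding bounded_iff by blast
  then show ?thesis
    by (intro that[of "max B 0"]) (auto simp: le_max_iff_disj)
qed

lemma continuous_torus_integrable:
  fixes f :: "real^'d \<Rightarrow> 'b::euclidean_space"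
  assumes "continuous_on UNIV f"
  shows "integrable torus f"
proof -
  obtain B where "\<And>x. x \<in> cell \<Longrightarrow> norm (f x) \<le> B"
    using continuous_torus_bounded[OF assms] by blast
  then show ?thesis
    by (intro torus.integrable_const_bound[where B = B] continuous_torus_measurable assms) auto
qed

lemma continuous_torus_integral:
  fixes f :: "real^'d \<Rightarrow> 'b::euclidean_space"
  assumes "continuous_on UNIV f"
  shows "(LINT x|torus. f x) = integral cell f"
  using continuous_torus_integrable[OF assms]
  by (auto simp: torus_def intro!: lebesgue_integral_eq_integral)

text \<open>The shifted cell is cut along the plane where coordinate \<open>i\<close> equals
  \<open>2 * pi\<close>; the piece beyond it, moved back by one period, fills the slab that the
  shift has vacated.\<close>

lemma integral_cell_shift:
  fixes f :: "real^'d \<Rightarrow> 'b::euclidean_space"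
  assumes f: "continuous_on UNIV f" "periodic f" and h: "0 \<le> h" "h \<le> 2 * pi"
  shows "integral cell (\<lambda>x. f (x + h *\<^sub>R axis i 1)) = integral cell f"
proof -
  define b :: "real^'d" where "b = (\<chi> i. 2 * pi)"
  define e :: "real^'d" where "e = axis i 1"
  \<comment> \<open>The upper corner of the vacated slab, in which coordinate \<open>i\<close> runs
    from 0 to \<open>h\<close>.\<close>
  define b1 :: "real^'d" where "b1 = (\<chi> j. if j = i then h else 2 * pi)"
  have int: "f integrable_on cbox c d" for c d
    using f(1) by (intro integrable_continuous) (auto intro: continuous_on_subset)
  have e: "e \<in> Basis" by (simp add: e_def)
  have ek: "x \<bullet> e = x $ i" for x by (simp add: e_def inner_axis)
  have [simp]: "e $ j = (if j = i then 1 else 0)" for j by (simp add: e_def axis_def)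
  have mem_split: "x \<in> cbox c d \<longleftrightarrow> c $ i \<le> x $ i \<and> x $ i \<le> d $ i \<and> (\<forall>j. j \<noteq> i \<longrightarrow> c $ j \<le> x $ j \<and> x $ j \<le> d $ j)"
    for x c d :: "real^'d"
    unfolding mem_box_cart by metis
  have "(2 * pi) *\<^sub>R e = axis i (2 * pi)"
    by (auto simp: e_def axis_def vec_eq_iff)
  then have fe: "f ((2 * pi) *\<^sub>R e + x) = f x" for x
    using f(2) by (simp add: periodic_def add.commute)
  have "integral cell (\<lambda>x. f (x + h *\<^sub>R axis i 1)) = integral (cbox (h *\<^sub>R e) (b + h *\<^sub>R e)) f"
    using integral_shift_cbox_plus[of 0 b f "h *\<^sub>R e"]
    by (simp add: o_def b_def add.commute e_def)
  also have "\<dots> = integral (cbox (h *\<^sub>R e) (b + h *\<^sub>R e) \<inter> {x. x\<bullet>e \<le> 2*pi}) f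
      + integral (cbox (h *\<^sub>R e) (b + h *\<^sub>R e) \<inter> {x. x\<bullet>e \<ge> 2*pi}) f"
    by (rule integral_split[OF int e])
  also have "cbox (h *\<^sub>R e) (b + h *\<^sub>R e) \<inter> {x. x\<bullet>e \<le> 2*pi} = cbox 0 b \<inter> {x. x\<bullet>e \<ge> h}"
    using h by (auto simp: mem_split ek b_def)
  also have "cbox (h *\<^sub>R e) (b + h *\<^sub>R e) \<inter> {x. x\<bullet>e \<ge> 2*pi} = cbox (0 + (2*pi) *\<^sub>R e) (b1 + (2*pi) *\<^sub>R e)"
    using h by (auto simp: mem_split ek b_def b1_def)
  also have "integral \<dots> f = integral (cbox 0 b1) f"
    unfolding integral_shift_cbox_plus[symmetric] unfolding o_def fe by simp
  also have "cbox 0 b1 = cbox 0 b \<inter> {x. x\<bullet>e \<le> h}"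
    using h by (auto simp: mem_split ek b_def b1_def)
  also have "integral (cbox 0 b \<inter> {x. x\<bullet>e \<ge> h}) f + integral (cbox 0 b \<inter> {x. x\<bullet>e \<le> h}) f
      = integral (cbox 0 b) f"
    using integral_split[OF int e, of 0 b h] by (simp add: add.commute)
  finally show ?thesis by (simp add: b_def)
qed

text \<open>Shift invariance turns \<open>2 * pi\<close> times the integral into an integral over
  all shifts \<open>h\<close>; after exchanging the order of integration, the inner integral over
  \<open>h\<close> is the increment of \<open>F\<close> over one period.\<close>

lemma integral_cell_derivative:
  fixes f :: "real^'d \<Rightarrow> 'b::euclidean_space"
  assumes f: "continuous_on UNIV f" "periodic f" and F: "periodic F"
    and deriv: "\<And>x. ((\<lambda>h. F (x + h *\<^sub>R axis i 1)) has_vector_derivative f x) (at 0)"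
  shows "integral cell f = 0"
proof -
  define e :: "real^'d" where "e = axis i 1"
  have cont: "continuous_on (cbox (0::real, 0) (2 * pi, \<chi> i. 2 * pi)) (\<lambda>(h, x). f (x + h *\<^sub>R e))"
    unfolding case_prod_unfold
    by (intro continuous_on_compose2[OF f(1)] continuous_intros) auto
  have FTC: "integral (cbox 0 (2 * pi)) (\<lambda>h. f (x + h *\<^sub>R e)) = 0" for x
  proof -
    have "((\<lambda>h. F (x + h *\<^sub>R e)) has_vector_derivative f (x + h *\<^sub>R e)) (at h)" for h
    proof -
      have "((\<lambda>s. F (x + h *\<^sub>R e + s *\<^sub>R e)) has_vector_derivative f (x + h *\<^sub>R e)) (at (h - h))"
        using deriv[of "x + h *\<^sub>R e"] by (simp add: e_def)
      then have "((\<lambda>s. F (x + h *\<^sub>R e + s *\<^sub>R e)) \<circ> (\<lambda>s. s - h) has_vector_derivative 1 *\<^sub>R f (x + h *\<^sub>R e)) (at h)"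
        by (intro vector_diff_chain_at) (auto intro!: derivative_eq_intros)
      then show ?thesis by (simp add: o_def algebra_simps)
    qed
    then have "((\<lambda>h. f (x + h *\<^sub>R e)) has_integral (F (x + (2*pi) *\<^sub>R e) - F (x + 0 *\<^sub>R e))) {0..2 * pi}"
      by (intro fundamental_theorem_of_calculus) (auto intro: has_vector_derivative_at_within)
    moreover have "(2 * pi) *\<^sub>R e = axis i (2 * pi)"
      by (auto simp: e_def axis_def vec_eq_iff)
    ultimately show ?thesis
      using F by (simp add: periodic_def integral_unique)
  qed
  have "(2 * pi) *\<^sub>R integral cell f = integral (cbox 0 (2 * pi)) (\<lambda>h. integral cell (\<lambda>x. f (x + h *\<^sub>R e)))"
    by (subst integral_cong[where g = "\<lambda>h. integral cell f"])
      (auto simp: e_def integral_cell_shift[OF f])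
  also have "\<dots> = integral cell (\<lambda>x. integral (cbox 0 (2 * pi)) (\<lambda>h. f (x + h *\<^sub>R e)))"
    by (rule integral_swap_continuous[OF cont])
  also have "\<dots> = 0" unfolding FTC by simp
  finally show ?thesis by simp
qed

section \<open>The Hartley system\<close>

definition lattice :: "(real^'d) set" where
  "lattice = {m. \<forall>i. m $ i \<in> \<int>}"

text \<open>The kernel cas of the Hartley transform. \<open>hartley k\<close> and
  \<open>hartley (- k)\<close> span the cosine and the sine at frequency \<open>k\<close>, so each
  lattice point contributes one real function and no half of the lattice has to be selected.\<close>

definition hartley :: "real^'d \<Rightarrow> real^'d \<Rightarrow> real" where
  "hartley k x = cos (k \<bullet> x) + sin (k \<bullet> x)"

lemma lattice_zero [simp]: "0 \<in> lattice"
  and lattice_minus: "k \<in> lattice \<Longrightarrow> - k \<in> lattice"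
  and lattice_add: "k \<in> lattice \<Longrightarrow> l \<in> lattice \<Longrightarrow> k + l \<in> lattice"
  and lattice_diff: "k \<in> lattice \<Longrightarrow> l \<in> lattice \<Longrightarrow> k - l \<in> lattice"
  and lattice_axis [simp]: "axis i 1 \<in> lattice"
  by (auto simp: lattice_def axis_def)

lemma lattice_minus_iff [simp]: "- k \<in> lattice \<longleftrightarrow> k \<in> lattice"
  using lattice_minus[of k] lattice_minus[of "- k"] by auto

lemma lattice_sign_iff [simp]: "(- 1) ^ n *\<^sub>R k \<in> lattice \<longleftrightarrow> k \<in> lattice"
  by (cases "even n") auto

lemma hartley_zero [simp]: "hartley 0 = (\<lambda>x. 1)"
  by (auto simp: hartley_def)

lemma hartley_continuous [continuous_intros]: "continuous_on A (hartley k)"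
  unfolding hartley_def by (intro continuous_intros)

lemma abs_hartley_le: "\<bar>hartley k x\<bar> \<le> 2"
proof -
  have "\<bar>cos (k \<bullet> x) + sin (k \<bullet> x)\<bar> \<le> \<bar>cos (k \<bullet> x)\<bar> + \<bar>sin (k \<bullet> x)\<bar>"
    by (rule abs_triangle_ineq)
  also have "\<dots> \<le> 1 + 1"
    by (intro add_mono) auto
  finally show ?thesis by (simp add: hartley_def)
qed

text \<open>The outer \<open>F\<close> covers scalar functions and vector-valued ones such as
  \<open>hartley k x *\<^sub>R v\<close> at once.\<close>

lemma hartley_periodic:
  assumes "k \<in> lattice"
  shows "periodic (\<lambda>x. F (hartley k x))"
  unfolding periodic_def
proof (intro allI)
  fix i x
  obtain n where n: "k $ i = of_int n"
    using assms by (auto simp: lattice_def elim!: Ints_cases)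
  have "k \<bullet> (x + axis i (2 * pi)) = k \<bullet> x + 2 * pi * of_int n"
    by (simp add: inner_add_right inner_axis n mult.commute)
  then show "F (hartley k (x + axis i (2 * pi))) = F (hartley k x)"
    by (simp add: hartley_def cos_add sin_add)
qed

text \<open>With a = \<open>k \<bullet> x\<close> and b = \<open>l \<bullet> x\<close> the product
  is cos (a - b) + sin (a + b); cosine and sine are then written as the even and odd parts of
  Hartley functions.\<close>

lemma hartley_mult:
  "hartley k x * hartley l x
     = (hartley (k - l) x + hartley (l - k) x + hartley (k + l) x - hartley (- k - l) x) / 2"
proof -
  have "sin (- (k \<bullet> x) - l \<bullet> x) = - sin (k \<bullet> x + l \<bullet> x)" "cos (- (k \<bullet> x) - l \<bullet> x) = cos (k \<bullet> x + l \<bullet> x)"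
    by (metis minus_add_distrib diff_conv_add_uminus sin_minus cos_minus)+
  then show ?thesis
    by (simp add: hartley_def inner_add_left inner_diff_left inner_minus_left field_simps
        cos_add sin_add cos_diff sin_diff)
qed

lemma hartley_has_derivative:
  "((\<lambda>x. hartley k x *\<^sub>R v) has_derivative (\<lambda>h. ((k \<bullet> h) * hartley (- k) x) *\<^sub>R v)) (at x)"
  unfolding hartley_def
  by (auto intro!: derivative_eq_intros simp: algebra_simps)

lemma LINT_hartley:
  fixes k :: "real^'d"
  assumes "k \<in> lattice"
  shows "(LINT x|torus. hartley k x) = (if k = 0 then (2 * pi) ^ CARD('d) else 0)"
proof (cases "k = 0")
  case False
  then obtain i where i: "k $ i \<noteq> 0" by (auto simp: vec_eq_iff)
  \<comment> \<open>Differentiation reverses the frequency, so a primitive in direction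
    \<open>i\<close> is \<open>- hartley (- k)\<close>.\<close>
  have "integral cell (\<lambda>x. k $ i * hartley k x) = 0"
  proof (rule integral_cell_derivative[where F = "\<lambda>x. - hartley (- k) x" and i = i])
    fix x
    have "((\<lambda>h. hartley (- k) (x + h *\<^sub>R axis i 1) *\<^sub>R (- 1 :: real)) has_vector_derivative
        ((- k \<bullet> axis i 1) * hartley k (x + 0 *\<^sub>R axis i 1)) *\<^sub>R (- 1)) (at 0)"
    proof -
      have "((\<lambda>h. x + h *\<^sub>R axis i 1) has_derivative (\<lambda>h. h *\<^sub>R axis i 1)) (at 0)"
        by (auto intro!: derivative_eq_intros)
      from has_derivative_compose[OF this hartley_has_derivative[where v = "- 1 :: real" and k = "- k"]]
      show ?thesis
        unfolding has_vector_derivative_def by (simp add: algebra_simps)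
    qed
    then show "((\<lambda>h. - hartley (- k) (x + h *\<^sub>R axis i 1)) has_vector_derivative k $ i * hartley k x) (at 0)"
      by (simp add: inner_axis)
  qed (use assms in \<open>auto intro!: continuous_intros hartley_periodic\<close>)
  with i False show ?thesis
    by (simp add: continuous_torus_integral hartley_continuous)
qed (simp add: measure_torus)

text \<open>In \<open>hartley_mult\<close> the first two terms have frequency 0 exactly when
  \<open>k = l\<close>; the last two have frequency 0 simultaneously, and then cancel.\<close>

lemma LINT_hartley_mult:
  fixes k l :: "real^'d"
  assumes "k \<in> lattice" "l \<in> lattice"
  shows "(LINT x|torus. hartley k x * hartley l x) = (if k = l then (2 * pi) ^ CARD('d) else 0)"
proof -
  have I: "integrable torus (hartley m)" for m :: "real^'d"
    by (intro continuous_torus_integrable continuous_intros)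
  have "- k - l \<in> lattice" "k - l = 0 \<longleftrightarrow> k = l" "l - k = 0 \<longleftrightarrow> k = l" "- k - l = 0 \<longleftrightarrow> k + l = 0"
    using assms lattice_diff[of "- k" l] by (auto simp: algebra_simps) (metis add_eq_0_iff)
  then show ?thesis
    using assms by (simp add: hartley_mult I LINT_hartley lattice_add lattice_diff)
qed

text \<open>The signs alternate because each differentiation replaces \<open>k\<close> by \<open>- k\<close>.\<close>

fun hartley_symbol :: "real^'d \<Rightarrow> (real^'d) list \<Rightarrow> real" where
  "hartley_symbol k [] = 1"
| "hartley_symbol k (b # bs) = hartley_symbol k bs * ((- 1) ^ length bs * (k \<bullet> b))"

lemma hartley_symbol_square: "(hartley_symbol k bs)\<^sup>2 = (\<Prod>b\<leftarrow>bs. (k \<bullet> b)\<^sup>2)"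
  by (induction bs) (auto simp: power_mult_distrib mult.commute power_mult[symmetric])

lemma partial_derivs_hartley:
  "partial_derivs bs (\<lambda>x. hartley k x *\<^sub>R v)
     = (\<lambda>x. hartley ((- 1) ^ length bs *\<^sub>R k) x *\<^sub>R (hartley_symbol k bs *\<^sub>R v))"
proof (induction bs)
  case (Cons b bs)
  let ?k = "(- 1) ^ length bs *\<^sub>R k"
  have "partial_deriv b (\<lambda>x. hartley ?k x *\<^sub>R (hartley_symbol k bs *\<^sub>R v))
      = (\<lambda>x. ((?k \<bullet> b) * hartley (- ?k) x) *\<^sub>R (hartley_symbol k bs *\<^sub>R v))"
    unfolding partial_deriv_def
    by (subst frechet_derivative_at[symmetric, OF hartley_has_derivative]) simp
  then show ?case
    using Cons by (auto simp: algebra_simps)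
qed simp

lemma hartley_torus_smooth:
  assumes "k \<in> lattice"
  shows "(\<lambda>x. hartley k x *\<^sub>R v) \<in> torus_smooth"
  using assms hartley_periodic[where F = "\<lambda>r. r *\<^sub>R v"] differentiableI[OF hartley_has_derivative]
  by (auto simp: torus_smooth_def smooth_def partial_derivs_hartley simp del: scaleR_scaleR)

lemmas partial_derivs_hartley_real = partial_derivs_hartley[where v = "1 :: real", simplified]
lemmas hartley_torus_smooth_real = hartley_torus_smooth[where v = "1 :: real", simplified]

section \<open>Trigonometric polynomials\<close>

text \<open>Only the linear span is generated; closure under products, which Stone-Weierstrass
  requires, comes from \<open>hartley_mult\<close>.\<close>

inductive_set trig_poly :: "(real^'d \<Rightarrow> real) set" where
  hartley: "k \<in> lattice \<Longrightarrow> hartley k \<in> trig_poly"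
| add: "P \<in> trig_poly \<Longrightarrow> Q \<in> trig_poly \<Longrightarrow> (\<lambda>x. P x + Q x) \<in> trig_poly"
| scale: "P \<in> trig_poly \<Longrightarrow> (\<lambda>x. c * P x) \<in> trig_poly"

lemma trig_poly_mult_hartley:
  assumes "P \<in> trig_poly" "k \<in> lattice"
  shows "(\<lambda>x. hartley k x * P x) \<in> trig_poly"
  using assms(1)
proof induction
  case (hartley l)
  have "- k - l \<in> lattice"
    using assms(2) hartley lattice_diff[of "- k" l] by auto
  have "(\<lambda>x. (1/2) * ((hartley (k - l) x + hartley (l - k) x) + (hartley (k + l) x + (- 1) * hartley (- k - l) x))) \<in> trig_poly"
    by (intro trig_poly.intros lattice_diff lattice_add assms(2) hartley \<open>- k - l \<in> lattice\<close>)
  then show ?case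
    by (simp add: hartley_mult algebra_simps add_divide_distrib diff_divide_distrib)
next
  case (add P Q)
  then show ?case
    using trig_poly.add[OF add.IH] by (simp add: algebra_simps)
next
  case (scale P c)
  then show ?case
    using trig_poly.scale[OF scale.IH, of c] by (simp add: algebra_simps)
qed

lemma trig_poly_mult:
  assumes "P \<in> trig_poly" "Q \<in> trig_poly"
  shows "(\<lambda>x. P x * Q x) \<in> trig_poly"
  using assms(1)
proof induction
  case (hartley k)
  then show ?case by (rule trig_poly_mult_hartley[OF assms(2)])
next
  case (add P Q)
  then show ?case
    using trig_poly.add[OF add.IH] by (simp add: algebra_simps)
next
  case (scale P c)
  then show ?case
    using trig_poly.scale[OF scale.IH, of c] by (simp add: algebra_simps)
qed

lemma trig_poly_const: "(\<lambda>x. c) \<in> trig_poly"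
  using trig_poly.scale[OF trig_poly.hartley[OF lattice_zero], of c] by simp

lemma trig_poly_representation:
  assumes "P \<in> trig_poly"
  obtains K c where "finite K" "K \<subseteq> lattice" "P = (\<lambda>x. \<Sum>k\<in>K. c k * hartley k x)"
proof -
  have "\<exists>K c. finite K \<and> K \<subseteq> lattice \<and> P = (\<lambda>x. \<Sum>k\<in>K. c k * hartley k x)"
    using assms
  proof induction
    case (hartley k)
    then show ?case by (intro exI[of _ "{k}"] exI[of _ "\<lambda>_. 1"]) auto
  next
    case (add P Q)
    then obtain K c L d where K: "finite K" "K \<subseteq> lattice" "P = (\<lambda>x. \<Sum>k\<in>K. c k * hartley k x)"
      and L: "finite L" "L \<subseteq> lattice" "Q = (\<lambda>x. \<Sum>k\<in>L. d k * hartley k x)" by blast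
    have "(\<Sum>k\<in>K. c k * hartley k x) = (\<Sum>k\<in>K \<union> L. (if k \<in> K then c k else 0) * hartley k x)"
      "(\<Sum>k\<in>L. d k * hartley k x) = (\<Sum>k\<in>K \<union> L. (if k \<in> L then d k else 0) * hartley k x)" for x
      using K(1) L(1) by (auto intro!: sum.mono_neutral_cong_left)
    then show ?case
      using K L by (intro exI[of _ "K \<union> L"] exI[of _ "\<lambda>k. (if k \<in> K then c k else 0) + (if k \<in> L then d k else 0)"])
        (auto simp: distrib_right sum.distrib)
  next
    case (scale P a)
    then obtain K c where K: "finite K" "K \<subseteq> lattice" "P = (\<lambda>x. \<Sum>k\<in>K. c k * hartley k x)" by blast
    then show ?case
      by (intro exI[of _ K] exI[of _ "\<lambda>k. a * c k"]) (auto simp: sum_distrib_left mult.assoc)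
  qed
  then show ?thesis using that by blast
qed

lemma trig_poly_continuous: "P \<in> trig_poly \<Longrightarrow> continuous_on A P"
  by (induction rule: trig_poly.induct) (auto intro!: continuous_intros)

text \<open>Stone-Weierstrass on the compact set of complex vectors with unimodular entries. The
  algebra consists of the continuous functions whose pullback under coordinatewise
  \<open>cis\<close> is a trigonometric polynomial; real and imaginary parts of the entries separate
  points.\<close>

lemma trig_poly_uniformly_dense:
  fixes f :: "complex^'d \<Rightarrow> real"
  assumes f: "continuous_on {z. \<forall>i. norm (z $ i) = 1} f" and "e > 0"
  obtains P where "P \<in> trig_poly" "\<And>x. \<bar>f (\<chi> i. cis (x $ i)) - P x\<bar> < e"
proof -
  define S :: "(complex^'d) set" where "S = {z. \<forall>i. norm (z $ i) = 1}"
  define E :: "real^'d \<Rightarrow> complex^'d" where "E x = (\<chi> i. cis (x $ i))" for x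
  define R where "R = {g. continuous_on S g \<and> (\<lambda>x. g (E x)) \<in> trig_poly}"
  have ES: "E x \<in> S" for x by (simp add: E_def S_def)
  have "closed S"
    unfolding S_def by (intro closed_Collect_all closed_Collect_eq continuous_intros)
  moreover have "norm z \<le> real CARD('d)" if "z \<in> S" for z
    using norm_le_componentwise_cart[of z "\<chi> i. 1"] L2_set_le_sum_abs[of "\<lambda>i. norm (z $ i)" UNIV] that
    by (simp add: norm_vec_def S_def)
  ultimately have "compact S"
    unfolding compact_eq_bounded_closed bounded_iff by blast
  have hart: "(\<lambda>x. cos (x $ i)) \<in> trig_poly" "(\<lambda>x. sin (x $ i)) \<in> trig_poly" for i :: 'd
  proof -
    have "(\<lambda>x. (1/2) * (hartley (axis i 1) x + hartley (- axis i 1) x)) \<in> trig_poly"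
      "(\<lambda>x. (1/2) * (hartley (axis i 1) x + (- 1) * hartley (- axis i 1) x)) \<in> trig_poly"
      by (intro trig_poly.intros lattice_minus lattice_axis)+
    then show "(\<lambda>x. cos (x $ i)) \<in> trig_poly" "(\<lambda>x. sin (x $ i)) \<in> trig_poly"
      by (simp_all add: hartley_def inner_axis')
  qed
  have re: "(\<lambda>z. Re (z $ i)) \<in> R" and im: "(\<lambda>z. Im (z $ i)) \<in> R" for i
    using hart[of i] by (auto simp: R_def E_def intro!: continuous_intros)
  interpret function_ring_on R S
  proof
    fix z w assume "z \<in> S" "w \<in> S" "z \<noteq> w"
    then obtain i where "z $ i \<noteq> w $ i" by (auto simp: vec_eq_iff)
    then show "\<exists>g\<in>R. g z \<noteq> g w"
      using re[of i] im[of i] by (metis complex_eqI)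
  qed (auto simp: R_def \<open>compact S\<close> intro!: continuous_intros trig_poly.add trig_poly_mult trig_poly_const)
  obtain g where "g \<in> R" "\<And>z. z \<in> S \<Longrightarrow> \<bar>f z - g z\<bar> < e"
    using Stone_Weierstrass_basic[OF f[folded S_def] \<open>e > 0\<close>] by blast
  then show ?thesis
    using ES by (intro that[of "\<lambda>x. g (E x)"]) (auto simp: R_def E_def)
qed

lemma AE_torusI: "AE x in lebesgue. Q x \<Longrightarrow> AE x in torus. Q x"
  unfolding torus_def by (subst AE_restrict_space_iff) (simp, erule eventually_mono, simp)

text \<open>A measurable function is an almost everywhere limit of continuous ones. These are not
  periodic, so they are cut off near the faces of the cell before the uniform approximation is
  applied. Clipping keeps them within \<open>M\<close>, and the approximation error, at most 1,
  accounts for the bound \<open>M + 1\<close>.\<close>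

lemma trig_poly_dense:
  fixes g :: "real^'d \<Rightarrow> real"
  assumes g: "g \<in> borel_measurable torus" and M: "\<And>x. \<bar>g x\<bar> \<le> M"
  obtains P where "\<And>n. P n \<in> trig_poly" "\<And>n x. \<bar>P n x\<bar> \<le> M + 1"
    "AE x in torus. (\<lambda>n. P n x) \<longlonglongrightarrow> g x"
proof -
  define S :: "(complex^'d) set" where "S = {z. \<forall>i. norm (z $ i) = 1}"
  define E :: "real^'d \<Rightarrow> complex^'d" where "E x = (\<chi> i. cis (x $ i))" for x
  define L :: "complex^'d \<Rightarrow> real^'d" where "L z = (\<chi> i. Arg2pi (z $ i))" for z
  have ES: "E x \<in> S" for x by (simp add: E_def S_def)
  have "M \<ge> 0" using M[of 0] by linarith
  have "(\<lambda>x. if x \<in> cell then g x else 0) \<in> borel_measurable lebesgue"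
    using g by (simp add: torus_def borel_measurable_if)
  then have "(\<lambda>x. if x \<in> cell then g x else 0) measurable_on UNIV"
    by (intro lebesgue_measurable_imp_measurable_on_real) auto
  then obtain N G where N: "negligible N" and G: "\<And>n. continuous_on UNIV (G n)"
    and lim: "\<And>x. x \<notin> N \<Longrightarrow> (\<lambda>n. G n x) \<longlonglongrightarrow> (if x \<in> cell then g x else 0)"
    unfolding measurable_on_def by auto
  \<comment> \<open>the cutoff \<open>\<zeta>\<close> vanishes near \<open>z = 1\<close>, where the inverse \<open>L\<close> of \<open>E\<close> jumps\<close>
  define clip where "clip r = max (- M) (min M r)" for r
  define \<zeta> :: "nat \<Rightarrow> complex \<Rightarrow> real" where "\<zeta> n z = min 1 (max 0 (real (Suc n) * norm (z - 1) - 1))" for n z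
  define h where "h n z = (\<Prod>i\<in>UNIV. \<zeta> n (z $ i)) * clip (G n (L z))" for n z
  have \<zeta>01: "0 \<le> \<zeta> n z" "\<zeta> n z \<le> 1" for n z by (auto simp: \<zeta>_def)
  have clip: "\<bar>clip r\<bar> \<le> M" for r using \<open>M \<ge> 0\<close> by (auto simp: clip_def)
  have hM: "\<bar>h n z\<bar> \<le> M" for n z
  proof -
    have "\<bar>\<Prod>i\<in>UNIV. \<zeta> n (z $ i)\<bar> \<le> 1"
      using \<zeta>01 by (simp add: prod_nonneg prod_le_1)
    then have "\<bar>\<Prod>i\<in>UNIV. \<zeta> n (z $ i)\<bar> * \<bar>clip (G n (L z))\<bar> \<le> 1 * M"
      using clip by (intro mult_mono) auto
    then show ?thesis by (simp add: h_def abs_mult)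
  qed
  have cont: "continuous_on S (h n)" for n
  proof -
    \<comment> \<open>\<open>A\<close> and \<open>B\<close> are closed and cover \<open>S\<close>.
      On \<open>A\<close> the arguments are continuous, on \<open>B\<close> the cutoff makes
      \<open>h n\<close> vanish; the two pieces are pasted.\<close>
    define A where "A = {z \<in> S. \<forall>i. norm (z $ i - 1) \<ge> 1 / Suc n}"
    define B where "B = {z \<in> S. \<exists>i. norm (z $ i - 1) \<le> 1 / Suc n}"
    have "closed S"
      unfolding S_def by (intro closed_Collect_all closed_Collect_eq continuous_intros)
    moreover have "A = S \<inter> {z. \<forall>i. norm (z $ i - 1) \<ge> 1 / Suc n}"
      and "B = S \<inter> (\<Union>i. {z. norm (z $ i - 1) \<le> 1 / Suc n})"
      by (auto simp: A_def B_def)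
    moreover have "closed {z::complex^'d. \<forall>i. norm (z $ i - 1) \<ge> 1 / Suc n}"
      by (intro closed_Collect_all closed_Collect_le continuous_intros)
    moreover have "closed {z::complex^'d. norm (z $ i - 1) \<le> 1 / Suc n}" for i
      by (intro closed_Collect_le continuous_intros)
    ultimately have "closed A" "closed B"
      by (simp_all add: closed_Int closed_UN)
    have "continuous_on A (\<lambda>z. Arg2pi (z $ i))" for i
    proof (rule continuous_on_compose2[of "- \<real>\<^sub>\<ge>\<^sub>0" Arg2pi])
      show "continuous_on (- \<real>\<^sub>\<ge>\<^sub>0) Arg2pi"
        using continuous_at_Arg2pi continuous_at_imp_continuous_on by blast
      show "(\<lambda>z. z $ i) ` A \<subseteq> - \<real>\<^sub>\<ge>\<^sub>0"
      proof clarsimp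
        fix z assume z: "z \<in> A" "z $ i \<in> \<real>\<^sub>\<ge>\<^sub>0"
        then have "norm (z $ i) = 1" "norm (z $ i - 1) \<ge> 1 / Suc n" by (auto simp: A_def S_def)
        moreover from z(2) obtain r where "r \<ge> 0" "z $ i = of_real r"
          by (auto elim: nonneg_Reals_cases)
        ultimately have "z $ i = 1" by simp
        then show False using \<open>norm (z $ i - 1) \<ge> 1 / Suc n\<close> by simp
      qed
    qed (intro continuous_intros)
    then have "continuous_on A L"
      unfolding L_def by (intro continuous_on_vec_lambda)
    then have "continuous_on A (h n)"
      unfolding h_def clip_def \<zeta>_def
      by (intro continuous_intros continuous_on_compose2[OF G]) auto
    moreover have "continuous_on B (h n)"
    proof -
      have "h n z = 0" if z: "z \<in> B" for z
      proof -
        obtain i where "norm (z $ i - 1) \<le> 1 / Suc n" using z by (auto simp: B_def)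
        then have "\<zeta> n (z $ i) = 0" by (simp add: \<zeta>_def field_simps)
        then show ?thesis unfolding h_def by (metis UNIV_I finite mult_zero_left prod_zero)
      qed
      then show ?thesis by (simp cong: continuous_on_cong)
    qed
    moreover have "S = A \<union> B" by (auto simp: A_def B_def) (meson linear)
    ultimately show ?thesis
      using \<open>closed A\<close> \<open>closed B\<close> by (metis continuous_on_closed_Un)
  qed
  have "\<exists>P. P \<in> trig_poly \<and> (\<forall>x. \<bar>h n (E x) - P x\<bar> < 1 / Suc n)" for n
    using trig_poly_uniformly_dense[OF cont[of n, unfolded S_def], of "1 / Suc n"]
    unfolding E_def by (metis of_nat_0_less_iff zero_less_Suc zero_less_divide_1_iff)
  then obtain P where P: "\<And>n. P n \<in> trig_poly" and Ph: "\<And>n x. \<bar>h n (E x) - P n x\<bar> < 1 / Suc n"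
    by metis
  show ?thesis
  proof
    show "P n \<in> trig_poly" for n by (rule P)
    show "\<bar>P n x\<bar> \<le> M + 1" for n x
    proof -
      have "1 / real (Suc n) \<le> 1" by simp
      then show ?thesis using Ph[where n=n and x=x] hM[of n "E x"] by linarith
    qed
    \<comment> \<open>Almost every point of the cell lies in its interior, where \<open>L\<close>
      inverts \<open>E\<close> and the cutoffs are eventually 1.\<close>
    have "AE x in lebesgue. x \<notin> N \<and> x \<notin> cell - box 0 (\<chi> i. 2 * pi)"
      using N negligible_frontier_interval[of 0 "\<chi> i::'d. 2 * pi"]
      unfolding negligible_iff_null_sets by (intro AE_conjI AE_not_in)
    then have "AE x in torus. x \<notin> N \<and> x \<notin> cell - box 0 (\<chi> i. 2 * pi)"
      by (rule AE_torusI)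
    moreover have "AE x in torus. x \<in> (cell :: (real^'d) set)"
      using AE_space[of torus] by simp
    ultimately show "AE x in torus. (\<lambda>n. P n x) \<longlonglongrightarrow> g x"
    proof eventually_elim
      case (elim x)
      show ?case
      proof -
        have x: "0 < x $ i" "x $ i < 2 * pi" for i using elim by (auto simp: mem_box_cart)
        have LE: "L (E x) = x"
        proof -
          have "Arg2pi (cis (x $ i)) = x $ i" for i
            by (rule Arg2pi_unique[where r = 1]) (use x[of i] in \<open>simp_all add: cis_conv_exp\<close>)
          then show ?thesis by (simp add: L_def E_def vec_eq_iff)
        qed
        have "(\<lambda>n. \<zeta> n (E x $ i)) \<longlonglongrightarrow> 1" for i
        proof -
          have "cis (x $ i) \<noteq> 1"
            using x[of i] arg_cong[OF LE, of "\<lambda>y. y $ i"] Arg2pi_of_real[of 1] by (auto simp: L_def E_def)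
          then have pos: "norm (E x $ i - 1) > 0" by (simp add: E_def)
          obtain n0 :: nat where "2 / norm (E x $ i - 1) < n0" using reals_Archimedean2 by blast
          have "\<zeta> n (E x $ i) = 1" if "n0 \<le> n" for n
          proof -
            have "2 / norm (E x $ i - 1) \<le> real (Suc n)" using that \<open>_ < real n0\<close> by linarith
            then have "2 \<le> real (Suc n) * norm (E x $ i - 1)" using pos by (simp add: field_simps)
            then show ?thesis by (simp add: \<zeta>_def)
          qed
          then have "eventually (\<lambda>n. \<zeta> n (E x $ i) = 1) sequentially"
            by (rule eventually_sequentiallyI)
          then show ?thesis by (rule tendsto_eventually)
        qed
        then have "(\<lambda>n. \<Prod>i\<in>UNIV. \<zeta> n (E x $ i)) \<longlonglongrightarrow> (\<Prod>i::'d\<in>UNIV. 1)"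
          by (intro tendsto_prod)
        moreover have "(\<lambda>n. G n x) \<longlonglongrightarrow> g x" using lim[of x] elim by simp
        then have "(\<lambda>n. clip (G n x)) \<longlonglongrightarrow> clip (g x)"
          unfolding clip_def by (intro tendsto_intros)
        moreover have "clip (g x) = g x" using M[of x] by (auto simp: clip_def)
        ultimately have "(\<lambda>n. h n (E x)) \<longlonglongrightarrow> g x"
          unfolding h_def LE by (auto dest: tendsto_mult)
        moreover have "(\<lambda>n. h n (E x) - P n x) \<longlonglongrightarrow> 0"
        proof (rule Lim_null_comparison[OF _ LIMSEQ_inverse_real_of_nat])
          show "\<forall>\<^sub>F n in sequentially. norm (h n (E x) - P n x) \<le> inverse (real (Suc n))"
            using Ph by (simp add: inverse_eq_divide less_imp_le)
        qed
        ultimately have "(\<lambda>n. h n (E x) - (h n (E x) - P n x)) \<longlonglongrightarrow> g x - 0"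
          by (rule tendsto_diff)
        then show ?thesis by simp
      qed
    qed
  qed
qed

section \<open>Hartley coefficients\<close>

text \<open>Not normalised: each Hartley function with lattice frequency has squared norm
  \<open>(2 * pi) ^ CARD('d)\<close>, and this factor reappears in the inequalities between
  coefficients and integrals.\<close>

definition hcoef :: "real^'d \<Rightarrow> (real^'d \<Rightarrow> 'b::euclidean_space) \<Rightarrow> 'b" where
  "hcoef k f = (LINT x|torus. hartley k x *\<^sub>R f x)"

lemma integrable_bounded_mult:
  fixes f :: "'a \<Rightarrow> 'b::euclidean_space"
  assumes "integrable M f" "P \<in> borel_measurable M" "\<And>x. x \<in> space M \<Longrightarrow> \<bar>P x\<bar> \<le> B"
  shows "integrable M (\<lambda>x. P x *\<^sub>R f x)"
proof (rule Bochner_Integration.integrable_bound)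
  show "integrable M (\<lambda>x. B *\<^sub>R f x)" using assms(1) by simp
  show "AE x in M. norm (P x *\<^sub>R f x) \<le> norm (B *\<^sub>R f x)"
    using assms(3) by (intro AE_I2) (force intro: mult_right_mono)
qed (use assms in \<open>auto intro!: borel_measurable_scaleR\<close>)

lemma integrable_continuous_mult:
  fixes f :: "real^'d \<Rightarrow> 'b::euclidean_space"
  assumes "integrable torus f" "continuous_on UNIV P"
  shows "integrable torus (\<lambda>x. P x *\<^sub>R f x)"
proof -
  obtain B where "\<And>x. x \<in> cell \<Longrightarrow> norm (P x) \<le> B"
    using continuous_torus_bounded[OF assms(2)] by blast
  then show ?thesis
    using assms by (intro integrable_bounded_mult[where B = B] continuous_torus_measurable) auto
qed

lemma hcoef_integrable:
  fixes f :: "real^'d \<Rightarrow> 'b::euclidean_space"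
  shows
  "integrable torus f \<Longrightarrow> integrable torus (\<lambda>x. hartley k x *\<^sub>R f x)"
  by (intro integrable_continuous_mult continuous_intros)

lemma hcoef_inner:
  "integrable torus f \<Longrightarrow> hcoef k f \<bullet> b = hcoef k (\<lambda>x. f x \<bullet> b)"
  using integral_inner_left[of b torus "\<lambda>x. hartley k x *\<^sub>R f x"] hcoef_integrable[of f k]
  by (simp add: hcoef_def)

lemma hcoef_diff:
  "integrable torus f \<Longrightarrow> integrable torus g \<Longrightarrow> hcoef k (\<lambda>x. f x - g x) = hcoef k f - hcoef k g"
  using Bochner_Integration.integral_diff[OF hcoef_integrable hcoef_integrable, of f g k k]
  by (simp add: hcoef_def scaleR_diff_right)

lemma trig_poly_pairing:
  fixes f :: "real^'d \<Rightarrow> real"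
  assumes f: "integrable torus f" and K: "P = (\<lambda>x. \<Sum>k\<in>K. c k * hartley k x)"
  shows "(LINT x|torus. P x * f x) = (\<Sum>k\<in>K. c k * hcoef k f)"
proof -
  have "(LINT x|torus. P x * f x) = (LINT x|torus. (\<Sum>k\<in>K. c k * (hartley k x *\<^sub>R f x)))"
    unfolding K by (simp add: sum_distrib_right mult.assoc)
  also have "\<dots> = (\<Sum>k\<in>K. LINT x|torus. c k * (hartley k x *\<^sub>R f x))"
    by (intro Bochner_Integration.integral_sum integrable_mult_right hcoef_integrable f)
  finally show ?thesis by (simp add: hcoef_def)
qed

lemma trig_poly_hcoef:
  fixes P :: "real^'d \<Rightarrow> real"
  assumes K: "finite K" "K \<subseteq> lattice" "P = (\<lambda>x. \<Sum>k\<in>K. c k * hartley k x)" and "l \<in> K"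
  shows "hcoef l P = (2 * pi) ^ CARD('d) * c l"
proof -
  have l: "integrable torus (hartley l)"
    by (intro continuous_torus_integrable continuous_intros)
  have "hcoef l P = (\<Sum>k\<in>K. c k * hcoef k (hartley l))"
    using trig_poly_pairing[OF l K(3)] by (simp add: hcoef_def mult.commute)
  also have "\<dots> = (\<Sum>k\<in>K. if k = l then c k * (2 * pi) ^ CARD('d) else 0)"
    using K(2) \<open>l \<in> K\<close> by (intro sum.cong) (auto simp: hcoef_def LINT_hartley_mult subset_iff)
  finally show ?thesis
    using K(1) \<open>l \<in> K\<close> by simp
qed

lemma trig_poly_square:
  fixes P :: "real^'d \<Rightarrow> real"
  assumes K: "finite K" "K \<subseteq> lattice" "P = (\<lambda>x. \<Sum>k\<in>K. c k * hartley k x)"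
  shows "(LINT x|torus. (P x)\<^sup>2) = (2 * pi) ^ CARD('d) * (\<Sum>k\<in>K. (c k)\<^sup>2)"
proof -
  have "integrable torus P"
    unfolding K(3) by (intro continuous_torus_integrable continuous_intros)
  then have "(LINT x|torus. (P x)\<^sup>2) = (\<Sum>k\<in>K. c k * hcoef k P)"
    using trig_poly_pairing[OF _ K(3)] by (simp add: power2_eq_square)
  then show ?thesis
    using trig_poly_hcoef[OF K] by (simp add: sum_distrib_left power2_eq_square mult_ac)
qed

section \<open>Bessel and Plancherel inequalities and uniform bounds for scalar functions\<close>

lemma integrable_of_square:
  fixes f :: "real^'d \<Rightarrow> real"
  assumes "f \<in> borel_measurable torus" "integrable torus (\<lambda>x. (f x)\<^sup>2)"
  shows "integrable torus f"
proof (rule Bochner_Integration.integrable_bound)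
  show "integrable torus (\<lambda>x. 1 + (f x)\<^sup>2)" using assms by simp
  have "\<bar>r\<bar> \<le> 1 + r\<^sup>2" for r :: real
    using sum_squares_bound[of 1 "\<bar>r\<bar>"] by (simp add: power2_eq_square)
  then show "AE x in torus. norm (f x) \<le> norm (1 + (f x)\<^sup>2)"
    by (intro AE_I2) (simp add: abs_of_nonneg)
qed (use assms in auto)

text \<open>The square of \<open>f - P\<close> has nonnegative integral, where \<open>P\<close> is
  the orthogonal projection of \<open>f\<close> onto the modes in \<open>K\<close>.\<close>

lemma bessel_inequality_real:
  fixes f :: "real^'d \<Rightarrow> real"
  assumes f: "f \<in> borel_measurable torus" "integrable torus (\<lambda>x. (f x)\<^sup>2)"
    and K: "finite K" "K \<subseteq> lattice"
  shows "(\<Sum>k\<in>K. (hcoef k f)\<^sup>2) \<le> (2 * pi) ^ CARD('d) * (LINT x|torus. (f x)\<^sup>2)"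
proof -
  define V :: real where "V = (2 * pi) ^ CARD('d)"
  define P where "P = (\<lambda>x. \<Sum>k\<in>K. hcoef k f / V * hartley k x)"
  have "V > 0" by (simp add: V_def)
  have If: "integrable torus f" by (rule integrable_of_square[OF f])
  have Pc: "continuous_on UNIV P" unfolding P_def by (intro continuous_intros)
  have I1: "integrable torus (\<lambda>x. P x * f x)"
    using integrable_continuous_mult[OF If Pc] by simp
  have I2: "integrable torus (\<lambda>x. (P x)\<^sup>2)"
    using Pc by (intro continuous_torus_integrable continuous_intros)
  have "0 \<le> (LINT x|torus. (f x - P x)\<^sup>2)" by simp
  also have "\<dots> = (LINT x|torus. (f x)\<^sup>2 - 2 * (P x * f x) + (P x)\<^sup>2)"
    by (intro Bochner_Integration.integral_cong) (auto simp: power2_eq_square algebra_simps)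
  also have "\<dots> = (LINT x|torus. (f x)\<^sup>2) - 2 * (LINT x|torus. P x * f x) + (LINT x|torus. (P x)\<^sup>2)"
    using I1 I2 f by simp
  also have "(LINT x|torus. P x * f x) = (\<Sum>k\<in>K. (hcoef k f)\<^sup>2) / V"
    using trig_poly_pairing[OF If P_def] by (simp add: power2_eq_square sum_divide_distrib)
  also have "(LINT x|torus. (P x)\<^sup>2) = V * (\<Sum>k\<in>K. (hcoef k f / V)\<^sup>2)"
    using trig_poly_square[OF K P_def] by (simp add: V_def)
  also have "\<dots> = (\<Sum>k\<in>K. (hcoef k f)\<^sup>2) / V"
    using \<open>V > 0\<close> by (simp add: power_divide sum_divide_distrib[symmetric] power2_eq_square)
  finally have "(\<Sum>k\<in>K. (hcoef k f)\<^sup>2) \<le> V * (LINT x|torus. (f x)\<^sup>2)"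
    using \<open>V > 0\<close> by (simp add: field_simps)
  then show ?thesis unfolding V_def .
qed

text \<open>Supplies the two duality arguments below: the limit of the squares serves the
  \<open>L^2\<close> bound, that of the absolute values the pointwise bound.\<close>

lemma trig_poly_dense_pairing:
  fixes f g :: "real^'d \<Rightarrow> real"
  assumes f: "integrable torus f" and g: "g \<in> borel_measurable torus" "\<And>x. \<bar>g x\<bar> \<le> M"
  obtains P where "\<And>n. P n \<in> trig_poly"
    "(\<lambda>n. LINT x|torus. P n x * f x) \<longlonglongrightarrow> (LINT x|torus. g x * f x)"
    "(\<lambda>n. LINT x|torus. (P n x)\<^sup>2) \<longlonglongrightarrow> (LINT x|torus. (g x)\<^sup>2)"
    "(\<lambda>n. LINT x|torus. \<bar>P n x\<bar>) \<longlonglongrightarrow> (LINT x|torus. \<bar>g x\<bar>)"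
proof -
  obtain P where P: "\<And>n. P n \<in> trig_poly" and PM: "\<And>n x. \<bar>P n x\<bar> \<le> M + 1"
    and lim: "AE x in torus. (\<lambda>n. P n x) \<longlonglongrightarrow> g x"
    using trig_poly_dense[OF g] by blast
  have meas: "P n \<in> borel_measurable torus" for n
    by (intro continuous_torus_measurable trig_poly_continuous P)
  show ?thesis
  proof
    show "(\<lambda>n. LINT x|torus. P n x * f x) \<longlonglongrightarrow> (LINT x|torus. g x * f x)"
    proof (rule integral_dominated_convergence[where w = "\<lambda>x. (M + 1) * \<bar>f x\<bar>"])
      show "AE x in torus. (\<lambda>n. P n x * f x) \<longlonglongrightarrow> g x * f x"
        using lim by eventually_elim (intro tendsto_intros)
      show "AE x in torus. norm (P n x * f x) \<le> (M + 1) * \<bar>f x\<bar>" for n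
        using PM by (intro AE_I2) (auto simp: abs_mult intro!: mult_right_mono)
    qed (use f g meas in auto)
    show "(\<lambda>n. LINT x|torus. (P n x)\<^sup>2) \<longlonglongrightarrow> (LINT x|torus. (g x)\<^sup>2)"
    proof (rule integral_dominated_convergence[where w = "\<lambda>x. (M + 1)\<^sup>2"])
      show "AE x in torus. (\<lambda>n. (P n x)\<^sup>2) \<longlonglongrightarrow> (g x)\<^sup>2"
        using lim by eventually_elim (intro tendsto_intros)
      show "AE x in torus. norm ((P n x)\<^sup>2) \<le> (M + 1)\<^sup>2" for n
        using PM power_mono[OF PM, of _ _ 2] by (intro AE_I2) auto
    qed (use g meas in auto)
    show "(\<lambda>n. LINT x|torus. \<bar>P n x\<bar>) \<longlonglongrightarrow> (LINT x|torus. \<bar>g x\<bar>)"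
    proof (rule integral_dominated_convergence[where w = "\<lambda>x. M + 1"])
      show "AE x in torus. (\<lambda>n. \<bar>P n x\<bar>) \<longlonglongrightarrow> \<bar>g x\<bar>"
        using lim by eventually_elim (intro tendsto_intros)
      show "AE x in torus. norm \<bar>P n x\<bar> \<le> M + 1" for n
        using PM by (intro AE_I2) auto
    qed (use g meas in auto)
  qed (rule P)
qed

text \<open>As \<open>f\<close> is only assumed integrable, square integrability is part of the
  claim and is obtained by duality. For a truncation \<open>g\<close> of \<open>f\<close>,
  approximated by trigonometric polynomials, Cauchy-Schwarz on coefficients bounds the square of the
  integral of \<open>g * f\<close> by \<open>A / V\<close> times that of \<open>g^2\<close>. Since
  \<open>g * f = g^2\<close>, one factor cancels, and Fatou's lemma removes the truncation.\<close>

lemma plancherel_inequality_real: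
  fixes f :: "real^'d \<Rightarrow> real"
  assumes f: "integrable torus f"
    and A: "\<And>K. finite K \<Longrightarrow> K \<subseteq> lattice \<Longrightarrow> (\<Sum>k\<in>K. (hcoef k f)\<^sup>2) \<le> A"
  shows "(\<integral>\<^sup>+x. ennreal ((f x)\<^sup>2) \<partial>torus) \<le> ennreal (A / (2 * pi) ^ CARD('d))"
proof -
  define V :: real where "V = (2 * pi) ^ CARD('d)"
  have "V > 0" by (simp add: V_def)
  have "A \<ge> 0" using A[of "{}"] by simp
  have [measurable]: "f \<in> borel_measurable torus" using f by auto
  define g where "g n x = (if \<bar>f x\<bar> \<le> real n then f x else 0)" for n x
  have gm [measurable]: "g n \<in> borel_measurable torus" for n unfolding g_def by measurable
  have gn: "\<bar>g n x\<bar> \<le> real n" for n x by (simp add: g_def)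
  have g2: "g n x * f x = (g n x)\<^sup>2" for n x by (simp add: g_def power2_eq_square)
  have bound: "(LINT x|torus. (g n x)\<^sup>2) \<le> A / V" for n
  proof -
    obtain P where P: "\<And>n. P n \<in> trig_poly"
      and lim: "(\<lambda>m. LINT x|torus. P m x * f x) \<longlonglongrightarrow> (LINT x|torus. g n x * f x)"
        "(\<lambda>m. LINT x|torus. (P m x)\<^sup>2) \<longlonglongrightarrow> (LINT x|torus. (g n x)\<^sup>2)"
      using trig_poly_dense_pairing[OF f gm gn] by blast
    have "(LINT x|torus. P m x * f x)\<^sup>2 \<le> A / V * (LINT x|torus. (P m x)\<^sup>2)" for m
    proof -
      obtain K c where K: "finite K" "K \<subseteq> lattice" "P m = (\<lambda>x. \<Sum>k\<in>K. c k * hartley k x)"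
        using trig_poly_representation[OF P] by blast
      have "(LINT x|torus. P m x * f x)\<^sup>2 \<le> (\<Sum>k\<in>K. (c k)\<^sup>2) * (\<Sum>k\<in>K. (hcoef k f)\<^sup>2)"
        unfolding trig_poly_pairing[OF f K(3)] by (rule Cauchy_Schwarz_ineq_sum)
      also have "\<dots> \<le> (\<Sum>k\<in>K. (c k)\<^sup>2) * A"
        using A[OF K(1,2)] by (intro mult_left_mono sum_nonneg) auto
      also have "\<dots> = A / V * (LINT x|torus. (P m x)\<^sup>2)"
        using \<open>V > 0\<close> unfolding trig_poly_square[OF K] V_def[symmetric] by simp
      finally show ?thesis .
    qed
    then have "(LINT x|torus. g n x * f x)\<^sup>2 \<le> A / V * (LINT x|torus. (g n x)\<^sup>2)"
      by (intro LIMSEQ_le[OF tendsto_power[OF lim(1)] tendsto_mult_left[OF lim(2)]]) auto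
    then have "(LINT x|torus. (g n x)\<^sup>2) * (LINT x|torus. (g n x)\<^sup>2) \<le> A / V * (LINT x|torus. (g n x)\<^sup>2)"
      by (simp add: g2 power2_eq_square[of "LINT x|torus. (g n x)\<^sup>2"])
    moreover have "(LINT x|torus. (g n x)\<^sup>2) \<ge> 0" by simp
    ultimately show ?thesis
    proof (cases "(LINT x|torus. (g n x)\<^sup>2) = 0")
      case True
      then show ?thesis using \<open>A \<ge> 0\<close> \<open>V > 0\<close> by simp
    next
      case False
      then have "(LINT x|torus. (g n x)\<^sup>2) > 0"
        using \<open>(LINT x|torus. (g n x)\<^sup>2) \<ge> 0\<close> by linarith
      then show ?thesis
        using \<open>_ * _ \<le> A / V * _\<close> mult_le_cancel_right_pos by blast
    qed
  qed
  have "(\<integral>\<^sup>+x. ennreal ((f x)\<^sup>2) \<partial>torus) = (\<integral>\<^sup>+x. liminf (\<lambda>n. ennreal ((g n x)\<^sup>2)) \<partial>torus)"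
  proof (intro nn_integral_cong)
    fix x
    obtain n0 :: nat where "\<bar>f x\<bar> \<le> n0" using real_arch_simple by blast
    then have "eventually (\<lambda>n. ennreal ((g n x)\<^sup>2) = ennreal ((f x)\<^sup>2)) sequentially"
      by (intro eventually_sequentiallyI[of n0]) (auto simp: g_def)
    then show "ennreal ((f x)\<^sup>2) = liminf (\<lambda>n. ennreal ((g n x)\<^sup>2))"
      by (metis lim_imp_Liminf sequentially_bot tendsto_eventually)
  qed
  also have "\<dots> \<le> liminf (\<lambda>n. \<integral>\<^sup>+x. ennreal ((g n x)\<^sup>2) \<partial>torus)"
    by (rule nn_integral_liminf) auto
  also have "\<dots> \<le> ennreal (A / V)"
  proof -
    have "(\<integral>\<^sup>+x. ennreal ((g n x)\<^sup>2) \<partial>torus) = ennreal (LINT x|torus. (g n x)\<^sup>2)" for n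
    proof (rule nn_integral_eq_integral)
      show "integrable torus (\<lambda>x. (g n x)\<^sup>2)"
        using power_mono[OF gn, of _ _ 2] by (intro torus.integrable_const_bound[of _ "(real n)\<^sup>2"]) auto
    qed auto
    then show ?thesis
      using bound by (intro Liminf_le always_eventually) (auto intro!: ennreal_leI)
  qed
  finally show ?thesis by (simp add: V_def)
qed

text \<open>Duality with \<open>L^1\<close>: Hartley functions are bounded by 2, so each coefficient
  of a trigonometric polynomial \<open>P\<close> is at most \<open>2 / V\<close> times the
  \<open>L^1\<close> norm of \<open>P\<close>, and pairing with \<open>f\<close> costs at most
  \<open>2 * A / V\<close> times that norm.\<close>

lemma abs_le_of_hcoef_summable_real:
  fixes f :: "real^'d \<Rightarrow> real"
  assumes f: "integrable torus f"
    and A: "\<And>K. finite K \<Longrightarrow> K \<subseteq> lattice \<Longrightarrow> (\<Sum>k\<in>K. \<bar>hcoef k f\<bar>) \<le> A"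
  shows "AE x in torus. \<bar>f x\<bar> \<le> 2 * A / (2 * pi) ^ CARD('d)"
proof -
  define V :: real where "V = (2 * pi) ^ CARD('d)"
  define B where "B = 2 * A / V"
  have "V > 0" by (simp add: V_def)
  have "A \<ge> 0" using A[of "{}"] by simp
  then have "B \<ge> 0" using \<open>V > 0\<close> by (simp add: B_def)
  have [measurable]: "f \<in> borel_measurable torus" using f by auto
  \<comment> \<open>With the sign of \<open>f\<close> on the set where
    \<open>\<bar>f x\<bar> > B\<close> as test function, the difference of \<open>g x * f x\<close>
    and \<open>B * \<bar>g x\<bar>\<close> is nonnegative, yet duality makes its integral at most 0;
    hence that set is null.\<close>
  define g where "g x = (if \<bar>f x\<bar> > B then sgn (f x) else 0)" for x
  have gm [measurable]: "g \<in> borel_measurable torus" unfolding g_def by measurable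
  have g1: "\<bar>g x\<bar> \<le> 1" for x by (simp add: g_def sgn_if)
  obtain P where P: "\<And>n. P n \<in> trig_poly"
    and lim: "(\<lambda>m. LINT x|torus. P m x * f x) \<longlonglongrightarrow> (LINT x|torus. g x * f x)"
      "(\<lambda>m. LINT x|torus. \<bar>P m x\<bar>) \<longlonglongrightarrow> (LINT x|torus. \<bar>g x\<bar>)"
    using trig_poly_dense_pairing[OF f gm g1] by blast
  have "(LINT x|torus. P m x * f x) \<le> B * (LINT x|torus. \<bar>P m x\<bar>)" for m
  proof -
    obtain K c where K: "finite K" "K \<subseteq> lattice" "P m = (\<lambda>x. \<Sum>k\<in>K. c k * hartley k x)"
      using trig_poly_representation[OF P] by blast
    have Pint: "integrable torus (P m)"
      by (intro continuous_torus_integrable trig_poly_continuous P)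
    have c: "\<bar>c k\<bar> \<le> 2 / V * (LINT x|torus. \<bar>P m x\<bar>)" if "k \<in> K" for k
    proof -
      have "V * \<bar>c k\<bar> = \<bar>hcoef k (P m)\<bar>"
        using trig_poly_hcoef[OF K that] \<open>V > 0\<close> by (simp add: V_def abs_mult)
      also have "\<dots> \<le> (LINT x|torus. norm (hartley k x *\<^sub>R P m x))"
        unfolding hcoef_def by (metis integral_norm_bound real_norm_def)
      also have "\<dots> \<le> (LINT x|torus. 2 * \<bar>P m x\<bar>)"
        using Pint by (intro integral_mono integrable_norm hcoef_integrable)
          (auto simp: abs_mult abs_hartley_le intro!: mult_right_mono)
      finally show ?thesis
        using \<open>V > 0\<close> Pint by (simp add: field_simps)
    qed
    have "(LINT x|torus. P m x * f x) \<le> (\<Sum>k\<in>K. \<bar>c k\<bar> * \<bar>hcoef k f\<bar>)"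
      unfolding trig_poly_pairing[OF f K(3)] by (intro sum_mono) (metis abs_ge_self abs_mult)
    also have "\<dots> \<le> (\<Sum>k\<in>K. 2 / V * (LINT x|torus. \<bar>P m x\<bar>) * \<bar>hcoef k f\<bar>)"
      using c by (intro sum_mono mult_right_mono) auto
    also have "\<dots> = 2 / V * (LINT x|torus. \<bar>P m x\<bar>) * (\<Sum>k\<in>K. \<bar>hcoef k f\<bar>)"
      by (simp add: sum_distrib_left)
    also have "\<dots> \<le> 2 / V * (LINT x|torus. \<bar>P m x\<bar>) * A"
      using \<open>V > 0\<close> A[OF K(1,2)] by (intro mult_left_mono) auto
    finally show ?thesis by (simp add: B_def mult_ac)
  qed
  then have le: "(LINT x|torus. g x * f x) \<le> B * (LINT x|torus. \<bar>g x\<bar>)"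
    by (intro LIMSEQ_le[OF lim(1) tendsto_mult_left[OF lim(2)]]) auto
  have I1: "integrable torus (\<lambda>x. g x * f x)"
    using integrable_bounded_mult[OF f, of g 1] g1 by simp
  have I2: "integrable torus (\<lambda>x. B * \<bar>g x\<bar>)"
    using g1 by (intro integrable_mult_right torus.integrable_const_bound[of _ 1]) auto
  have nonneg: "g x * f x - B * \<bar>g x\<bar> \<ge> 0" for x
    using \<open>B \<ge> 0\<close> by (auto simp: g_def sgn_if)
  have "(LINT x|torus. g x * f x - B * \<bar>g x\<bar>) = 0"
    using le I1 I2 nonneg Bochner_Integration.integral_nonneg[of torus "\<lambda>x. g x * f x - B * \<bar>g x\<bar>"]
    by simp
  then have "AE x in torus. g x * f x - B * \<bar>g x\<bar> = 0"
    using I1 I2 nonneg by (subst (asm) integral_nonneg_eq_0_iff_AE) auto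
  then have "AE x in torus. \<bar>f x\<bar> \<le> B"
  proof eventually_elim
    case (elim x)
    then show ?case
      using \<open>B \<ge> 0\<close> by (auto simp: g_def sgn_if split: if_splits)
  qed
  then show ?thesis by (simp add: B_def V_def)
qed

section \<open>Squared L2 norms and vector-valued functions\<close>

definition L2_square :: "(real^'d \<Rightarrow> 'b::real_normed_vector) \<Rightarrow> ennreal" where
  "L2_square f = (\<integral>\<^sup>+x. ennreal ((norm (f x))\<^sup>2) \<partial>torus)"

lemma ennreal_powr_2: "ennreal_powr x 2 = x\<^sup>2"
proof (cases x)
  case (real r)
  then have "r powr 2 = r\<^sup>2" by (cases "r = 0") auto
  with real show ?thesis by (simp add: ennreal_powr_def ennreal_power)
next
  case top
  then show ?thesis by (simp add: ennreal_powr_def)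
qed

lemma ennreal_powr_half: "(ennreal_powr x (1 / 2))\<^sup>2 = x"
proof (cases x)
  case (real r)
  then show ?thesis by (simp add: ennreal_powr_def powr_half_sqrt ennreal_power)
next
  case top
  then show ?thesis by (simp add: ennreal_powr_def)
qed

lemma Lp_norm_2_square: "(Lp_norm 2 M f)\<^sup>2 = (\<integral>\<^sup>+x. (f x)\<^sup>2 \<partial>M)"
proof -
  have "(2 :: ennreal) \<noteq> \<infinity>" by simp
  then show ?thesis
    by (simp add: Lp_norm_def ennreal_powr_2 ennreal_powr_half)
qed

lemma torus_Lp_norm_2_square: "(torus_Lp_norm 2 f)\<^sup>2 = L2_square f"
  by (simp add: torus_Lp_norm_def Lp_norm_2_square L2_square_def ennreal_power)

lemma torus_Lp_measurable: "f \<in> torus_Lp p \<Longrightarrow> f \<in> borel_measurable torus"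
  by (auto simp: torus_Lp_def intro: sets_lebesgue_subset_torus)

lemma torus_Lp_2_L2_square: "f \<in> torus_Lp 2 \<Longrightarrow> L2_square f < \<infinity>"
  unfolding torus_Lp_norm_2_square[symmetric]
  by (auto simp: torus_Lp_def power_less_top_ennreal)

lemma torus_Lp_1_integrable:
  fixes f :: "real^'d \<Rightarrow> 'b::euclidean_space"
  assumes "f \<in> torus_Lp 1"
  shows "integrable torus f"
proof (rule integrableI_bounded)
  have "torus_Lp_norm 1 f < \<infinity>" using assms by (simp add: torus_Lp_def)
  moreover have "ennreal_powr x 1 = x" for x
    by (cases x) (auto simp: ennreal_powr_def)
  ultimately show "(\<integral>\<^sup>+x. ennreal (norm (f x)) \<partial>torus) < \<infinity>"
    by (simp add: torus_Lp_norm_def Lp_norm_def)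
qed (rule torus_Lp_measurable[OF assms])

lemma L2_square_integrable:
  fixes f :: "real^'d \<Rightarrow> 'b::euclidean_space"
  assumes "f \<in> borel_measurable torus" "L2_square f < \<infinity>"
  shows "integrable torus (\<lambda>x. (norm (f x))\<^sup>2)" "integrable torus f"
proof -
  show I: "integrable torus (\<lambda>x. (norm (f x))\<^sup>2)"
    using assms by (intro integrableI_nonneg) (auto simp: L2_square_def)
  have "integrable torus (\<lambda>x. norm (f x))"
    using assms(1) I by (intro integrable_of_square[where f = "\<lambda>x. norm (f x)"]) auto
  then show "integrable torus f"
    using assms(1) integrable_norm_cancel by blast
qed

lemma L2_square_eq_integral:
  fixes f :: "real^'d \<Rightarrow> 'b::euclidean_space"
  assumes "f \<in> borel_measurable torus" "L2_square f < \<infinity>"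
  shows "L2_square f = ennreal (LINT x|torus. (norm (f x))\<^sup>2)"
  unfolding L2_square_def
  by (intro nn_integral_eq_integral L2_square_integrable assms) auto

lemma L2_square_cong_AE:
  "AE x in torus. f x = g x \<Longrightarrow> L2_square f = L2_square g"
  unfolding L2_square_def by (intro nn_integral_cong_AE) (erule eventually_mono, simp)

lemma norm_square_Basis: "(norm x)\<^sup>2 = (\<Sum>b\<in>Basis. (x \<bullet> b)\<^sup>2)" for x :: "'b::euclidean_space"
  by (simp only: power2_norm_eq_inner euclidean_inner[of x x]) (simp only: power2_eq_square)

lemma L2_square_Basis:
  fixes f :: "real^'d \<Rightarrow> 'b::euclidean_space"
  assumes [measurable]: "f \<in> borel_measurable torus"
  shows "L2_square f = (\<Sum>b\<in>Basis. L2_square (\<lambda>x. f x \<bullet> b))"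
proof -
  have "L2_square f = (\<integral>\<^sup>+x. (\<Sum>b\<in>Basis. ennreal ((f x \<bullet> b)\<^sup>2)) \<partial>torus)"
    by (simp add: L2_square_def norm_square_Basis)
  also have "\<dots> = (\<Sum>b\<in>Basis. L2_square (\<lambda>x. f x \<bullet> b))"
    by (subst nn_integral_sum) (auto simp: L2_square_def)
  finally show ?thesis .
qed

text \<open>Summation of the scalar inequality over components. In the extended reals a function
  outside \<open>L^2\<close> is covered too, by an infinite right side.\<close>

lemma bessel_inequality:
  fixes f :: "real^'d \<Rightarrow> 'b::euclidean_space"
  assumes f: "f \<in> borel_measurable torus" and K: "finite K" "K \<subseteq> lattice"
  shows "ennreal (\<Sum>k\<in>K. (norm (hcoef k f))\<^sup>2) \<le> ennreal ((2 * pi) ^ CARD('d)) * L2_square f"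
proof (cases "L2_square f < \<infinity>")
  case False
  then show ?thesis by (simp add: ennreal_mult_top less_top[symmetric])
next
  case True
  define V :: real where "V = (2 * pi) ^ CARD('d)"
  have "V > 0" by (simp add: V_def)
  have If: "integrable torus f" by (rule L2_square_integrable(2)[OF f True])
  have fin: "L2_square (\<lambda>x. f x \<bullet> b) < \<infinity>" if "b \<in> Basis" for b
    using True that unfolding L2_square_Basis[OF f] by (simp add: ennreal_sum_less_top)
  have "(\<Sum>k\<in>K. (norm (hcoef k f))\<^sup>2) = (\<Sum>b\<in>Basis. \<Sum>k\<in>K. (hcoef k (\<lambda>x. f x \<bullet> b))\<^sup>2)"
    unfolding norm_square_Basis hcoef_inner[OF If] by (rule sum.swap)
  also have "\<dots> \<le> (\<Sum>b\<in>Basis. V * (LINT x|torus. (f x \<bullet> b)\<^sup>2))"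
  proof (intro sum_mono)
    fix b :: 'b assume b: "b \<in> Basis"
    have "(\<lambda>x. f x \<bullet> b) \<in> borel_measurable torus" using f by auto
    moreover have "integrable torus (\<lambda>x. (f x \<bullet> b)\<^sup>2)"
      using L2_square_integrable(1)[OF calculation fin[OF b]] by simp
    ultimately show "(\<Sum>k\<in>K. (hcoef k (\<lambda>x. f x \<bullet> b))\<^sup>2) \<le> V * (LINT x|torus. (f x \<bullet> b)\<^sup>2)"
      unfolding V_def by (rule bessel_inequality_real[OF _ _ K])
  qed
  finally have "ennreal (\<Sum>k\<in>K. (norm (hcoef k f))\<^sup>2) \<le> ennreal (V * (\<Sum>b\<in>Basis. LINT x|torus. (f x \<bullet> b)\<^sup>2))"
    by (intro ennreal_leI) (simp add: sum_distrib_left)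
  also have "\<dots> = ennreal V * (\<Sum>b\<in>Basis. ennreal (LINT x|torus. (f x \<bullet> b)\<^sup>2))"
    using \<open>V > 0\<close> by (simp add: ennreal_mult sum_nonneg)
  also have "(\<Sum>b\<in>Basis. ennreal (LINT x|torus. (f x \<bullet> b)\<^sup>2)) = (\<Sum>b\<in>Basis. L2_square (\<lambda>x. f x \<bullet> b))"
    using f fin by (intro sum.cong) (simp_all add: L2_square_eq_integral)
  also have "\<dots> = L2_square f" by (rule L2_square_Basis[OF f, symmetric])
  finally show ?thesis by (simp only: V_def)
qed

lemma hcoef_component_le:
  fixes f :: "real^'d \<Rightarrow> 'b::euclidean_space"
  assumes "integrable torus f" "b \<in> Basis"
  shows "\<bar>hcoef k (\<lambda>x. f x \<bullet> b)\<bar> \<le> norm (hcoef k f)"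
  using Basis_le_norm[OF assms(2), of "hcoef k f"] by (simp add: hcoef_inner[OF assms(1)])

text \<open>The factor \<open>DIM('b)\<close> arises because \<open>A\<close>, a bound for the whole
  vector, is used for each component separately.\<close>

lemma plancherel_inequality:
  fixes f :: "real^'d \<Rightarrow> 'b::euclidean_space" and A :: real
  assumes f: "integrable torus f"
    and A: "\<And>K. finite K \<Longrightarrow> K \<subseteq> lattice \<Longrightarrow> (\<Sum>k\<in>K. (norm (hcoef k f))\<^sup>2) \<le> A"
  shows "L2_square f \<le> ennreal (DIM('b) * A / (2 * pi) ^ CARD('d))"
proof -
  have "A \<ge> 0" using A[of "{}"] by simp
  have "L2_square (\<lambda>x. f x \<bullet> b) \<le> ennreal (A / (2 * pi) ^ CARD('d))" if b: "b \<in> Basis" for b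
  proof -
    have "(\<Sum>k\<in>K. (hcoef k (\<lambda>x. f x \<bullet> b))\<^sup>2) \<le> A" if K: "finite K" "K \<subseteq> lattice" for K
    proof -
      have "(\<Sum>k\<in>K. (hcoef k (\<lambda>x. f x \<bullet> b))\<^sup>2) \<le> (\<Sum>k\<in>K. (norm (hcoef k f))\<^sup>2)"
        using hcoef_component_le[OF f b] by (intro sum_mono) (simp add: abs_le_square_iff[symmetric])
      then show ?thesis using A[OF K] by linarith
    qed
    then show ?thesis
      using plancherel_inequality_real[of "\<lambda>x. f x \<bullet> b" A] f by (simp add: L2_square_def)
  qed
  then have "(\<Sum>b\<in>(Basis::'b set). L2_square (\<lambda>x. f x \<bullet> b)) \<le> (\<Sum>b\<in>(Basis::'b set). ennreal (A / (2 * pi) ^ CARD('d)))"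
    by (intro sum_mono)
  also have "\<dots> = ennreal (DIM('b) * A / (2 * pi) ^ CARD('d))"
    using \<open>A \<ge> 0\<close> by (simp add: ennreal_of_nat_eq_real_of_nat ennreal_mult[symmetric])
  finally show ?thesis
    using L2_square_Basis[OF borel_measurable_integrable[OF f]] by simp
qed

lemma norm_le_of_hcoef_summable:
  fixes f :: "real^'d \<Rightarrow> 'b::euclidean_space" and A :: real
  assumes f: "integrable torus f"
    and A: "\<And>K. finite K \<Longrightarrow> K \<subseteq> lattice \<Longrightarrow> (\<Sum>k\<in>K. norm (hcoef k f)) \<le> A"
  shows "AE x in torus. norm (f x) \<le> DIM('b) * (2 * A / (2 * pi) ^ CARD('d))"
proof -
  have "AE x in torus. \<bar>f x \<bullet> b\<bar> \<le> 2 * A / (2 * pi) ^ CARD('d)" if b: "b \<in> Basis" for b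
  proof (rule abs_le_of_hcoef_summable_real)
    fix K :: "(real^'d) set" assume K: "finite K" "K \<subseteq> lattice"
    have "(\<Sum>k\<in>K. \<bar>hcoef k (\<lambda>x. f x \<bullet> b)\<bar>) \<le> (\<Sum>k\<in>K. norm (hcoef k f))"
      by (intro sum_mono hcoef_component_le f b)
    then show "(\<Sum>k\<in>K. \<bar>hcoef k (\<lambda>x. f x \<bullet> b)\<bar>) \<le> A" using A[OF K] by linarith
  qed (use f in auto)
  then have "AE x in torus. \<forall>b\<in>(Basis::'b set). \<bar>f x \<bullet> b\<bar> \<le> 2 * A / (2 * pi) ^ CARD('d)"
    by (intro AE_finite_allI) auto
  then show ?thesis
  proof eventually_elim
    case (elim x)
    have "norm (f x) \<le> (\<Sum>b\<in>(Basis::'b set). \<bar>f x \<bullet> b\<bar>)" by (rule norm_le_l1)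
    also have "\<dots> \<le> (\<Sum>b\<in>(Basis::'b set). 2 * A / (2 * pi) ^ CARD('d))"
      using elim by (intro sum_mono) auto
    finally show ?case by simp
  qed
qed

text \<open>The pointwise bound with \<open>A = 0\<close>, applied to \<open>f - g\<close>.\<close>

lemma hcoef_unique:
  fixes f g :: "real^'d \<Rightarrow> 'b::euclidean_space"
  assumes fg: "integrable torus f" "integrable torus g"
    and eq: "\<And>k. k \<in> lattice \<Longrightarrow> hcoef k f = hcoef k g"
  shows "AE x in torus. f x = g x"
proof -
  have "AE x in torus. norm (f x - g x) \<le> DIM('b) * (2 * 0 / (2 * pi) ^ CARD('d))"
  proof (rule norm_le_of_hcoef_summable)
    fix K :: "(real^'d) set" assume "finite K" "K \<subseteq> lattice"
    then show "(\<Sum>k\<in>K. norm (hcoef k (\<lambda>x. f x - g x))) \<le> 0"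
      using eq by (auto simp: hcoef_diff[OF fg] subset_iff intro!: sum_nonpos)
  qed (use fg in auto)
  then show ?thesis by eventually_elim simp
qed

section \<open>Weak derivatives\<close>

text \<open>\<open>hartley k\<close> is inserted as the test function in \<open>weak_deriv\<close>.
  An odd number of derivatives links the coefficient of \<open>g\<close> at \<open>k\<close> to that
  of \<open>f\<close> at \<open>- k\<close>.\<close>

lemma hcoef_weak_deriv:
  assumes "weak_deriv bs f g" "k \<in> lattice"
  shows "(- 1) ^ length bs *\<^sub>R hcoef k g = hartley_symbol k bs *\<^sub>R hcoef ((- 1) ^ length bs *\<^sub>R k) f"
proof -
  have "(LINT x|torus. partial_derivs bs (hartley k) x *\<^sub>R f x) = (- 1) ^ length bs *\<^sub>R (LINT x|torus. hartley k x *\<^sub>R g x)"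
    using assms hartley_torus_smooth_real[of k] by (auto simp: weak_deriv_def)
  also have "(LINT x|torus. partial_derivs bs (hartley k) x *\<^sub>R f x)
     = (LINT x|torus. hartley_symbol k bs *\<^sub>R (hartley ((- 1) ^ length bs *\<^sub>R k) x *\<^sub>R f x))"
    by (simp add: partial_derivs_hartley_real mult.commute)
  finally show ?thesis by (simp add: hcoef_def del: scaleR_scaleR)
qed

lemma norm_hcoef_weak_deriv:
  assumes "weak_deriv bs f g" "k \<in> lattice"
  shows "(norm (hcoef k g))\<^sup>2 = (\<Prod>b\<leftarrow>bs. (k \<bullet> b)\<^sup>2) * (norm (hcoef ((- 1) ^ length bs *\<^sub>R k) f))\<^sup>2"
  using arg_cong[OF hcoef_weak_deriv[OF assms], of "\<lambda>v. (norm v)\<^sup>2"]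
  by (simp add: power_mult_distrib hartley_symbol_square[symmetric])

lemma weak_deriv_integrable:
  assumes "weak_deriv bs f g"
  shows "integrable torus f" "integrable torus g"
  using assms by (auto simp: weak_deriv_def intro: torus_Lp_1_integrable)

lemma weak_deriv_unique:
  assumes "weak_deriv bs f g" "weak_deriv bs f h"
  shows "AE x in torus. g x = h x"
proof (rule hcoef_unique)
  fix k :: "real^'a" assume "k \<in> lattice"
  then have "(- 1) ^ length bs *\<^sub>R hcoef k g = ((- 1) ^ length bs :: real) *\<^sub>R hcoef k h"
    using assms by (simp add: hcoef_weak_deriv)
  then show "hcoef k g = hcoef k h" by simp
qed (use assms in \<open>auto intro: weak_deriv_integrable\<close>)

lemma weak_deriv_wderiv: "weak_deriv bs f g \<Longrightarrow> weak_deriv bs f (wderiv bs f)"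
  unfolding wderiv_def by (rule someI[of "weak_deriv bs f"])

text \<open>Neutralises the choice in \<open>wderiv\<close>: integrals and norms may be computed
  with any weak derivative at hand.\<close>

lemma wderiv_unique: "weak_deriv bs f g \<Longrightarrow> AE x in torus. wderiv bs f x = g x"
  using weak_deriv_unique weak_deriv_wderiv by blast

section \<open>Weak derivatives of the Hartley functions\<close>

lemma periodic_partial_deriv:
  assumes "\<And>x. f differentiable (at x)" "periodic f"
  shows "periodic (partial_deriv b f)"
  unfolding periodic_def
proof (intro allI)
  fix i x
  define a :: "real^'a" where "a = axis i (2 * pi)"
  have "((\<lambda>y. y + a) has_derivative (\<lambda>h. h)) (at x)"
    by (auto intro!: derivative_eq_intros)
  then have "((\<lambda>y. f (y + a)) has_derivative frechet_derivative f (at (x + a))) (at x)"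
    using has_derivative_compose[of "\<lambda>y. y + a" "\<lambda>h. h" x UNIV f "frechet_derivative f (at (x + a))"]
      assms(1)[of "x + a"] by (simp add: frechet_derivative_works)
  moreover have "(\<lambda>y. f (y + a)) = f"
    using assms(2) by (auto simp: periodic_def a_def)
  ultimately have "frechet_derivative f (at (x + a)) = frechet_derivative f (at x)"
    by (simp add: frechet_derivative_at)
  then show "partial_deriv b f (x + axis i (2 * pi)) = partial_deriv b f x"
    by (simp add: partial_deriv_def a_def)
qed

lemma torus_smooth_differentiable: "f \<in> torus_smooth \<Longrightarrow> f differentiable (at x)"
  by (auto simp: torus_smooth_def smooth_def dest!: bspec[where x = "[]"])

lemma torus_smooth_partial_deriv:
  assumes "f \<in> torus_smooth" "b \<in> Basis"
  shows "partial_deriv b f \<in> torus_smooth"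
proof -
  have "partial_derivs bs (partial_deriv b f) = partial_derivs (bs @ [b]) f" for bs
    by (induction bs) auto
  then have "smooth (partial_deriv b f)"
    using assms unfolding torus_smooth_def smooth_def by auto
  moreover have "periodic (partial_deriv b f)"
    using assms(1) by (intro periodic_partial_deriv torus_smooth_differentiable) (auto simp: torus_smooth_def)
  ultimately show ?thesis
    by (simp add: torus_smooth_def)
qed

lemma torus_smooth_continuous: "f \<in> torus_smooth \<Longrightarrow> continuous_on A f"
  by (intro continuous_at_imp_continuous_on ballI differentiable_imp_continuous_within torus_smooth_differentiable)

lemma torus_smooth_partial_derivs:
  assumes "f \<in> torus_smooth" "bs \<in> lists Basis"
  shows "partial_derivs bs f \<in> torus_smooth"
  using assms(2) by induction (auto intro: assms torus_smooth_partial_deriv)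

text \<open>The product of \<open>q\<close>, \<open>hartley k\<close> and \<open>v\<close> is
  periodic, so its derivative in direction \<open>b\<close> integrates to zero; the product rule
  splits that derivative into the two integrands.\<close>

lemma hartley_integration_by_parts:
  fixes q :: "real^'d \<Rightarrow> real" and v :: "'b::euclidean_space"
  assumes q: "q \<in> torus_smooth" and b: "b \<in> Basis" and k: "k \<in> lattice"
  shows "(LINT x|torus. partial_deriv b q x *\<^sub>R (hartley k x *\<^sub>R v))
       = - (LINT x|torus. q x *\<^sub>R (hartley (- k) x *\<^sub>R ((k \<bullet> b) *\<^sub>R v)))"
proof -
  obtain i where i: "b = axis i 1" using b by (auto simp: Basis_vec_def)
  define f where "f x = partial_deriv b q x *\<^sub>R (hartley k x *\<^sub>R v) + q x *\<^sub>R (hartley (- k) x *\<^sub>R ((k \<bullet> b) *\<^sub>R v))" for x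
  note q' = torus_smooth_partial_deriv[OF q b]
  have I: "integrable torus (\<lambda>x. partial_deriv b q x *\<^sub>R (hartley k x *\<^sub>R v))"
    "integrable torus (\<lambda>x. q x *\<^sub>R (hartley (- k) x *\<^sub>R ((k \<bullet> b) *\<^sub>R v)))"
    by (intro continuous_torus_integrable continuous_intros torus_smooth_continuous q q')+
  have fc: "continuous_on UNIV f"
    unfolding f_def by (intro continuous_intros torus_smooth_continuous q q')
  have per: "periodic q" "periodic (partial_deriv b q)" "periodic (hartley k)" "periodic (hartley (- k))"
    using q q' k hartley_periodic[of k "\<lambda>r. r"] hartley_periodic[of "- k" "\<lambda>r. r"]
    by (auto simp: torus_smooth_def)
  have "integral cell f = 0"
  proof (rule integral_cell_derivative[OF fc])
    show "periodic f" using per by (simp add: f_def periodic_def)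
    show "periodic (\<lambda>x. q x *\<^sub>R (hartley k x *\<^sub>R v))" using per by (simp add: periodic_def)
    fix x :: "real^'d"
    have d1: "((\<lambda>h. x + h *\<^sub>R axis i 1) has_derivative (\<lambda>h. h *\<^sub>R axis i 1)) (at 0)"
      by (auto intro!: derivative_eq_intros)
    have "(q has_derivative frechet_derivative q (at x)) (at x)"
      using torus_smooth_differentiable[OF q] frechet_derivative_works by blast
    then have "((\<lambda>x. q x *\<^sub>R (hartley k x *\<^sub>R v)) has_derivative
        (\<lambda>h. q x *\<^sub>R (((k \<bullet> h) * hartley (- k) x) *\<^sub>R v) + frechet_derivative q (at x) h *\<^sub>R (hartley k x *\<^sub>R v)))
        (at (x + 0 *\<^sub>R axis i 1))"
      using has_derivative_scaleR[OF _ hartley_has_derivative] by simp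
    from has_derivative_compose[OF d1 this]
    have "((\<lambda>h. q (x + h *\<^sub>R axis i 1) *\<^sub>R (hartley k (x + h *\<^sub>R axis i 1) *\<^sub>R v)) has_derivative
        (\<lambda>h. q x *\<^sub>R (((k \<bullet> (h *\<^sub>R axis i 1)) * hartley (- k) x) *\<^sub>R v)
            + frechet_derivative q (at x) (h *\<^sub>R axis i 1) *\<^sub>R (hartley k x *\<^sub>R v))) (at 0)" .
    moreover have "frechet_derivative q (at x) (h *\<^sub>R axis i 1) = h * partial_deriv b q x" for h
      using linear_frechet_derivative[OF torus_smooth_differentiable[OF q]]
      by (simp add: partial_deriv_def i linear_cmul)
    ultimately show "((\<lambda>h. q (x + h *\<^sub>R axis i 1) *\<^sub>R (hartley k (x + h *\<^sub>R axis i 1) *\<^sub>R v)) has_vector_derivative f x) (at 0)"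
      unfolding has_vector_derivative_def f_def by (simp add: i algebra_simps)
  qed
  then have "(LINT x|torus. f x) = 0"
    by (simp add: continuous_torus_integral[OF fc])
  then show ?thesis
    unfolding f_def using I by (simp add: eq_neg_iff_add_eq_0)
qed

lemma hartley_symbol_minus: "hartley_symbol (- k) bs = (- 1) ^ length bs * hartley_symbol k bs"
  by (induction bs) auto

lemma torus_continuous_Lp_1:
  fixes f :: "real^'d \<Rightarrow> 'b::euclidean_space"
  assumes "continuous_on UNIV f" "periodic f"
  shows "f \<in> torus_Lp 1"
proof -
  have "(\<integral>\<^sup>+x. ennreal (norm (f x)) \<partial>torus) < \<infinity>"
    using continuous_torus_integrable[OF assms(1)] by (simp add: integrable_iff_bounded)
  moreover have "ennreal_powr x 1 = x" for x
    by (cases x) (auto simp: ennreal_powr_def)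
  ultimately have "torus_Lp_norm 1 f < \<infinity>"
    by (simp add: torus_Lp_norm_def Lp_norm_def)
  then show ?thesis
    using assms by (auto simp: torus_Lp_def intro!: borel_measurable_continuous_onI measurable_completion)
qed

text \<open>The weak formulation applies \<open>grad\<close> and \<open>laplacian\<close> to the
  test function as well, and both are built from \<open>wderiv\<close>. The classical derivatives of
  Hartley functions must therefore be recognised as weak ones.\<close>

lemma weak_deriv_hartley:
  fixes v :: "'b::euclidean_space"
  assumes k: "k \<in> lattice" and bs: "bs \<in> lists Basis"
  shows "weak_deriv bs (\<lambda>x. hartley k x *\<^sub>R v)
    (\<lambda>x. hartley ((- 1) ^ length bs *\<^sub>R k) x *\<^sub>R (hartley_symbol k bs *\<^sub>R v))"
proof -
  have "(LINT x|torus. partial_derivs bs \<psi> x *\<^sub>R (hartley k x *\<^sub>R v)) = (- 1) ^ length bs *\<^sub>R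
      (LINT x|torus. \<psi> x *\<^sub>R (hartley ((- 1) ^ length bs *\<^sub>R k) x *\<^sub>R (hartley_symbol k bs *\<^sub>R v)))"
    if \<psi>: "\<psi> \<in> torus_smooth" for \<psi> :: "real^'a \<Rightarrow> real"
    using bs k
  proof (induction bs arbitrary: k v)
    case (Cons b bs)
    have "(LINT x|torus. partial_derivs (b # bs) \<psi> x *\<^sub>R (hartley k x *\<^sub>R v))
        = - (LINT x|torus. partial_derivs bs \<psi> x *\<^sub>R (hartley (- k) x *\<^sub>R ((k \<bullet> b) *\<^sub>R v)))"
      unfolding partial_derivs.simps
      by (rule hartley_integration_by_parts) (use Cons in \<open>auto intro!: torus_smooth_partial_derivs[OF \<psi>]\<close>)
    also have "\<dots> = - ((- 1) ^ length bs *\<^sub>R (LINT x|torus. \<psi> x *\<^sub>R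
        (hartley ((- 1) ^ length bs *\<^sub>R (- k)) x *\<^sub>R (hartley_symbol (- k) bs *\<^sub>R ((k \<bullet> b) *\<^sub>R v)))))"
      using Cons.prems Cons.hyps by (subst Cons.IH) auto
    finally show ?case
      by (simp add: hartley_symbol_minus mult_ac)
  qed simp
  moreover have "(\<lambda>x. hartley l x *\<^sub>R w) \<in> torus_Lp 1" if "l \<in> lattice" for l :: "real^'a" and w :: 'b
    using that by (intro torus_continuous_Lp_1 continuous_intros hartley_periodic[where F = "\<lambda>r. r *\<^sub>R w"])
  ultimately show ?thesis
    using k by (simp add: weak_deriv_def del: scaleR_scaleR)
qed

section \<open>Sobolev norms and weighted coefficients\<close>

lemma finite_multi_indices: "finite {bs. bs \<in> lists Basis \<and> length bs \<le> n}"
  using finite_lists_length_le[OF finite_Basis, of n]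
  by (rule rev_finite_subset) (auto simp: in_lists_conv_set)

lemma sobolev_norm_square:
  "(sobolev_norm n f)\<^sup>2 = (\<Sum>bs | bs \<in> lists Basis \<and> length bs \<le> n. L2_square (wderiv bs f))"
  by (simp add: sobolev_norm_def ennreal_powr_half torus_Lp_norm_2_square)

lemma sobolev_wderiv:
  assumes "f \<in> sobolev n" "bs \<in> lists Basis" "length bs \<le> n"
  shows "weak_deriv bs f (wderiv bs f)" "L2_square (wderiv bs f) < \<infinity>"
proof -
  obtain g where g: "g \<in> torus_Lp 2" "weak_deriv bs f g"
    using assms by (auto simp: sobolev_def)
  show "weak_deriv bs f (wderiv bs f)" by (rule weak_deriv_wderiv[OF g(2)])
  show "L2_square (wderiv bs f) < \<infinity>"
    using L2_square_cong_AE[OF wderiv_unique[OF g(2)]] torus_Lp_2_L2_square[OF g(1)] by simp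
qed

lemma sobolev_integrable: "f \<in> sobolev n \<Longrightarrow> integrable torus f"
  using sobolev_wderiv(1)[of f n "[]"] weak_deriv_integrable(1) by auto

lemma sobolev_mono: "m \<le> n \<Longrightarrow> sobolev n \<subseteq> sobolev m"
  unfolding sobolev_def by (auto dest: bspec)

lemma hcoef_wderiv:
  assumes "f \<in> sobolev n" "bs \<in> lists Basis" "length bs \<le> n" "k \<in> lattice"
  shows "(norm (hcoef k (wderiv bs f)))\<^sup>2
    = (\<Prod>b\<leftarrow>bs. (k \<bullet> b)\<^sup>2) * (norm (hcoef ((- 1) ^ length bs *\<^sub>R k) f))\<^sup>2"
  by (rule norm_hcoef_weak_deriv[OF sobolev_wderiv(1)[OF assms(1-3)] assms(4)])

text \<open>Absorbs the reversal of frequencies by derivatives of odd order: the reflection of a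
  finite set of frequencies is again such a set.\<close>

lemma sum_sign_reindex:
  fixes g :: "real^'d \<Rightarrow> 'a::comm_monoid_add"
  shows "(\<Sum>k\<in>K. g ((- 1) ^ n *\<^sub>R k)) = sum g ((\<lambda>k. (- 1) ^ n *\<^sub>R k) ` K)"
  by (subst sum.reindex) (auto intro!: inj_onI)

text \<open>\<open>p = 1\<close> serves derivatives up to order 2, \<open>p = 2\<close> those up to
  order 4. Each factor is at most \<open>norm k ^ 2\<close>; small and large \<open>k\<close> are
  separated because \<open>length bs\<close> may lie below \<open>2 * p\<close>.\<close>

lemma symbol_le_weight:
  fixes k :: "real^'d"
  assumes "bs \<in> lists Basis" "length bs \<le> 2 * p"
  shows "(\<Prod>b\<leftarrow>bs. (k \<bullet> b)\<^sup>2) \<le> (1 + norm k ^ 4) ^ p"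
proof -
  have "0 \<le> (\<Prod>b\<leftarrow>bs. (k \<bullet> b)\<^sup>2) \<and> (\<Prod>b\<leftarrow>bs. (k \<bullet> b)\<^sup>2) \<le> (norm k ^ 2) ^ length bs"
    using assms(1)
  proof induction
    case (Cons b bs)
    have "(k \<bullet> b)\<^sup>2 \<le> (norm k)\<^sup>2"
      using Basis_le_norm[OF Cons.hyps(1), of k] by (simp add: abs_le_square_iff[symmetric])
    then show ?case
      using Cons.IH by (auto intro!: mult_mono)
  qed simp
  moreover have "(norm k ^ 2) ^ length bs \<le> (1 + norm k ^ 4) ^ p"
  proof (cases "norm k \<le> 1")
    case True
    then have "(norm k ^ 2) ^ length bs \<le> 1" by (simp add: power_le_one)
    also have "\<dots> \<le> (1 + norm k ^ 4) ^ p" by (intro one_le_power) simp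
    finally show ?thesis .
  next
    case False
    then have "(norm k ^ 2) ^ length bs \<le> (norm k ^ 2) ^ (2 * p)"
      by (intro power_increasing assms one_le_power) simp
    also have "\<dots> = (norm k ^ 4) ^ p" by (simp add: power_mult[symmetric])
    also have "\<dots> \<le> (1 + norm k ^ 4) ^ p" by (intro power_mono) auto
    finally show ?thesis .
  qed
  ultimately show ?thesis by linarith
qed

text \<open>Each derivative up to order \<open>n\<close> obeys the same Plancherel bound, which is
  why the number of index lists appears as a factor.\<close>

lemma sobolev_norm_le_hcoef:
  fixes f :: "real^'d \<Rightarrow> 'b::euclidean_space" and A :: real
  assumes f: "f \<in> sobolev n" and n: "n \<le> 2 * p"
    and A: "\<And>K. finite K \<Longrightarrow> K \<subseteq> lattice \<Longrightarrow>
      (\<Sum>k\<in>K. (1 + norm k ^ 4) ^ p * (norm (hcoef k f))\<^sup>2) \<le> A"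
  shows "(sobolev_norm n f)\<^sup>2 \<le>
    of_nat (card {bs :: (real^'d) list. bs \<in> lists Basis \<and> length bs \<le> n})
      * ennreal (DIM('b) * A / (2 * pi) ^ CARD('d))"
proof -
  have "L2_square (wderiv bs f) \<le> ennreal (DIM('b) * A / (2 * pi) ^ CARD('d))"
    if bs: "bs \<in> lists Basis" "length bs \<le> n" for bs
  proof (rule plancherel_inequality)
    show "integrable torus (wderiv bs f)"
      using sobolev_wderiv(1)[OF f bs] by (rule weak_deriv_integrable)
    fix K :: "(real^'d) set" assume K: "finite K" "K \<subseteq> lattice"
    have "(\<Sum>k\<in>K. (norm (hcoef k (wderiv bs f)))\<^sup>2)
        = (\<Sum>k\<in>K. (\<Prod>b\<leftarrow>bs. (k \<bullet> b)\<^sup>2) * (norm (hcoef ((- 1) ^ length bs *\<^sub>R k) f))\<^sup>2)"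
      using K by (intro sum.cong) (auto simp: hcoef_wderiv[OF f bs] subset_iff)
    also have "\<dots> \<le> (\<Sum>k\<in>K. (1 + norm ((- 1) ^ length bs *\<^sub>R k) ^ 4) ^ p * (norm (hcoef ((- 1) ^ length bs *\<^sub>R k) f))\<^sup>2)"
      using bs n by (intro sum_mono mult_right_mono) (auto simp: power_abs intro!: symbol_le_weight)
    also have "\<dots> = (\<Sum>k\<in>((\<lambda>k. (- 1) ^ length bs *\<^sub>R k) ` K). (1 + norm k ^ 4) ^ p * (norm (hcoef k f))\<^sup>2)"
      by (rule sum_sign_reindex)
    also have "\<dots> \<le> A"
      using K by (intro A) auto
    finally show "(\<Sum>k\<in>K. (norm (hcoef k (wderiv bs f)))\<^sup>2) \<le> A" .
  qed
  then have "(sobolev_norm n f)\<^sup>2 \<le>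
      (\<Sum>bs | (bs :: (real^'d) list) \<in> lists Basis \<and> length bs \<le> n. ennreal (DIM('b) * A / (2 * pi) ^ CARD('d)))"
    unfolding sobolev_norm_square by (intro sum_mono) auto
  then show ?thesis by simp
qed

lemma norm_square_axes: "(norm k)\<^sup>2 = (\<Sum>i\<in>UNIV. (k \<bullet> axis i 1)\<^sup>2)" for k :: "real^'d"
  by (simp add: norm_vec_def L2_set_def sum_nonneg inner_axis)

text \<open>Cauchy-Schwarz against the constant 1. It recovers \<open>norm k ^ 4\<close> from the
  symbols of the pure second derivatives.\<close>

lemma norm_power4_le: "norm k ^ 4 \<le> CARD('d) * (\<Sum>i\<in>UNIV. (k \<bullet> axis i 1) ^ 4)" for k :: "real^'d"
proof -
  have "norm k ^ 4 = (\<Sum>i\<in>UNIV. 1 * (k \<bullet> axis i 1)\<^sup>2)\<^sup>2"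
    by (simp add: norm_square_axes[symmetric] power_mult[symmetric])
  also have "\<dots> \<le> (\<Sum>i\<in>(UNIV::'d set). 1\<^sup>2) * (\<Sum>i\<in>UNIV. ((k \<bullet> axis i 1)\<^sup>2)\<^sup>2)"
    by (rule Cauchy_Schwarz_ineq_sum)
  finally show ?thesis by (simp add: power_mult[symmetric])
qed

text \<open>Bessel's inequality for \<open>f\<close> and its pure second derivatives. In the factor
  \<open>CARD('d) + 1\<close> the 1 belongs to \<open>f\<close>, and \<open>CARD('d)\<close> comes
  from \<open>norm_power4_le\<close>.\<close>

lemma hcoef_le_sobolev_norm:
  fixes f :: "real^'d \<Rightarrow> 'b::euclidean_space"
  assumes f: "f \<in> sobolev n" and n: "n \<ge> 2" and K: "finite K" "K \<subseteq> lattice"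
  shows "ennreal (\<Sum>k\<in>K. (1 + norm k ^ 4) * (norm (hcoef k f))\<^sup>2)
    \<le> ennreal (real (CARD('d) + 1) * (2 * pi) ^ CARD('d)) * (sobolev_norm 2 f)\<^sup>2"
proof -
  define V :: real where "V = (2 * pi) ^ CARD('d)"
  define D where "D i = [axis i 1, axis i 1 :: real^'d]" for i
  have D: "D i \<in> lists Basis" "length (D i) \<le> n" for i using n by (auto simp: D_def)
  \<comment> \<open>The function itself enters \<open>sobolev_norm\<close> only through the chosen
    representative \<open>wderiv []\<close>, so order 0 is treated like the other orders.\<close>
  have ND: "[] \<in> lists (Basis :: (real^'d) set)" "length ([] :: (real^'d) list) \<le> n" by auto
  have "(\<Sum>k\<in>K. (1 + norm k ^ 4) * (norm (hcoef k f))\<^sup>2)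
      \<le> (\<Sum>k\<in>K. (norm (hcoef k (wderiv [] f)))\<^sup>2 + CARD('d) * (\<Sum>i\<in>UNIV. (norm (hcoef k (wderiv (D i) f)))\<^sup>2))"
  proof (rule sum_mono)
    fix k assume "k \<in> K"
    then have k: "k \<in> lattice" using K by auto
    have "(1 + norm k ^ 4) * (norm (hcoef k f))\<^sup>2
        \<le> (1 + CARD('d) * (\<Sum>i\<in>UNIV. (k \<bullet> axis i 1) ^ 4)) * (norm (hcoef k f))\<^sup>2"
      using norm_power4_le[of k] by (intro mult_right_mono) auto
    then show "(1 + norm k ^ 4) * (norm (hcoef k f))\<^sup>2
      \<le> (norm (hcoef k (wderiv [] f)))\<^sup>2 + CARD('d) * (\<Sum>i\<in>UNIV. (norm (hcoef k (wderiv (D i) f)))\<^sup>2)"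
      unfolding hcoef_wderiv[OF f ND k] hcoef_wderiv[OF f D k]
      by (simp add: D_def distrib_right sum_distrib_right mult.assoc numeral_eq_Suc)
  qed
  then have "ennreal (\<Sum>k\<in>K. (1 + norm k ^ 4) * (norm (hcoef k f))\<^sup>2)
      \<le> ennreal ((\<Sum>k\<in>K. (norm (hcoef k (wderiv [] f)))\<^sup>2) +
          CARD('d) * (\<Sum>i\<in>UNIV. \<Sum>k\<in>K. (norm (hcoef k (wderiv (D i) f)))\<^sup>2))"
    by (intro ennreal_leI) (simp add: sum.distrib sum_distrib_left[symmetric] sum.swap[of _ K])
  also have "\<dots> = ennreal (\<Sum>k\<in>K. (norm (hcoef k (wderiv [] f)))\<^sup>2) +
          of_nat CARD('d) * (\<Sum>i\<in>UNIV. ennreal (\<Sum>k\<in>K. (norm (hcoef k (wderiv (D i) f)))\<^sup>2))"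
    by (simp add: sum_nonneg ennreal_mult ennreal_of_nat_eq_real_of_nat)
  also have "\<dots> \<le> ennreal V * L2_square (wderiv [] f) + of_nat CARD('d) * (\<Sum>i\<in>UNIV. ennreal V * L2_square (wderiv (D i) f))"
    unfolding V_def
    by (intro add_mono mult_left_mono sum_mono bessel_inequality K borel_measurable_integrable
        weak_deriv_integrable(2)[OF sobolev_wderiv(1)[OF f]] D ND) auto
  also have "\<dots> = ennreal V * (L2_square (wderiv [] f) + of_nat CARD('d) * (\<Sum>i\<in>UNIV. L2_square (wderiv (D i) f)))"
    by (simp add: distrib_left sum_distrib_left mult_ac)
  also have "\<dots> \<le> ennreal V * ((sobolev_norm 2 f)\<^sup>2 + of_nat CARD('d) * (sobolev_norm 2 f)\<^sup>2)"
  proof (intro mult_left_mono add_mono)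
    have fin: "finite {bs. bs \<in> lists (Basis :: (real^'d) set) \<and> length bs \<le> 2}"
      by (rule finite_multi_indices)
    show "L2_square (wderiv [] f) \<le> (sobolev_norm 2 f)\<^sup>2"
      unfolding sobolev_norm_square by (rule member_le_sum[OF _ _ fin]) auto
    have "inj D" by (auto simp: inj_on_def D_def axis_eq_axis)
    then have "(\<Sum>i\<in>UNIV. L2_square (wderiv (D i) f)) = (\<Sum>bs\<in>range D. L2_square (wderiv bs f))"
      by (simp add: sum.reindex)
    also have "\<dots> \<le> (sobolev_norm 2 f)\<^sup>2"
      unfolding sobolev_norm_square by (rule sum_mono2[OF fin]) (auto simp: D_def)
    finally show "(\<Sum>i\<in>UNIV. L2_square (wderiv (D i) f)) \<le> (sobolev_norm 2 f)\<^sup>2" .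
  qed auto
  also have "\<dots> = ennreal (real (CARD('d) + 1) * V) * (sobolev_norm 2 f)\<^sup>2"
  proof -
    have "ennreal (real (CARD('d) + 1) * V) = of_nat (CARD('d) + 1) * ennreal V"
      by (subst ennreal_mult) (auto simp: V_def ennreal_of_nat_eq_real_of_nat)
    then show ?thesis by (simp add: distrib_left distrib_right mult_ac)
  qed
  finally show ?thesis by (simp only: V_def)
qed

lemma L2_square_grad:
  fixes f :: "real^'d \<Rightarrow> 'b::euclidean_space"
  assumes "f \<in> sobolev n" "n \<ge> 1"
  shows "L2_square (grad f) = (\<Sum>i\<in>UNIV. L2_square (wderiv [axis i 1] f))"
proof -
  have [measurable]: "wderiv [axis i 1] f \<in> borel_measurable torus" for i
    using assms by (intro borel_measurable_integrable weak_deriv_integrable(2)[OF sobolev_wderiv(1)[OF assms(1)]]) auto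
  have "L2_square (grad f) = (\<integral>\<^sup>+x. (\<Sum>i\<in>UNIV. ennreal ((norm (wderiv [axis i 1] f x))\<^sup>2)) \<partial>torus)"
    by (simp add: L2_square_def grad_def norm_vec_def L2_set_def sum_nonneg)
  also have "\<dots> = (\<Sum>i\<in>UNIV. L2_square (wderiv [axis i 1] f))"
    by (subst nn_integral_sum) (auto simp: L2_square_def)
  finally show ?thesis .
qed

lemma hcoef_grad:
  fixes f :: "real^'d \<Rightarrow> 'b::euclidean_space"
  assumes f: "f \<in> sobolev n" "n \<ge> 1" and k: "k \<in> lattice"
  shows "(\<Sum>i\<in>UNIV. (norm (hcoef k (wderiv [axis i 1] f)))\<^sup>2) = (norm (- k))\<^sup>2 * (norm (hcoef (- k) f))\<^sup>2"
proof -
  have "[axis i 1 :: real^'d] \<in> lists Basis" "length [axis i 1 :: real^'d] \<le> n" for i :: 'd using f by auto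
  from hcoef_wderiv[OF f(1) this k]
  show ?thesis by (simp add: norm_square_axes[of k] sum_distrib_right)
qed

lemma hcoef_grad_le:
  fixes f :: "real^'d \<Rightarrow> 'b::euclidean_space"
  assumes f: "f \<in> sobolev n" "n \<ge> 1" and K: "finite K" "K \<subseteq> lattice"
  shows "ennreal (\<Sum>k\<in>K. (norm k)\<^sup>2 * (norm (hcoef k f))\<^sup>2) \<le> ennreal ((2 * pi) ^ CARD('d)) * L2_square (grad f)"
proof -
  have mK: "finite (uminus ` K)" "uminus ` K \<subseteq> lattice" using K by auto
  have "(\<Sum>k\<in>K. (norm k)\<^sup>2 * (norm (hcoef k f))\<^sup>2)
      = (\<Sum>k\<in>uminus ` K. (norm (- k))\<^sup>2 * (norm (hcoef (- k) f))\<^sup>2)"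
    by (subst sum.reindex) auto
  also have "\<dots> = (\<Sum>k\<in>uminus ` K. \<Sum>i\<in>UNIV. (norm (hcoef k (wderiv [axis i 1] f)))\<^sup>2)"
    using K by (intro sum.cong refl hcoef_grad[OF f, symmetric]) auto
  also have "\<dots> = (\<Sum>i\<in>UNIV. \<Sum>k\<in>uminus ` K. (norm (hcoef k (wderiv [axis i 1] f)))\<^sup>2)"
    by (rule sum.swap)
  finally have "ennreal (\<Sum>k\<in>K. (norm k)\<^sup>2 * (norm (hcoef k f))\<^sup>2)
      = (\<Sum>i\<in>UNIV. ennreal (\<Sum>k\<in>uminus ` K. (norm (hcoef k (wderiv [axis i 1] f)))\<^sup>2))"
    by (simp add: sum_nonneg)
  also have "\<dots> \<le> (\<Sum>i\<in>UNIV. ennreal ((2 * pi) ^ CARD('d)) * L2_square (wderiv [axis i 1] f))"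
    using f(2) by (intro sum_mono bessel_inequality mK borel_measurable_integrable
        weak_deriv_integrable(2)[OF sobolev_wderiv(1)[OF f(1)]]) auto
  finally show ?thesis
    unfolding L2_square_grad[OF f] by (simp add: sum_distrib_left)
qed

text \<open>Each partial derivative is bounded by the full \<open>A\<close>, and
  \<open>plancherel_inequality\<close> adds a factor \<open>DIM('b)\<close>; for vector fields in
  dimension three the product of the two dimensions is 9.\<close>

lemma L2_square_grad_le:
  fixes f :: "real^'d \<Rightarrow> 'b::euclidean_space" and A :: real
  assumes f: "f \<in> sobolev n" "n \<ge> 1"
    and A: "\<And>K. finite K \<Longrightarrow> K \<subseteq> lattice \<Longrightarrow> (\<Sum>k\<in>K. (norm k)\<^sup>2 * (norm (hcoef k f))\<^sup>2) \<le> A"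
  shows "L2_square (grad f) \<le> ennreal (real CARD('d) * (DIM('b) * A / (2 * pi) ^ CARD('d)))"
proof -
  have "A \<ge> 0" using A[of "{}"] by simp
  have "L2_square (wderiv [axis i 1] f) \<le> ennreal (DIM('b) * A / (2 * pi) ^ CARD('d))" for i
  proof (rule plancherel_inequality)
    show "integrable torus (wderiv [axis i 1] f)"
      using f by (intro weak_deriv_integrable(2)[OF sobolev_wderiv(1)]) auto
    fix K :: "(real^'d) set" assume K: "finite K" "K \<subseteq> lattice"
    have "(\<Sum>k\<in>K. (norm (hcoef k (wderiv [axis i 1] f)))\<^sup>2) \<le> (\<Sum>k\<in>K. (norm (- k))\<^sup>2 * (norm (hcoef (- k) f))\<^sup>2)"
    proof (rule sum_mono)
      fix k assume "k \<in> K"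
      then have "k \<in> lattice" using K by auto
      from hcoef_grad[OF f this] show "(norm (hcoef k (wderiv [axis i 1] f)))\<^sup>2 \<le> (norm (- k))\<^sup>2 * (norm (hcoef (- k) f))\<^sup>2"
        using member_le_sum[of i UNIV "\<lambda>i. (norm (hcoef k (wderiv [axis i 1] f)))\<^sup>2"] by simp
    qed
    also have "\<dots> = (\<Sum>k\<in>uminus ` K. (norm k)\<^sup>2 * (norm (hcoef k f))\<^sup>2)"
      by (subst sum.reindex) auto
    also have "\<dots> \<le> A" using K by (intro A) auto
    finally show "(\<Sum>k\<in>K. (norm (hcoef k (wderiv [axis i 1] f)))\<^sup>2) \<le> A" .
  qed
  then have "L2_square (grad f) \<le> (\<Sum>i\<in>(UNIV::'d set). ennreal (DIM('b) * A / (2 * pi) ^ CARD('d)))"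
    unfolding L2_square_grad[OF f] by (intro sum_mono)
  then show ?thesis
    using \<open>A \<ge> 0\<close> by (simp add: ennreal_of_nat_eq_real_of_nat ennreal_mult[symmetric])
qed

section \<open>The embedding of \<open>H\<^sup>2\<close> into the bounded functions in dimension three\<close>

text \<open>The exponent is one third of -2, as the decay \<open>(1 + (norm k)^2) powr (- 2)\<close>
  will be shared equally by three coordinates. Comparison with the exponent -4/3, which is less than
  -1, gives convergence.\<close>

lemma int_sum_bounded:
  obtains S :: real where "S \<ge> 0" "\<And>I. finite I \<Longrightarrow> (\<Sum>m\<in>I. (1 + (real_of_int m)\<^sup>2) powr (- 2 / 3)) \<le> S"
proof -
  let ?a = "\<lambda>n::nat. real n powr (- 4 / 3)"
  have sm: "summable ?a" by (simp add: summable_real_powr_iff)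
  \<comment> \<open>The term at 0 contributes 1, the positive and the negative integers one series
    each.\<close>
  define S where "S = 1 + 2 * suminf ?a"
  have "S \<ge> 0" unfolding S_def by (intro add_nonneg_nonneg mult_nonneg_nonneg suminf_nonneg sm) auto
  moreover have "(\<Sum>m\<in>I. (1 + (real_of_int m)\<^sup>2) powr (- 2 / 3)) \<le> S" if "finite I" for I
  proof -
    let ?f = "\<lambda>m::int. (1 + (real_of_int m)\<^sup>2) powr (- 2 / 3)"
    have le: "?f m \<le> ?a (nat \<bar>m\<bar>)" if "m \<noteq> 0" for m
    proof -
      have "?f m \<le> ((real_of_int m)\<^sup>2) powr (- 2 / 3)"
        using that by (intro powr_mono2') auto
      also have "((real_of_int m)\<^sup>2) powr (- 2 / 3) = (\<bar>real_of_int m\<bar> powr 2) powr (- 2 / 3)"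
        using that by simp
      also have "\<dots> = ?a (nat \<bar>m\<bar>)"
        unfolding powr_powr by simp
      finally show ?thesis .
    qed
    define P N where "P = I \<inter> {0<..}" and "N = I \<inter> {..<0}"
    have fin: "finite P" "finite N" using that by (auto simp: P_def N_def)
    have inj: "inj_on (\<lambda>m. nat \<bar>m\<bar>) P" "inj_on (\<lambda>m. nat \<bar>m\<bar>) N"
      by (auto simp: inj_on_def P_def N_def)
    have part: "(\<Sum>m\<in>J. ?f m) \<le> suminf ?a" if J: "finite J" "inj_on (\<lambda>m. nat \<bar>m\<bar>) J" "0 \<notin> J" for J
    proof -
      have "(\<Sum>m\<in>J. ?f m) \<le> (\<Sum>m\<in>J. ?a (nat \<bar>m\<bar>))"
        using J le by (intro sum_mono) metis
      also have "\<dots> = sum ?a ((\<lambda>m. nat \<bar>m\<bar>) ` J)"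
        using J(2) by (simp add: sum.reindex)
      also have "\<dots> \<le> suminf ?a"
        using J(1) by (intro sum_le_suminf sm) auto
      finally show ?thesis .
    qed
    have "(\<Sum>m\<in>I. ?f m) \<le> (\<Sum>m\<in>{0} \<union> P \<union> N. ?f m)"
      using that fin by (intro sum_mono2) (auto simp: P_def N_def)
    also have "\<dots> = ?f 0 + (\<Sum>m\<in>P. ?f m) + (\<Sum>m\<in>N. ?f m)"
      using fin by (subst sum.union_disjoint; (auto simp: P_def N_def)?)+
    also have "\<dots> \<le> 1 + suminf ?a + suminf ?a"
      using fin inj by (intro add_mono part) (auto simp: P_def N_def)
    finally show ?thesis by (simp add: S_def)
  qed
  ultimately show ?thesis using that by blast
qed

text \<open>The restriction on the dimension enters here: in dimension three the exponent 4 makes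
  the lattice sum converge. As every coordinate is at most \<open>norm k\<close>, the summand is at
  most twice a product of three functions of one coordinate, and the sum over a box of integers
  factorises.\<close>

lemma lattice_sum_bounded:
  obtains S :: real where "S \<ge> 0"
    "\<And>K :: (real^3) set. finite K \<Longrightarrow> K \<subseteq> lattice \<Longrightarrow> (\<Sum>k\<in>K. 1 / (1 + norm k ^ 4)) \<le> S"
proof -
  obtain S where S: "S \<ge> 0" "\<And>I. finite I \<Longrightarrow> (\<Sum>m\<in>I. (1 + (real_of_int m)\<^sup>2) powr (- 2 / 3)) \<le> S"
    using int_sum_bounded by blast
  let ?f = "\<lambda>r::real. (1 + r\<^sup>2) powr (- 2 / 3)"
  have pointwise: "1 / (1 + norm k ^ 4) \<le> 2 * (\<Prod>i\<in>UNIV. ?f (k $ i))" for k :: "real^3"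
  proof -
    have "(1 + (norm k)\<^sup>2) powr (- 2) = (\<Prod>i\<in>(UNIV::3 set). (1 + (norm k)\<^sup>2) powr (- 2 / 3))"
      by (simp add: power3_eq_cube powr_add[symmetric])
    also have "\<dots> \<le> (\<Prod>i\<in>UNIV. ?f (k $ i))"
    proof (intro prod_mono conjI powr_mono2')
      fix i
      show "1 + (k $ i)\<^sup>2 \<le> 1 + (norm k)\<^sup>2"
        using component_le_norm_cart[of k i] by (simp add: abs_le_square_iff[symmetric])
      show "0 < 1 + (k $ i)\<^sup>2" by (simp add: add_pos_nonneg)
    qed auto
    finally have "(1 + (norm k)\<^sup>2) powr (- 2) \<le> (\<Prod>i\<in>UNIV. ?f (k $ i))" .
    moreover have "(1 + (norm k)\<^sup>2) powr (- 2) = 1 / (1 + (norm k)\<^sup>2)\<^sup>2"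
      by (simp add: powr_minus_divide add_pos_nonneg)
    moreover have "(1 + (norm k)\<^sup>2)\<^sup>2 \<le> 2 * (1 + norm k ^ 4)"
      using sum_squares_bound[of 1 "(norm k)\<^sup>2"] by (simp add: power2_sum power_mult[symmetric])
    then have "1 / (2 * (1 + norm k ^ 4)) \<le> 1 / (1 + (norm k)\<^sup>2)\<^sup>2"
      by (intro divide_left_mono mult_pos_pos zero_less_power add_pos_nonneg) auto
    ultimately have "1 / (2 * (1 + norm k ^ 4)) \<le> (\<Prod>i\<in>UNIV. ?f (k $ i))" by linarith
    then have "2 * (1 / (2 * (1 + norm k ^ 4))) \<le> 2 * (\<Prod>i\<in>UNIV. ?f (k $ i))"
      by (rule mult_left_mono) simp
    moreover have "2 * (1 / (2 * a)) = 1 / a" for a :: real by simp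
    ultimately show ?thesis by (simp only:)
  qed
  have "(\<Sum>k\<in>K. 1 / (1 + norm k ^ 4)) \<le> 2 * S ^ 3" if K: "finite K" "K \<subseteq> lattice" for K :: "(real^3) set"
  proof -
    \<comment> \<open>All integers that occur as a coordinate of a point of \<open>K\<close>; thus
      \<open>K\<close> lies in the cube with side set \<open>I\<close>.\<close>
    define I where "I = (\<Union>i. (\<lambda>k. \<lfloor>k $ i\<rfloor>) ` K)"
    have "finite I" using K by (auto simp: I_def)
    define e where "e g = (\<chi> i. real_of_int (g i))" for g :: "3 \<Rightarrow> int"
    have inj: "inj_on e A" for A by (auto simp: inj_on_def e_def vec_eq_iff fun_eq_iff)
    have sub: "K \<subseteq> e ` (PiE UNIV (\<lambda>_. I))"
    proof
      fix k assume k: "k \<in> K"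
      then have "e (\<lambda>i. \<lfloor>k $ i\<rfloor>) = k" using K by (auto simp: e_def vec_eq_iff lattice_def subset_iff)
      moreover have "(\<lambda>i. \<lfloor>k $ i\<rfloor>) \<in> PiE UNIV (\<lambda>_. I)" using k by (auto simp: I_def)
      ultimately show "k \<in> e ` (PiE UNIV (\<lambda>_. I))" by (metis imageI)
    qed
    have finPi: "finite (PiE (UNIV :: 3 set) (\<lambda>_. I))" using \<open>finite I\<close> by (intro finite_PiE) auto
    have "(\<Sum>k\<in>K. 1 / (1 + norm k ^ 4)) \<le> (\<Sum>k\<in>K. 2 * (\<Prod>i\<in>UNIV. ?f (k $ i)))"
      by (intro sum_mono pointwise)
    also have "\<dots> \<le> (\<Sum>k\<in>e ` (PiE UNIV (\<lambda>_. I)). 2 * (\<Prod>i\<in>UNIV. ?f (k $ i)))"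
      using finPi sub by (intro sum_mono2) (auto intro!: prod_nonneg)
    also have "\<dots> = 2 * (\<Sum>g\<in>PiE (UNIV :: 3 set) (\<lambda>_. I). \<Prod>i\<in>UNIV. ?f (real_of_int (g i)))"
      by (subst sum.reindex[OF inj]) (simp add: e_def sum_distrib_left)
    also have "\<dots> = 2 * (\<Prod>i\<in>(UNIV::3 set). \<Sum>m\<in>I. ?f (real_of_int m))"
      using \<open>finite I\<close> by (subst prod_sum_PiE) auto
    also have "\<dots> \<le> 2 * (\<Prod>i\<in>(UNIV::3 set). S)"
      using S(2)[OF \<open>finite I\<close>] by (intro mult_left_mono prod_mono) (auto intro!: sum_nonneg)
    finally show ?thesis by simp
  qed
  then show ?thesis using S(1) by (intro that[of "2 * S ^ 3"]) auto
qed

text \<open>The embedding is phrased with partial sums of weighted coefficients instead of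
  \<open>sobolev_norm\<close>, since these sums are what the energy estimate propagates. The
  \<open>itself\<close> argument fixes the value type of the functions.\<close>

definition embedding_constant :: "'b::euclidean_space itself \<Rightarrow> real \<Rightarrow> bool" where
  "embedding_constant _ C \<longleftrightarrow> C \<ge> 0 \<and> (\<forall>(f :: real^3 \<Rightarrow> 'b) A. integrable torus f \<longrightarrow>
     (\<forall>K. finite K \<longrightarrow> K \<subseteq> lattice \<longrightarrow> (\<Sum>k\<in>K. (1 + norm k ^ 4) * (norm (hcoef k f))\<^sup>2) \<le> A) \<longrightarrow>
     (AE x in torus. norm (f x) \<le> C * sqrt A))"

text \<open>Cauchy-Schwarz, with the square root of the weight on one factor and of its reciprocal
  on the other, makes the coefficients absolutely summable; \<open>norm_le_of_hcoef_summable\<close>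
  then bounds the function.\<close>

lemma embedding_constant_exists:
  obtains C where "embedding_constant TYPE('b::euclidean_space) C"
proof -
  obtain S :: real where S: "S \<ge> 0"
    "\<And>K :: (real^3) set. finite K \<Longrightarrow> K \<subseteq> lattice \<Longrightarrow> (\<Sum>k\<in>K. 1 / (1 + norm k ^ 4)) \<le> S"
    using lattice_sum_bounded by blast
  have "AE x in torus. norm (f x) \<le> DIM('b) * (2 * sqrt S / (2 * pi) ^ 3) * sqrt A"
    if f: "integrable torus f" and A: "\<And>K. finite K \<Longrightarrow> K \<subseteq> lattice \<Longrightarrow> (\<Sum>k\<in>K. (1 + norm k ^ 4) * (norm (hcoef k f))\<^sup>2) \<le> A"
    for f :: "real^3 \<Rightarrow> 'b" and A
  proof -
    have "A \<ge> 0" using A[of "{}"] by simp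
    have "(\<Sum>k\<in>K. norm (hcoef k f)) \<le> sqrt S * sqrt A" if K: "finite K" "K \<subseteq> lattice" for K
    proof -
      have w: "1 + norm k ^ 4 > 0" for k :: "real^3" by (simp add: add_pos_nonneg)
      have "(\<Sum>k\<in>K. norm (hcoef k f))\<^sup>2
          = (\<Sum>k\<in>K. sqrt (1 / (1 + norm k ^ 4)) * (sqrt (1 + norm k ^ 4) * norm (hcoef k f)))\<^sup>2"
        using w by (simp add: real_sqrt_divide less_imp_neq[THEN not_sym])
      also have "\<dots> \<le> (\<Sum>k\<in>K. (sqrt (1 / (1 + norm k ^ 4)))\<^sup>2) * (\<Sum>k\<in>K. (sqrt (1 + norm k ^ 4) * norm (hcoef k f))\<^sup>2)"
        by (rule Cauchy_Schwarz_ineq_sum)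
      also have "\<dots> = (\<Sum>k\<in>K. 1 / (1 + norm k ^ 4)) * (\<Sum>k\<in>K. (1 + norm k ^ 4) * (norm (hcoef k f))\<^sup>2)"
        using w by (simp add: power_mult_distrib less_imp_le)
      also have "\<dots> \<le> S * A"
        using S K A[OF K] w by (intro mult_mono sum_nonneg) (auto simp: less_imp_le)
      finally show ?thesis
        by (metis real_le_rsqrt real_sqrt_mult)
    qed
    from norm_le_of_hcoef_summable[OF f this] show ?thesis by (simp add: mult_ac)
  qed
  moreover have "0 \<le> DIM('b) * (2 * sqrt S / (2 * pi) ^ 3)" using S(1) by simp
  ultimately have "embedding_constant TYPE('b) (DIM('b) * (2 * sqrt S / (2 * pi) ^ 3))"
    unfolding embedding_constant_def by blast
  then show ?thesis by (rule that)
qed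

section \<open>The convection term and the pairings with Hartley functions\<close>

lemma norm_advect_le: "norm (advect v f x) \<le> norm (v x) * norm (grad f x)"
proof -
  have "norm (advect v f x) \<le> (\<Sum>i\<in>UNIV. \<bar>v x $ i\<bar> * norm (wderiv [axis i 1] f x))"
    unfolding advect_def by (rule order_trans[OF norm_sum]) simp
  also have "\<dots> \<le> norm (v x) * norm (grad f x)"
    using L2_set_mult_ineq[of "\<lambda>i. norm (v x $ i)" "\<lambda>i. norm (wderiv [axis i 1] f x)" UNIV]
    by (simp add: norm_vec_def grad_def L2_set_def)
  finally show ?thesis .
qed

lemma advect_measurable:
  fixes v :: "real^'d \<Rightarrow> real^'d" and f :: "real^'d \<Rightarrow> 'b::euclidean_space"
  assumes "v \<in> borel_measurable torus" "f \<in> sobolev n" "n \<ge> 1"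
  shows "advect v f \<in> borel_measurable torus"
proof -
  have "wderiv [axis i 1] f \<in> borel_measurable torus" for i
    using assms by (intro borel_measurable_integrable weak_deriv_integrable(2)[OF sobolev_wderiv(1)]) auto
  moreover have "(\<lambda>x. v x $ i) \<in> borel_measurable torus" for i
    using borel_measurable_inner[OF assms(1), of "\<lambda>_. axis i 1"] by (simp add: inner_axis)
  ultimately show ?thesis
    unfolding advect_def[abs_def] by (intro borel_measurable_sum borel_measurable_scaleR)
qed

lemma norm_grad_measurable:
  fixes f :: "real^'d \<Rightarrow> 'b::euclidean_space"
  assumes "f \<in> sobolev n" "n \<ge> 1"
  shows "(\<lambda>x. norm (grad f x)) \<in> borel_measurable torus"
proof -
  have [measurable]: "wderiv [axis i 1] f \<in> borel_measurable torus" for i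
    using assms by (intro borel_measurable_integrable weak_deriv_integrable(2)[OF sobolev_wderiv(1)[OF assms(1)]]) auto
  show ?thesis
    unfolding grad_def norm_vec_def L2_set_def by simp
qed

lemma L2_square_advect_le:
  fixes v :: "real^'d \<Rightarrow> real^'d" and f :: "real^'d \<Rightarrow> 'b::euclidean_space"
  assumes "AE x in torus. norm (v x) \<le> c" "c \<ge> 0" and f: "f \<in> sobolev n" "n \<ge> 1"
  shows "L2_square (advect v f) \<le> ennreal (c\<^sup>2) * L2_square (grad f)"
proof -
  have "L2_square (advect v f) \<le> (\<integral>\<^sup>+x. ennreal (c\<^sup>2) * ennreal ((norm (grad f x))\<^sup>2) \<partial>torus)"
    unfolding L2_square_def
  proof (rule nn_integral_mono_AE)
    show "AE x in torus. ennreal ((norm (advect v f x))\<^sup>2) \<le> ennreal (c\<^sup>2) * ennreal ((norm (grad f x))\<^sup>2)"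
      using assms(1)
    proof eventually_elim
      case (elim x)
      have "norm (advect v f x) \<le> c * norm (grad f x)"
        using norm_advect_le[of v f x] mult_right_mono[OF elim norm_ge_zero[of "grad f x"]] by linarith
      then have "(norm (advect v f x))\<^sup>2 \<le> (c * norm (grad f x))\<^sup>2" by (intro power_mono) auto
      then show ?case by (simp add: ennreal_mult[symmetric] power_mult_distrib ennreal_leI)
    qed
  qed
  also have "\<dots> = ennreal (c\<^sup>2) * L2_square (grad f)"
    unfolding L2_square_def using norm_grad_measurable[OF f] by (intro nn_integral_cmult) auto
  finally show ?thesis .
qed

text \<open>Equality only almost everywhere is assumed because \<open>g\<close> will be a derivative
  of a Hartley function as selected by \<open>wderiv\<close>.\<close>

lemma inner_hartley_AE:
  fixes f g :: "real^'d \<Rightarrow> 'b::euclidean_space"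
  assumes f: "integrable torus f" and g: "g \<in> borel_measurable torus"
    and eq: "AE x in torus. g x = hartley k x *\<^sub>R v"
  shows "integrable torus (\<lambda>x. f x \<bullet> g x)" "(LINT x|torus. f x \<bullet> g x) = hcoef k f \<bullet> v"
proof -
  have [measurable]: "f \<in> borel_measurable torus" "g \<in> borel_measurable torus" using f g by auto
  note I = hcoef_integrable[OF f, of k]
  have I': "integrable torus (\<lambda>x. (hartley k x *\<^sub>R f x) \<bullet> v)" using I by (rule integrable_inner_left)
  have m [measurable]: "(\<lambda>x. (hartley k x *\<^sub>R f x) \<bullet> v) \<in> borel_measurable torus" using I' by (rule borel_measurable_integrable)
  have AE: "AE x in torus. (hartley k x *\<^sub>R f x) \<bullet> v = f x \<bullet> g x"
    using eq by eventually_elim simp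
  show "integrable torus (\<lambda>x. f x \<bullet> g x)"
    by (intro integrable_cong_AE_imp[OF I' _ AE]) measurable
  have "(LINT x|torus. f x \<bullet> g x) = (LINT x|torus. (hartley k x *\<^sub>R f x) \<bullet> v)"
    using AE by (intro integral_cong_AE m borel_measurable_inner) (auto elim: eventually_mono)
  also have "\<dots> = hcoef k f \<bullet> v"
    unfolding hcoef_def by (rule integral_inner_left) (rule I)
  finally show "(LINT x|torus. f x \<bullet> g x) = hcoef k f \<bullet> v" .
qed

lemma torus_inner_hartley:
  fixes f :: "real^'d \<Rightarrow> 'b::euclidean_space"
  assumes "integrable torus f"
  shows "torus_inner f (\<lambda>x. hartley k x *\<^sub>R v) = hcoef k f \<bullet> v"
  unfolding torus_inner_def
  by (rule inner_hartley_AE(2)[OF assms]) (auto intro!: continuous_torus_measurable continuous_intros)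

text \<open>Both gradients are evaluated at frequency \<open>- k\<close>, where each carries the
  same factor \<open>k \<bullet> axis i 1\<close>; the squares of these factors add up to
  \<open>(norm k)^2\<close>.\<close>

lemma torus_inner_grad_hartley:
  fixes f :: "real^'d \<Rightarrow> 'b::euclidean_space"
  assumes f: "f \<in> sobolev n" "n \<ge> 1" and k: "k \<in> lattice"
  shows "torus_inner (grad f) (grad (\<lambda>x. hartley k x *\<^sub>R v)) = (norm k)\<^sup>2 * (hcoef k f \<bullet> v)"
proof -
  let ?\<psi> = "\<lambda>x. hartley k x *\<^sub>R v"
  have wf: "weak_deriv [axis i 1] f (wderiv [axis i 1] f)" for i
    using f by (intro sobolev_wderiv) auto
  have w\<psi>: "weak_deriv [axis i 1] ?\<psi> (\<lambda>x. hartley (- k) x *\<^sub>R ((k \<bullet> axis i 1) *\<^sub>R v))" for i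
    using weak_deriv_hartley[OF k, of "[axis i 1]" v] by simp
  have AE: "AE x in torus. wderiv [axis i 1] ?\<psi> x = hartley (- k) x *\<^sub>R ((k \<bullet> axis i 1) *\<^sub>R v)" for i
    by (rule wderiv_unique[OF w\<psi>])
  have meas: "wderiv [axis i 1] ?\<psi> \<in> borel_measurable torus" for i
    by (intro borel_measurable_integrable weak_deriv_integrable(2)[OF weak_deriv_wderiv[OF w\<psi>]])
  note I = inner_hartley_AE[OF weak_deriv_integrable(2)[OF wf] meas AE]
  have c: "hcoef (- k) (wderiv [axis i 1] f) = (k \<bullet> axis i 1) *\<^sub>R hcoef k f" for i
    using hcoef_weak_deriv[OF wf, of "- k"] k by simp
  have "torus_inner (grad f) (grad ?\<psi>) = (LINT x|torus. (\<Sum>i\<in>UNIV. wderiv [axis i 1] f x \<bullet> wderiv [axis i 1] ?\<psi> x))"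
    by (simp add: torus_inner_def grad_def inner_vec_def)
  also have "\<dots> = (\<Sum>i\<in>UNIV. hcoef (- k) (wderiv [axis i 1] f) \<bullet> ((k \<bullet> axis i 1) *\<^sub>R v))"
    by (subst Bochner_Integration.integral_sum) (simp_all only: I)
  also have "\<dots> = (norm k)\<^sup>2 * (hcoef k f \<bullet> v)"
    by (simp add: c norm_square_axes[of k] sum_distrib_right) (simp add: power2_eq_square mult_ac)
  finally show ?thesis .
qed

lemma torus_inner_laplacian_hartley:
  fixes f :: "real^'d \<Rightarrow> 'b::euclidean_space"
  assumes f: "f \<in> sobolev n" "n \<ge> 2" and k: "k \<in> lattice"
  shows "torus_inner (laplacian f) (laplacian (\<lambda>x. hartley k x *\<^sub>R v)) = norm k ^ 4 * (hcoef k f \<bullet> v)"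
proof -
  let ?\<psi> = "\<lambda>x. hartley k x *\<^sub>R v"
  let ?D = "\<lambda>i. [axis i 1, axis i 1 :: real^'d]"
  have wf: "weak_deriv (?D i) f (wderiv (?D i) f)" for i
    using f by (intro sobolev_wderiv) auto
  have w\<psi>: "weak_deriv (?D i) ?\<psi> (\<lambda>x. hartley k x *\<^sub>R (- (k \<bullet> axis i 1)\<^sup>2 *\<^sub>R v))" for i
    using weak_deriv_hartley[OF k, of "?D i" v] by (simp add: power2_eq_square)
  have meas: "wderiv (?D i) ?\<psi> \<in> borel_measurable torus" for i
    by (intro borel_measurable_integrable weak_deriv_integrable(2)[OF weak_deriv_wderiv[OF w\<psi>]])
  have "AE x in torus. \<forall>i\<in>UNIV. wderiv (?D i) ?\<psi> x = hartley k x *\<^sub>R (- (k \<bullet> axis i 1)\<^sup>2 *\<^sub>R v)"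
    by (intro AE_finite_allI wderiv_unique[OF w\<psi>]) auto
  then have AE: "AE x in torus. laplacian ?\<psi> x = hartley k x *\<^sub>R (- (norm k)\<^sup>2 *\<^sub>R v)"
    by eventually_elim
      (simp add: laplacian_def norm_square_axes[of k] scaleR_sum_left scaleR_sum_right sum_negf)
  have c: "hcoef k (wderiv (?D i) f) = - (k \<bullet> axis i 1)\<^sup>2 *\<^sub>R hcoef k f" for i
    using hcoef_weak_deriv[OF wf k] by (simp add: power2_eq_square)
  have If: "integrable torus (wderiv (?D i) f)" for i by (rule weak_deriv_integrable(2)[OF wf])
  have "integrable torus (laplacian f)"
    unfolding laplacian_def[abs_def] by (intro Bochner_Integration.integrable_sum If)
  moreover have "laplacian ?\<psi> \<in> borel_measurable torus"
    unfolding laplacian_def[abs_def] by (intro borel_measurable_sum meas)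
  ultimately have "torus_inner (laplacian f) (laplacian ?\<psi>) = hcoef k (laplacian f) \<bullet> (- (norm k)\<^sup>2 *\<^sub>R v)"
    unfolding torus_inner_def by (rule inner_hartley_AE(2)[OF _ _ AE])
  also have "hcoef k (laplacian f) = (\<Sum>i\<in>UNIV. hcoef k (wderiv (?D i) f))"
    unfolding hcoef_def laplacian_def scaleR_sum_right
    by (intro Bochner_Integration.integral_sum hcoef_integrable If)
  also have "\<dots> = - (norm k)\<^sup>2 *\<^sub>R hcoef k f"
    by (simp add: c norm_square_axes[of k] scaleR_sum_left sum_negf)
  finally show ?thesis by (simp add: power_mult[symmetric] flip: power_add)
qed

section \<open>A smooth transition function\<close>

text \<open>Differentiability of order \<open>n\<close> in one variable, with an unnamed derivative
  at each level, so that closure under the usual operations is a plain induction;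
  \<open>smooth_real\<close> leads back to \<open>smooth\<close>.\<close>

fun times_diff :: "nat \<Rightarrow> (real \<Rightarrow> real) \<Rightarrow> bool" where
  "times_diff 0 f = True"
| "times_diff (Suc n) f = (\<exists>f'. (\<forall>x. (f has_real_derivative f' x) (at x)) \<and> times_diff n f')"

lemma times_diffI:
  "(\<And>x. (f has_real_derivative f' x) (at x)) \<Longrightarrow> times_diff n f' \<Longrightarrow> times_diff (Suc n) f"
  by auto

lemma times_diff_Suc: "times_diff (Suc n) f \<Longrightarrow> times_diff n f"
proof (induction n arbitrary: f)
  case (Suc n)
  then obtain f' where "\<And>x. (f has_real_derivative f' x) (at x)" "times_diff (Suc n) f'"
    using times_diff.simps(2)[of "Suc n" f] by blast
  then show ?case using Suc.IH by (intro times_diffI)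
qed simp

lemma times_diff_add: "times_diff n f \<Longrightarrow> times_diff n g \<Longrightarrow> times_diff n (\<lambda>x. f x + g x)"
proof (induction n arbitrary: f g)
  case (Suc n)
  then obtain f' g' where "\<And>x. (f has_real_derivative f' x) (at x)" "times_diff n f'"
    "\<And>x. (g has_real_derivative g' x) (at x)" "times_diff n g'" by auto
  then show ?case
    by (intro times_diffI[where f' = "\<lambda>x. f' x + g' x"] Suc.IH) (auto intro!: derivative_eq_intros)
qed simp

lemma times_diff_mult: "times_diff n f \<Longrightarrow> times_diff n g \<Longrightarrow> times_diff n (\<lambda>x. f x * g x)"
proof (induction n arbitrary: f g)
  case (Suc n)
  then obtain f' g' where *: "\<And>x. (f has_real_derivative f' x) (at x)" "times_diff n f'"
    "\<And>x. (g has_real_derivative g' x) (at x)" "times_diff n g'" by auto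
  have "times_diff n (\<lambda>x. f' x * g x + f x * g' x)"
    using * Suc.prems[THEN times_diff_Suc] by (intro times_diff_add Suc.IH) auto
  then show ?case
    using * by (intro times_diffI[where f' = "\<lambda>x. f' x * g x + f x * g' x"])
      (auto intro!: derivative_eq_intros)
qed simp

lemma times_diff_const: "times_diff n (\<lambda>x. c)"
proof (induction n arbitrary: c)
  case (Suc n)
  then show ?case by (intro times_diffI[where f' = "\<lambda>x. 0"]) auto
qed simp

lemma times_diff_inverse: "times_diff n f \<Longrightarrow> (\<And>x. f x \<noteq> 0) \<Longrightarrow> times_diff n (\<lambda>x. inverse (f x))"
proof (induction n arbitrary: f)
  case (Suc n)
  then obtain f' where *: "\<And>x. (f has_real_derivative f' x) (at x)" "times_diff n f'" by auto
  have "times_diff n (\<lambda>x. (- 1) * f' x * (inverse (f x) * inverse (f x)))"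
    using * Suc.prems(2) Suc.prems(1)[THEN times_diff_Suc] by (intro times_diff_mult Suc.IH times_diff_const) auto
  then show ?case
    using * Suc.prems by (intro times_diffI[where f' = "\<lambda>x. (- 1) * f' x * (inverse (f x) * inverse (f x))"])
      (auto intro!: derivative_eq_intros simp: field_simps)
qed simp

lemma times_diff_affine: "times_diff n f \<Longrightarrow> times_diff n (\<lambda>x. f (c * x + d))"
proof (induction n arbitrary: f)
  case (Suc n)
  then obtain f' where *: "\<And>x. (f has_real_derivative f' x) (at x)" "times_diff n f'" by auto
  have "((\<lambda>x. f (c * x + d)) has_real_derivative f' (c * x + d) * c) (at x)" for x
  proof -
    have "((\<lambda>x. c * x + d) has_real_derivative c) (at x)"
      by (auto intro!: derivative_eq_intros)
    from DERIV_chain2[OF *(1) this] show ?thesis .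
  qed
  moreover have "times_diff n (\<lambda>x. f' (c * x + d) * c)"
    by (rule times_diff_mult[OF Suc.IH[OF *(2)] times_diff_const])
  ultimately show ?case by (rule times_diffI)
qed simp

text \<open>The only direction in \<open>Basis\<close> is 1, so the iterated partial derivatives are
  iterated ordinary derivatives.\<close>

lemma smooth_real: "(\<And>n. times_diff n f) \<Longrightarrow> smooth f"
proof -
  assume f: "\<And>n. times_diff n f"
  have "times_diff n (partial_derivs bs f)" if "bs \<in> lists Basis" for n bs
    using that
  proof (induction arbitrary: n)
    case (Cons b bs)
    obtain f' where f': "\<And>x. (partial_derivs bs f has_real_derivative f' x) (at x)" "times_diff n f'"
      using Cons.IH[of "Suc n"] by auto
    have "frechet_derivative (partial_derivs bs f) (at x) = (*) (f' x)" for x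
      using frechet_derivative_at[OF f'(1)[unfolded has_field_derivative_def]] by simp
    then have "partial_deriv b (partial_derivs bs f) = f'"
      using Cons.hyps by (simp add: partial_deriv_def)
    with f' show ?case by simp
  qed (simp add: f)
  note diff = this
  show "smooth f"
    unfolding smooth_def
  proof (intro ballI allI)
    fix bs :: "real list" and x :: real
    assume "bs \<in> lists Basis"
    from diff[OF this, of "Suc 0"] obtain f' where "(partial_derivs bs f has_real_derivative f' x) (at x)"
      by auto
    then show "partial_derivs bs f differentiable (at x)"
      unfolding has_field_derivative_def by (rule differentiableI)
  qed
qed

text \<open>All powers of \<open>1 / x\<close> are included because the family is then closed under
  differentiation: the derivative of member \<open>k\<close> combines the members
  \<open>k + 1\<close> and \<open>k + 2\<close>.\<close>

definition flat_exp :: "nat \<Rightarrow> real \<Rightarrow> real" where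
  "flat_exp k x = (if x > 0 then (1 / x) ^ k * exp (- (1 / x)) else 0)"

lemma flat_exp_tendsto_0: "((\<lambda>x. flat_exp k x) \<longlongrightarrow> 0) (at 0)"
proof -
  have "((\<lambda>y::real. y ^ k / exp y) \<longlongrightarrow> 0) at_top"
    by (rule tendsto_power_div_exp_0)
  then have "((\<lambda>x::real. (inverse x) ^ k / exp (inverse x)) \<longlongrightarrow> 0) (at_right 0)"
    by (rule filterlim_compose) (rule filterlim_inverse_at_top_right)
  moreover have "eventually (\<lambda>x. (inverse x) ^ k / exp (inverse x) = flat_exp k x) (at_right 0)"
    using eventually_at_right_less[of 0]
    by eventually_elim (simp add: flat_exp_def divide_inverse exp_minus)
  ultimately have "(flat_exp k \<longlongrightarrow> 0) (at_right 0)"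
    by (rule Lim_transform_eventually)
  moreover have "(flat_exp k \<longlongrightarrow> 0) (at_left 0)"
    by (rule Lim_transform_eventually[OF tendsto_const])
      (auto simp: flat_exp_def eventually_at_filter)
  ultimately show ?thesis by (simp add: filterlim_at_split)
qed

lemma flat_exp_derivative:
  "(flat_exp k has_real_derivative (- real k) * flat_exp (Suc k) x + flat_exp (Suc (Suc k)) x) (at x)"
proof -
  consider "x > 0" | "x < 0" | "x = 0" by linarith
  then show ?thesis
  proof cases
    case 1
    have "((\<lambda>y. y ^ k * exp (- y)) has_real_derivative
        (real k * y ^ (k - 1) * exp (- y) - y ^ k * exp (- y))) (at y)" for y :: real
      by (auto intro!: derivative_eq_intros)
    from DERIV_chain2[OF this DERIV_inverse[of x]]
    have "((\<lambda>x. (inverse x) ^ k * exp (- inverse x)) has_real_derivative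
        (- real k) * flat_exp (Suc k) x + flat_exp (Suc (Suc k)) x) (at x)"
    proof (rule DERIV_cong)
      define y where "y = inverse x"
      have "flat_exp j x = y ^ j * exp (- y)" for j
        using 1 by (simp add: flat_exp_def y_def divide_inverse)
      then show "(real k * inverse x ^ (k - 1) * exp (- inverse x) - inverse x ^ k * exp (- inverse x)) *
          - (inverse x ^ Suc (Suc 0)) = (- real k) * flat_exp (Suc k) x + flat_exp (Suc (Suc k)) x"
        unfolding y_def[symmetric] by (cases k) (simp_all add: algebra_simps)
    qed (use 1 in simp)
    then show ?thesis
      by (rule has_field_derivative_transform_within[where S = UNIV and d = x])
        (use 1 in \<open>auto simp: flat_exp_def dist_real_def divide_inverse\<close>)
  next
    case 2
    have "((\<lambda>x. 0) has_real_derivative 0) (at x)" by simp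
    then have "(flat_exp k has_real_derivative 0) (at x)"
      by (rule has_field_derivative_transform_within[where S = UNIV and d = "- x"])
        (use 2 in \<open>auto simp: flat_exp_def dist_real_def\<close>)
    then show ?thesis using 2 by (simp add: flat_exp_def)
  next
    case 3
    \<comment> \<open>The difference quotient at 0 is the next member of the family, whose limit is
      already known.\<close>
    have "((\<lambda>h. (flat_exp k (0 + h) - flat_exp k 0) / h) \<longlongrightarrow> 0) (at 0)"
      by (rule Lim_transform_eventually[OF flat_exp_tendsto_0[of "Suc k"]])
        (auto simp: flat_exp_def eventually_at_filter)
    then show ?thesis using 3 by (simp add: DERIV_def flat_exp_def)
  qed
qed

lemma times_diff_flat_exp: "times_diff n (flat_exp k)"
proof (induction n arbitrary: k)
  case (Suc n)
  show ?case
    by (rule times_diffI[OF flat_exp_derivative])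
      (intro times_diff_add times_diff_mult times_diff_const Suc.IH)
qed simp

text \<open>The quotient e(x) / (e(x) + e(1 - x)) with e(x) = exp (-1/x) for positive x and 0
  otherwise. The derivative \<open>s\<close> is supplied as well, because rescaled copies of it act
  as mollifiers.\<close>

lemma smooth_transition:
  obtains S s :: "real \<Rightarrow> real" where "\<And>n. times_diff n S"
    "\<And>x. (S has_real_derivative s x) (at x)" "continuous_on UNIV s"
    "\<And>x. x \<le> 0 \<Longrightarrow> S x = 0" "\<And>x. x \<ge> 1 \<Longrightarrow> S x = 1" "\<And>x. 0 \<le> S x" "\<And>x. S x \<le> 1"
    "\<And>x. x \<notin> {0..1} \<Longrightarrow> s x = 0"
proof -
  define e where "e = flat_exp 0"
  \<comment> \<open>The argument is written \<open>(- 1) * x + 1\<close> to match the form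
    \<open>c * x + d\<close> of \<open>times_diff_affine\<close>.\<close>
  define S where "S x = e x * inverse (e x + e ((- 1) * x + 1))" for x
  have e0: "e x \<ge> 0" for x by (simp add: e_def flat_exp_def)
  have e_pos: "e x > 0 \<longleftrightarrow> x > 0" and e_zero: "x \<le> 0 \<Longrightarrow> e x = 0" for x
    by (auto simp: e_def flat_exp_def)
  have pos: "e x + e ((- 1) * x + 1) > 0" for x
  proof (cases "x > 0")
    case True
    then show ?thesis using e_pos[of x] e0[of "(- 1) * x + 1"] by linarith
  next
    case False
    then show ?thesis using e_pos[of "(- 1) * x + 1"] e0[of x] by linarith
  qed
  have "times_diff n S" for n
    unfolding S_def[abs_def] using pos
    by (intro times_diff_mult times_diff_inverse times_diff_add times_diff_affine)
      (auto simp: e_def times_diff_flat_exp less_imp_neq[THEN not_sym])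
  note S_diff = this
  obtain s where s: "\<And>x. (S has_real_derivative s x) (at x)" "times_diff 1 s"
    using S_diff[of "Suc 1"] by auto
  have "isCont s x" for x
    using s(2) by (auto intro: DERIV_isCont)
  then have cont: "continuous_on UNIV s"
    by (simp add: continuous_at_imp_continuous_on)
  have S0: "S x = 0" if "x \<le> 0" for x using that e_zero by (simp add: S_def)
  have S1: "S x = 1" if "x \<ge> 1" for x
    using that e_pos[of x] e_zero[of "(- 1) * x + 1"] by (simp add: S_def)
  have s0: "s x = 0" if "x \<notin> {0..1}" for x
  proof -
    consider "x < 0" | "x > 1" using \<open>x \<notin> {0..1}\<close> by auto
    then show ?thesis
    proof cases
      case 1
      have "(S has_real_derivative 0) (at x)"
        by (rule has_field_derivative_transform_within[where S = UNIV, OF DERIV_const[of 0], where d = "- x"])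
          (use 1 in \<open>auto simp: S0 dist_real_def\<close>)
      then show ?thesis using s(1) DERIV_unique by blast
    next
      case 2
      have "(S has_real_derivative 0) (at x)"
        by (rule has_field_derivative_transform_within[where S = UNIV, OF DERIV_const[of 1], where d = "x - 1"])
          (use 2 in \<open>auto simp: S1 dist_real_def\<close>)
      then show ?thesis using s(1) DERIV_unique by blast
    qed
  qed
  have S01: "0 \<le> S x" "S x \<le> 1" for x
    using e0[of x] e0[of "(- 1) * x + 1"] pos[of x] by (simp_all add: S_def divide_inverse[symmetric])
  show ?thesis
    by (rule that[of S s, OF S_diff s(1) cont S0 S1 S01 s0])
qed

section \<open>Distributional time derivatives\<close>

lemma LINT_lebesgue_on_subset:
  fixes f :: "real \<Rightarrow> real"
  assumes "A \<in> sets lebesgue" "B \<in> sets lebesgue" "A \<subseteq> B" "\<And>t. t \<in> B - A \<Longrightarrow> f t = 0"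
  shows "(LINT t|lebesgue_on B. f t) = (LINT t|lebesgue_on A. f t)"
proof -
  have "(LINT t|lebesgue. indicator B t *\<^sub>R f t) = (LINT t|lebesgue. indicator A t *\<^sub>R f t)"
    using assms(3,4) by (intro Bochner_Integration.integral_cong) (auto simp: indicator_def)
  then show ?thesis
    using assms(1,2) by (simp add: integral_restrict_space)
qed

lemma AE_lebesgue_on_subset:
  assumes "AE t in lebesgue_on B. Q t" "A \<subseteq> B" "A \<in> sets lebesgue" "B \<in> sets lebesgue"
  shows "AE t in lebesgue_on A. Q t"
proof -
  have "AE t in lebesgue. t \<in> B \<longrightarrow> Q t"
    using assms(1,4) by (simp add: AE_restrict_space_iff)
  then have "AE t in lebesgue. t \<in> A \<longrightarrow> Q t"
    by (rule eventually_mono) (use assms(2) in auto)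
  then show ?thesis
    using assms(3) by (simp add: AE_restrict_space_iff)
qed

lemma AE_lebesgue_onI: "AE t in lebesgue. Q t \<Longrightarrow> A \<in> sets lebesgue \<Longrightarrow> AE t in lebesgue_on A. Q t"
  by (simp add: AE_restrict_space_iff) (erule eventually_mono, simp)

text \<open>The test functions are smoothed indicators of \<open>{a..b}\<close>. Their derivatives
  concentrate at the two ends and produce \<open>G a - G b\<close>, while on the side of
  \<open>h\<close> dominated convergence restores the indicator.\<close>

lemma weak_time_deriv_increment:
  assumes w: "weak_time_deriv T g h" and G: "continuous_on {0<..<T} G"
    and AE: "AE t in lebesgue_on {0<..<T}. g t = G t" and ab: "0 < a" "a \<le> b" "b < T"
  shows "integrable (lebesgue_on {a..b}) h" "G b - G a = (LINT t|lebesgue_on {a..b}. h t)"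
proof -
  have int: "integrable (lebesgue_on {p..q}) h" if "0 < p" "q < T" for p q
  proof -
    have "compact {p..q} \<and> {p..q} \<subseteq> {0<..<T}" using that by auto
    then have "set_integrable lebesgue {p..q} h"
      using w unfolding weak_time_deriv_def by blast
    then show ?thesis by (simp add: set_integrable_def integrable_restrict_space)
  qed
  show "integrable (lebesgue_on {a..b}) h" using int ab by auto
  obtain S s :: "real \<Rightarrow> real" where S_diff: "\<And>n. times_diff n S"
    and s: "\<And>x. (S has_real_derivative s x) (at x)" "continuous_on UNIV s"
    and S0: "\<And>x. x \<le> 0 \<Longrightarrow> S x = 0" and S1: "\<And>x. x \<ge> 1 \<Longrightarrow> S x = 1"
    and S01: "\<And>x. 0 \<le> S x" "\<And>x. S x \<le> 1" and s0: "\<And>x. x \<notin> {0..1} \<Longrightarrow> s x = 0"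
    using smooth_transition by blast
  have "compact (s ` {0..1})"
    using s(2) by (intro compact_continuous_image) (auto intro: continuous_on_subset)
  then obtain M where M: "M > 0" "\<And>x. x \<in> {0..1} \<Longrightarrow> \<bar>s x\<bar> \<le> M"
    using bounded_pos[of "s ` {0..1}"] compact_imp_bounded by auto
  \<comment> \<open>The transitions lie to the right of \<open>a\<close> and of \<open>b\<close>;
    \<open>\<delta>\<close> is the room they may take without reaching \<open>T\<close>.\<close>
  define \<delta> where "\<delta> = (T - b) / 2"
  have \<delta>: "\<delta> > 0" "b + \<delta> < T" using ab by (auto simp: \<delta>_def field_simps)
  define \<epsilon> where "\<epsilon> n = \<delta> / real (Suc n)" for n
  have \<epsilon>: "0 < \<epsilon> n" "\<epsilon> n \<le> \<delta>" for n using \<delta> by (auto simp: \<epsilon>_def field_simps)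
  have \<epsilon>0: "\<epsilon> \<longlonglongrightarrow> 0"
    unfolding \<epsilon>_def using tendsto_mult_right_zero[OF LIMSEQ_inverse_real_of_nat, of \<delta>]
    by (simp add: divide_inverse)
  \<comment> \<open>The derivative of a smoothed step at \<open>c\<close>: it vanishes outside
    \<open>{c..c + \<epsilon> n}\<close> and has integral 1.\<close>
  define \<sigma> where "\<sigma> n c t = s ((t - c) / \<epsilon> n) / \<epsilon> n" for n c t
  have S_aff: "((\<lambda>t. S ((t - c) / \<epsilon> n)) has_real_derivative \<sigma> n c t) (at t)" for c n t
  proof -
    have "((\<lambda>t. (t - c) / \<epsilon> n) has_real_derivative 1 / \<epsilon> n) (at t)"
      using \<epsilon>(1)[of n] by (auto intro!: derivative_eq_intros)
    from DERIV_chain2[OF s(1) this] show ?thesis by (simp add: \<sigma>_def)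
  qed
  have \<sigma>_cont: "continuous_on A (\<sigma> n c)" for A n c
    unfolding \<sigma>_def[abs_def]
    by (intro continuous_intros continuous_on_compose2[OF s(2)]) (use \<epsilon>(1)[of n] in auto)
  have \<sigma>_bound: "\<bar>\<sigma> n c t\<bar> \<le> M / \<epsilon> n" for n c t
    using M s0[of "(t - c) / \<epsilon> n"] \<epsilon>(1)[of n]
    by (cases "(t - c) / \<epsilon> n \<in> {0..1}") (auto simp: \<sigma>_def intro!: divide_right_mono)
  define J where "J n c = (LINT t|lebesgue_on {0<..<T}. g t * \<sigma> n c t)" for n c
  have supp: "\<sigma> n c t = 0" if "t \<notin> {c..c + \<epsilon> n}" for t c n
    using that \<epsilon>(1)[of n] s0[of "(t - c) / \<epsilon> n"] by (auto simp: \<sigma>_def field_simps)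
  have contGs: "continuous_on {c..c + \<epsilon> n} (\<lambda>t. G t * \<sigma> n c t)" if c: "c \<in> {a..b}" for n c
    using \<epsilon>[of n] \<delta> c ab by (intro continuous_on_mult \<sigma>_cont continuous_on_subset[OF G]) auto
  have J: "integrable (lebesgue_on {0<..<T}) (\<lambda>t. g t * \<sigma> n c t) \<and>
      J n c = integral {c..c + \<epsilon> n} (\<lambda>t. G t * \<sigma> n c t)"
    if c: "c \<in> {a..b}" for n c
  proof -
    have sub: "{c..c + \<epsilon> n} \<subseteq> {0<..<T}" using \<epsilon>[of n] \<delta> c ab by auto
    have g: "integrable (lebesgue_on {c..c + \<epsilon> n}) g"
    proof -
      have "set_integrable lebesgue {c..c + \<epsilon> n} g"
        using w sub unfolding weak_time_deriv_def by blast
      then show ?thesis by (simp add: set_integrable_def integrable_restrict_space)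
    qed
    have AE': "AE t in lebesgue_on {c..c + \<epsilon> n}. G t * \<sigma> n c t = g t * \<sigma> n c t"
      by (rule eventually_mono[OF AE_lebesgue_on_subset[OF AE sub]]) auto
    have I: "integrable (lebesgue_on {c..c + \<epsilon> n}) (\<lambda>t. G t * \<sigma> n c t)"
      by (rule continuous_imp_integrable_real[OF contGs[OF c]])
    have sm: "\<sigma> n c \<in> borel_measurable (lebesgue_on {c..c + \<epsilon> n})"
      by (intro continuous_imp_measurable_on_sets_lebesgue \<sigma>_cont) simp
    have m: "(\<lambda>t. g t * \<sigma> n c t) \<in> borel_measurable (lebesgue_on {c..c + \<epsilon> n})"
      by (rule borel_measurable_times[OF borel_measurable_integrable[OF g] sm])
    have Ig: "integrable (lebesgue_on {c..c + \<epsilon> n}) (\<lambda>t. g t * \<sigma> n c t)"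
      by (rule integrable_cong_AE_imp[OF I m AE'])
    have "J n c = (LINT t|lebesgue_on {c..c + \<epsilon> n}. g t * \<sigma> n c t)"
      unfolding J_def using sub by (intro LINT_lebesgue_on_subset) (auto simp: supp)
    also have "\<dots> = (LINT t|lebesgue_on {c..c + \<epsilon> n}. G t * \<sigma> n c t)"
      by (rule integral_cong_AE[OF borel_measurable_integrable[OF I] m AE', symmetric])
    also have "\<dots> = integral {c..c + \<epsilon> n} (\<lambda>t. G t * \<sigma> n c t)"
      using I by (intro lebesgue_integral_eq_integral) auto
    finally have "J n c = integral {c..c + \<epsilon> n} (\<lambda>t. G t * \<sigma> n c t)" .
    moreover have "integrable (lebesgue_on {0<..<T}) (\<lambda>t. g t * \<sigma> n c t)"
    proof -
      have eq: "indicator {c..c + \<epsilon> n} t *\<^sub>R (g t * \<sigma> n c t) = indicator {0<..<T} t *\<^sub>R (g t * \<sigma> n c t)" for t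
        using sub supp[of t c n] by (cases "t \<in> {c..c + \<epsilon> n}") (auto simp: subset_iff)
      have "integrable lebesgue (\<lambda>t. indicator {c..c + \<epsilon> n} t *\<^sub>R (g t * \<sigma> n c t))"
        using Ig by (simp add: integrable_restrict_space)
      then show ?thesis unfolding eq by (simp add: integrable_restrict_space)
    qed
    ultimately show ?thesis by simp
  qed
  have J_lim: "(\<lambda>n. J n c) \<longlonglongrightarrow> G c" if c: "c \<in> {a..b}" for c
  proof (rule LIMSEQ_I)
    fix r :: real assume "r > 0"
    have "isCont G c"
      using G c ab by (intro continuous_on_interior[of "{0<..<T}"]) auto
    \<comment> \<open>In place of a sign of \<open>\<sigma>\<close>, the bound
      \<open>M / \<epsilon> n\<close> on an interval of length \<open>\<epsilon> n\<close> is used;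
      this is why the deviation of \<open>G\<close> is kept below
      \<open>r / (2 * M)\<close>.\<close>
    then obtain d where d: "d > 0" "\<And>t. \<bar>t - c\<bar> < d \<Longrightarrow> \<bar>G t - G c\<bar> < r / (2 * M)"
      using \<open>r > 0\<close> M(1) unfolding continuous_at_eps_delta dist_real_def
      by (metis divide_pos_pos mult_pos_pos zero_less_numeral)
    obtain N where N: "\<And>n. n \<ge> N \<Longrightarrow> \<epsilon> n < d"
      using order_tendstoD(2)[OF \<epsilon>0 d(1)] by (auto simp: eventually_sequentially)
    have "norm (J n c - G c) < r" if "n \<ge> N" for n
    proof -
      have "((\<lambda>t. \<sigma> n c t) has_integral (S ((c + \<epsilon> n - c) / \<epsilon> n) - S ((c - c) / \<epsilon> n))) {c..c + \<epsilon> n}"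
        using \<epsilon>(1)[of n] S_aff
        by (intro fundamental_theorem_of_calculus)
          (auto simp: has_real_derivative_iff_has_vector_derivative[symmetric] intro: DERIV_subset)
      then have one: "((\<lambda>t. \<sigma> n c t) has_integral 1) {c..c + \<epsilon> n}"
        using \<epsilon>(1)[of n] S0[of 0] S1[of 1] by simp
      have "((\<lambda>t. G t * \<sigma> n c t) has_integral J n c) {c..c + \<epsilon> n}"
        unfolding conjunct2[OF J[OF c]] by (intro integrable_integral integrable_continuous_real contGs c)
      from has_integral_diff[OF this has_integral_mult_right[OF one, of "G c"]]
      have "((\<lambda>t. (G t - G c) * \<sigma> n c t) has_integral (J n c - G c)) (cbox c (c + \<epsilon> n))"
        by (simp only: left_diff_distrib cbox_interval mult_1_right)
      then have "norm (J n c - G c) \<le> (r / (2 * \<epsilon> n)) * measure lborel (cbox c (c + \<epsilon> n))"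
      proof (rule has_integral_bound[rotated])
        fix t assume "t \<in> cbox c (c + \<epsilon> n)"
        then have "\<bar>G t - G c\<bar> \<le> r / (2 * M)" using d(2)[of t] N[OF that] by auto
        then have "\<bar>G t - G c\<bar> * \<bar>\<sigma> n c t\<bar> \<le> r / (2 * M) * (M / \<epsilon> n)"
          using \<open>r > 0\<close> M(1) by (intro mult_mono \<sigma>_bound) auto
        then show "norm ((G t - G c) * \<sigma> n c t) \<le> r / (2 * \<epsilon> n)"
          using M(1) by (simp add: abs_mult)
      qed (use \<open>r > 0\<close> \<epsilon>(1)[of n] in auto)
      also have "\<dots> = r / 2" using \<epsilon>(1)[of n] by simp
      also have "\<dots> < r" using \<open>r > 0\<close> by simp
      finally show ?thesis .
    qed
    then show "\<exists>N. \<forall>n\<ge>N. norm (J n c - G c) < r" by blast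
  qed
  \<comment> \<open>A smoothed indicator of \<open>{a..b}\<close>. Writing the difference as a sum
    with factor -1 lets \<open>times_diff_add\<close> and \<open>times_diff_mult\<close>
    apply.\<close>
  define \<eta> where "\<eta> n t = S ((t - a) / \<epsilon> n) + (- 1) * S ((t - b) / \<epsilon> n)" for n t
  have \<eta>_supp: "\<eta> n t = 0" if "t \<notin> {a..b + \<epsilon> n}" for n t
  proof -
    have "t < a \<or> t > b + \<epsilon> n" using that by auto
    then show ?thesis
    proof
      assume "t < a"
      then have "(t - a) / \<epsilon> n \<le> 0" "(t - b) / \<epsilon> n \<le> 0"
        using \<epsilon>(1)[of n] ab by (auto simp: divide_le_0_iff)
      then show ?thesis by (simp add: \<eta>_def S0)
    next
      assume "t > b + \<epsilon> n"
      then have "(t - a) / \<epsilon> n \<ge> 1" "(t - b) / \<epsilon> n \<ge> 1"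
        using \<epsilon>(1)[of n] ab by auto
      then show ?thesis by (simp add: \<eta>_def S1)
    qed
  qed
  have identity: "J n a - J n b = - (LINT t|lebesgue_on {0<..<T}. h t * \<eta> n t)" for n
  proof -
    have aff: "(\<lambda>t. S ((t - c) / \<epsilon> n)) = (\<lambda>t. S ((1 / \<epsilon> n) * t + (- c / \<epsilon> n)))" for c
      by (simp add: diff_divide_distrib)
    have "times_diff m (\<eta> n)" for m
      unfolding \<eta>_def[abs_def]
      by (intro times_diff_add times_diff_mult times_diff_const) (simp_all only: aff times_diff_affine S_diff)
    then have "smooth (\<eta> n)" by (rule smooth_real)
    moreover have "closure {t. \<eta> n t \<noteq> 0} \<subseteq> {a..b + \<epsilon> n}"
    proof (rule closure_minimal)
      show "{t. \<eta> n t \<noteq> 0} \<subseteq> {a..b + \<epsilon> n}" using \<eta>_supp[of _ n] by blast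
    qed simp
    then have "closure {t. \<eta> n t \<noteq> 0} \<subseteq> {0<..<T}" using ab \<epsilon>(2)[of n] \<delta> by (auto dest: subsetD)
    moreover have "deriv (\<eta> n) t = \<sigma> n a t - \<sigma> n b t" for t
      unfolding \<eta>_def[abs_def] using DERIV_diff[OF S_aff[of a n t] S_aff[of b n t]]
      by (intro DERIV_imp_deriv) simp
    ultimately have "(LINT t|lebesgue_on {0<..<T}. g t * (\<sigma> n a t - \<sigma> n b t))
        = - (LINT t|lebesgue_on {0<..<T}. h t * \<eta> n t)"
      using w unfolding weak_time_deriv_def by auto
    then show ?thesis
      using J[of a n] J[of b n] ab by (simp add: right_diff_distrib J_def)
  qed
  have "(\<lambda>n. LINT t|lebesgue_on {a..b + \<delta>}. h t * \<eta> n t) \<longlonglongrightarrow> (LINT t|lebesgue_on {a..b + \<delta>}. h t * indicator {a..b} t)"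
  proof (rule integral_dominated_convergence[where w = "\<lambda>t. \<bar>h t\<bar>"])
    have I: "integrable (lebesgue_on {a..b + \<delta>}) h" using ab \<delta> by (intro int) auto
    then show "integrable (lebesgue_on {a..b + \<delta>}) (\<lambda>t. \<bar>h t\<bar>)" by simp
    have hm: "h \<in> borel_measurable (lebesgue_on {a..b + \<delta>})" using I by auto
    have "continuous_on UNIV S" using DERIV_isCont[OF s(1)] by (simp add: continuous_at_imp_continuous_on)
    then have "continuous_on {a..b + \<delta>} (\<lambda>t. S ((t - c) / \<epsilon> n))" for c n
      by (rule continuous_on_compose2) (use \<epsilon>(1)[of n] in \<open>auto intro!: continuous_intros\<close>)
    then have "continuous_on {a..b + \<delta>} (\<eta> n)" for n
      unfolding \<eta>_def[abs_def] by (intro continuous_on_add continuous_on_mult continuous_on_const)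
    then have "\<eta> n \<in> borel_measurable (lebesgue_on {a..b + \<delta>})" for n
      by (intro continuous_imp_measurable_on_sets_lebesgue) auto
    with hm show "(\<lambda>t. h t * \<eta> n t) \<in> borel_measurable (lebesgue_on {a..b + \<delta>})" for n
      by (rule borel_measurable_times)
    have "(\<lambda>t. indicator {a..b} t :: real) \<in> borel_measurable (lebesgue_on {a..b + \<delta>})"
      by (intro measurable_restrict_space1 borel_measurable_indicator) auto
    with hm show "(\<lambda>t. h t * indicator {a..b} t) \<in> borel_measurable (lebesgue_on {a..b + \<delta>})"
      by (rule borel_measurable_times)
    show "AE t in lebesgue_on {a..b + \<delta>}. norm (h t * \<eta> n t) \<le> \<bar>h t\<bar>" for n
    proof (rule AE_I2)
      fix t
      have "\<bar>\<eta> n t\<bar> \<le> 1" using S01[of "(t - a) / \<epsilon> n"] S01[of "(t - b) / \<epsilon> n"] by (simp add: \<eta>_def)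
      then show "norm (h t * \<eta> n t) \<le> \<bar>h t\<bar>" by (simp add: abs_mult mult_left_le)
    qed
    \<comment> \<open>At \<open>t = a\<close> all cutoffs are 0 while the indicator is 1, so this
      one point is discarded.\<close>
    have "AE t in lebesgue. t \<notin> {a}"
      by (rule AE_not_in) (simp add: negligible_iff_null_sets[symmetric])
    then have "AE t in lebesgue_on {a..b + \<delta>}. t \<notin> {a}"
      by (rule AE_lebesgue_onI) simp
    then show "AE t in lebesgue_on {a..b + \<delta>}. (\<lambda>n. h t * \<eta> n t) \<longlonglongrightarrow> h t * indicator {a..b} t"
    proof (rule eventually_mono)
      fix t assume "t \<notin> {a}"
      then have "t \<noteq> a" by simp
      have Slim: "(\<lambda>n. S ((t - c) / \<epsilon> n)) \<longlonglongrightarrow> (if t > c then 1 else 0)" for c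
      proof (cases "t > c")
        case True
        then have "eventually (\<lambda>n. \<epsilon> n < t - c) sequentially" using order_tendstoD(2)[OF \<epsilon>0, of "t - c"] by simp
        then have "eventually (\<lambda>n. S ((t - c) / \<epsilon> n) = 1) sequentially"
          by eventually_elim (use \<epsilon>(1) in \<open>auto intro!: S1\<close>)
        then show ?thesis using True by (simp add: tendsto_eventually)
      next
        case False
        then have "S ((t - c) / \<epsilon> n) = 0" for n using \<epsilon>(1)[of n] by (intro S0) (auto simp: divide_le_0_iff)
        then show ?thesis using False by simp
      qed
      have "(\<lambda>n. \<eta> n t) \<longlonglongrightarrow> (if t > a then 1 else 0) + (- 1) * (if t > b then 1 else 0)"
        unfolding \<eta>_def by (intro tendsto_intros Slim)
      also have "(if t > a then 1 else 0) + (- 1) * (if t > b then 1 else 0) = (indicator {a..b} t :: real)"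
        using ab \<open>t \<noteq> a\<close> by (auto simp: indicator_def)
      finally show "(\<lambda>n. h t * \<eta> n t) \<longlonglongrightarrow> h t * indicator {a..b} t"
        by (intro tendsto_intros)
    qed
  qed
  moreover have "(LINT t|lebesgue_on {0<..<T}. h t * \<eta> n t) = (LINT t|lebesgue_on {a..b + \<delta>}. h t * \<eta> n t)" for n
    using ab \<delta> \<epsilon>(2)[of n] by (intro LINT_lebesgue_on_subset) (auto intro!: \<eta>_supp)
  moreover have "(LINT t|lebesgue_on {a..b + \<delta>}. h t * indicator {a..b} t) = (LINT t|lebesgue_on {a..b}. h t)"
  proof -
    have "(LINT t|lebesgue_on {a..b + \<delta>}. h t * indicator {a..b} t) = (LINT t|lebesgue_on {a..b}. h t * indicator {a..b} t)"
      using \<delta> by (intro LINT_lebesgue_on_subset) (auto simp: indicator_def)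
    also have "\<dots> = (LINT t|lebesgue_on {a..b}. h t)"
      by (intro Bochner_Integration.integral_cong) auto
    finally show ?thesis .
  qed
  ultimately have "(\<lambda>n. J n a - J n b) \<longlonglongrightarrow> - (LINT t|lebesgue_on {a..b}. h t)"
    unfolding identity by (auto intro!: tendsto_minus)
  moreover have "(\<lambda>n. J n a - J n b) \<longlonglongrightarrow> G a - G b"
    using ab by (intro tendsto_diff J_lim) auto
  ultimately have "- (LINT t|lebesgue_on {a..b}. h t) = G a - G b" by (rule LIMSEQ_unique)
  then show "G b - G a = (LINT t|lebesgue_on {a..b}. h t)" by linarith
qed

text \<open>The chain rule for the square of an absolutely continuous function, by bisection. On a
  short interval the increment of the square is \<open>G q + G p\<close> times the integral of
  \<open>h\<close>, and \<open>G q + G p\<close> differs from \<open>2 * G t\<close> by at most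
  \<open>e\<close>. The error, \<open>e\<close> times the integral of
  \<open>\<bar>h t\<bar>\<close>, is additive over adjacent intervals, so the local bound extends to
  \<open>{a..b}\<close>.\<close>

lemma integral_square_increment:
  fixes G h :: "real \<Rightarrow> real"
  assumes ab: "a \<le> b" and G: "continuous_on {a..b} G" and h: "integrable (lebesgue_on {a..b}) h"
    and incr: "\<And>p q. a \<le> p \<Longrightarrow> p \<le> q \<Longrightarrow> q \<le> b \<Longrightarrow> G q - G p = (LINT t|lebesgue_on {p..q}. h t)"
  shows "integrable (lebesgue_on {a..b}) (\<lambda>t. 2 * G t * h t)"
    "(G b)\<^sup>2 - (G a)\<^sup>2 = (LINT t|lebesgue_on {a..b}. 2 * G t * h t)"
proof -
  have sub: "integrable (lebesgue_on {p..q}) f" if "integrable (lebesgue_on {a..b}) f" "a \<le> p" "q \<le> b"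
    for f :: "real \<Rightarrow> real" and p q
  proof -
    have "set_integrable lebesgue {a..b} f"
      using that(1) by (simp add: set_integrable_def integrable_restrict_space)
    then have "set_integrable lebesgue {p..q} f"
      by (rule set_integrable_subset) (use that in auto)
    then show ?thesis by (simp add: set_integrable_def integrable_restrict_space)
  qed
  have mult: "integrable (lebesgue_on {a..b}) (\<lambda>t. F t * h t)" if F: "continuous_on {a..b} F" for F
  proof -
    have "bounded (F ` {a..b})"
      using F by (intro compact_imp_bounded compact_continuous_image) auto
    then obtain B where B: "\<And>t. t \<in> {a..b} \<Longrightarrow> \<bar>F t\<bar> \<le> B"
      by (metis bounded_iff imageI real_norm_def)
    have Fm: "F \<in> borel_measurable (lebesgue_on {a..b})"
      using F by (intro continuous_imp_measurable_on_sets_lebesgue) auto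
    show ?thesis
    proof (rule Bochner_Integration.integrable_bound)
      show "integrable (lebesgue_on {a..b}) (\<lambda>t. B * h t)" using h by simp
      show "(\<lambda>t. F t * h t) \<in> borel_measurable (lebesgue_on {a..b})"
        by (rule borel_measurable_times[OF Fm borel_measurable_integrable[OF h]])
      show "AE t in lebesgue_on {a..b}. norm (F t * h t) \<le> norm (B * h t)"
      proof (rule AE_I2)
        fix t assume "t \<in> space (lebesgue_on {a..b})"
        then have "\<bar>F t\<bar> \<le> \<bar>B\<bar>" using B[of t] by auto
        then show "norm (F t * h t) \<le> norm (B * h t)"
          by (simp add: abs_mult mult_right_mono)
      qed
    qed
  qed
  show I: "integrable (lebesgue_on {a..b}) (\<lambda>t. 2 * G t * h t)"
    using G by (intro mult continuous_intros)
  have Ia: "integrable (lebesgue_on {a..b}) (\<lambda>t. \<bar>h t\<bar>)" using h by simp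
  define Q where "Q p q = (LINT t|lebesgue_on {p..q}. 2 * G t * h t)" for p q
  define H where "H p q = (LINT t|lebesgue_on {p..q}. \<bar>h t\<bar>)" for p q
  have add: "(LINT t|lebesgue_on {p..r}. f t) = (LINT t|lebesgue_on {p..q}. f t) + (LINT t|lebesgue_on {q..r}. f t)"
    if "integrable (lebesgue_on {a..b}) f" "a \<le> p" "p \<le> q" "q \<le> r" "r \<le> b" for f :: "real \<Rightarrow> real" and p q r
  proof -
    have "integrable (lebesgue_on {p..r}) f" "integrable (lebesgue_on {p..q}) f" "integrable (lebesgue_on {q..r}) f"
      using that by (auto intro!: sub)
    moreover have "f integrable_on {p..r}"
      using calculation(1) by (auto simp: integrable_on_lebesgue_on)
    ultimately show ?thesis
      using that Henstock_Kurzweil_Integration.integral_combine[of p q r f]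
      by (simp add: lebesgue_integral_eq_integral)
  qed
  have est: "\<bar>(G b)\<^sup>2 - (G a)\<^sup>2 - Q a b\<bar> \<le> e * H a b" if "e > 0" for e
  proof -
    define P where "P p q \<longleftrightarrow> (a \<le> p \<longrightarrow> p \<le> q \<longrightarrow> q \<le> b \<longrightarrow> \<bar>(G q)\<^sup>2 - (G p)\<^sup>2 - Q p q\<bar> \<le> e * H p q)" for p q
    have "P a b"
      using ab
    proof (induction rule: Bolzano)
      case (trans p q r)
      show ?case
        unfolding P_def
      proof (intro impI)
        assume *: "a \<le> p" "p \<le> r" "r \<le> b"
        have "\<bar>(G q)\<^sup>2 - (G p)\<^sup>2 - Q p q\<bar> \<le> e * H p q" "\<bar>(G r)\<^sup>2 - (G q)\<^sup>2 - Q q r\<bar> \<le> e * H q r"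
          using trans * by (auto simp: P_def)
        moreover have "Q p r = Q p q + Q q r" "H p r = H p q + H q r"
          unfolding Q_def H_def using I Ia trans * by (auto intro!: add)
        ultimately show "\<bar>(G r)\<^sup>2 - (G p)\<^sup>2 - Q p r\<bar> \<le> e * H p r"
          by (simp add: distrib_left)
      qed
    next
      case (local x)
      then have "continuous (at x within {a..b}) G"
        using G by (simp add: continuous_on_eq_continuous_within)
      \<comment> \<open>\<open>G q + G p - 2 * G t\<close> is made of four deviations from
        \<open>G x\<close>, hence \<open>e / 4\<close>.\<close>
      then obtain d where d: "d > 0" "\<And>t. t \<in> {a..b} \<Longrightarrow> \<bar>t - x\<bar> < d \<Longrightarrow> \<bar>G t - G x\<bar> < e / 4"
        using \<open>e > 0\<close> unfolding continuous_within_eps_delta dist_real_def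
        by (metis zero_less_divide_iff zero_less_numeral)
      show ?case
      proof (intro exI[of _ d] conjI allI impI)
        fix p q assume pq: "p \<le> x \<and> x \<le> q \<and> q - p < d"
        show "P p q"
          unfolding P_def
        proof (intro impI)
          assume *: "a \<le> p" "p \<le> q" "q \<le> b"
          have near: "\<bar>G t - G x\<bar> < e / 4" if "t \<in> {p..q}" for t
            using that pq * by (intro d(2)) auto
          have Ih: "integrable (lebesgue_on {p..q}) h" and Iq: "integrable (lebesgue_on {p..q}) (\<lambda>t. 2 * G t * h t)"
            using h I * by (auto intro!: sub)
          have "(G q)\<^sup>2 - (G p)\<^sup>2 = (G q + G p) * (LINT t|lebesgue_on {p..q}. h t)"
            using incr[OF *] by (simp add: power2_eq_square algebra_simps)
          then have "(G q)\<^sup>2 - (G p)\<^sup>2 - Q p q = (LINT t|lebesgue_on {p..q}. (G q + G p) * h t - 2 * G t * h t)"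
            unfolding Q_def using Ih Iq by (subst Bochner_Integration.integral_diff) auto
          also have "\<bar>\<dots>\<bar> \<le> (LINT t|lebesgue_on {p..q}. e * \<bar>h t\<bar>)"
          proof (rule order_trans[OF integral_abs_bound integral_mono])
            show "integrable (lebesgue_on {p..q}) (\<lambda>t. \<bar>(G q + G p) * h t - 2 * G t * h t\<bar>)"
              using Ih Iq by (intro integrable_abs Bochner_Integration.integrable_diff) auto
            show "integrable (lebesgue_on {p..q}) (\<lambda>t. e * \<bar>h t\<bar>)" using Ih by simp
            fix t assume "t \<in> space (lebesgue_on {p..q})"
            then have "q \<in> {p..q}" "p \<in> {p..q}" "t \<in> {p..q}" using * by auto
            then have "\<bar>G q - G x\<bar> < e / 4" "\<bar>G p - G x\<bar> < e / 4" "\<bar>G t - G x\<bar> < e / 4"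
              using near by blast+
            then have "\<bar>G q + G p - 2 * G t\<bar> \<le> e" by linarith
            then have "\<bar>G q + G p - 2 * G t\<bar> * \<bar>h t\<bar> \<le> e * \<bar>h t\<bar>" by (intro mult_right_mono) auto
            moreover have "(G q + G p) * h t - 2 * G t * h t = (G q + G p - 2 * G t) * h t"
              by (simp add: algebra_simps)
            ultimately show "\<bar>(G q + G p) * h t - 2 * G t * h t\<bar> \<le> e * \<bar>h t\<bar>"
              by (simp only: abs_mult)
          qed
          finally show "\<bar>(G q)\<^sup>2 - (G p)\<^sup>2 - Q p q\<bar> \<le> e * H p q" by (simp add: H_def)
        qed
      qed (rule d(1))
    qed
    then show ?thesis using ab by (simp add: P_def)
  qed
  have "\<bar>(G b)\<^sup>2 - (G a)\<^sup>2 - Q a b\<bar> \<le> 0"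
  proof (rule field_le_epsilon)
    fix e :: real assume "e > 0"
    have "H a b \<ge> 0" by (simp add: H_def)
    \<comment> \<open>The added 1 covers the case \<open>H a b = 0\<close>.\<close>
    then have "e / (H a b + 1) * H a b \<le> e"
      using \<open>e > 0\<close> by (simp add: field_simps)
    then show "\<bar>(G b)\<^sup>2 - (G a)\<^sup>2 - Q a b\<bar> \<le> 0 + e"
      using est[of "e / (H a b + 1)"] \<open>e > 0\<close> \<open>H a b \<ge> 0\<close> by (simp add: add_nonneg_pos)
  qed
  then show "(G b)\<^sup>2 - (G a)\<^sup>2 = (LINT t|lebesgue_on {a..b}. 2 * G t * h t)" by (simp add: Q_def)
qed

section \<open>Exhausting a half-open time interval\<close>

text \<open>The shift by 2 makes the sequence start at \<open>T / 2\<close>, so that every member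
  lies strictly between 0 and \<open>T\<close>.\<close>

definition time_step :: "real \<Rightarrow> nat \<Rightarrow> real" where
  "time_step T m = T - T / real (m + 2)"

lemma time_step:
  assumes "T > 0"
  shows "0 < time_step T m" "time_step T m < T"
proof -
  have "T / real (m + 2) < T"
    using assms by (simp add: divide_less_eq)
  then show "0 < time_step T m" "time_step T m < T"
    using assms by (auto simp: time_step_def)
qed

lemma time_step_exhausts:
  assumes "t < T" "T > 0"
  obtains m where "t < time_step T m"
proof -
  obtain m :: nat where "T / (T - t) < real m" using reals_Archimedean2 by blast
  then have "T / (T - t) < real (m + 2)" by simp
  then have "T < real (m + 2) * (T - t)" using assms by (simp add: field_simps)
  then have "t < time_step T m" by (simp add: time_step_def field_simps)
  then show ?thesis by (rule that)
qed

lemma AE_exhaust: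
  fixes T :: real
  assumes "T > 0" "\<And>T'. 0 < T' \<Longrightarrow> T' < T \<Longrightarrow> AE t in lebesgue_on {0..<T'}. Q t"
  shows "AE t in lebesgue_on {0..<T}. Q t"
proof -
  have "AE t in lebesgue. t \<in> {0..<time_step T m} \<longrightarrow> Q t" for m
    using assms(2)[OF time_step[OF assms(1)]] by (simp add: AE_restrict_space_iff)
  then have "AE t in lebesgue. \<forall>m. t \<in> {0..<time_step T m} \<longrightarrow> Q t"
    unfolding AE_all_countable by blast
  then have "AE t in lebesgue. t \<in> {0..<T} \<longrightarrow> Q t"
  proof (rule eventually_mono)
    fix t assume *: "\<forall>m. t \<in> {0..<time_step T m} \<longrightarrow> Q t"
    show "t \<in> {0..<T} \<longrightarrow> Q t"
    proof
      assume t: "t \<in> {0..<T}"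
      then obtain m where "t < time_step T m" using time_step_exhausts[of t T] assms(1) by auto
      then show "Q t" using * t by auto
    qed
  qed
  then show ?thesis by (simp add: AE_restrict_space_iff)
qed

lemma borel_measurable_exhaust:
  fixes T :: real and f :: "real \<Rightarrow> 'b::topological_space"
  assumes "T > 0" "\<And>T'. 0 < T' \<Longrightarrow> T' < T \<Longrightarrow> f \<in> borel_measurable (lebesgue_on {0..<T'})"
  shows "f \<in> borel_measurable (lebesgue_on {0..<T})"
proof (rule measurable_piecewise_restrict[where C = "range (\<lambda>m. {0..<time_step T m})"])
  show "space (lebesgue_on {0..<T}) \<subseteq> \<Union> (range (\<lambda>m. {0..<time_step T m}))"
  proof
    fix t assume "t \<in> space (lebesgue_on {0..<T})"
    then have t: "t \<in> {0..<T}" by simp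
    then obtain m where "t < time_step T m" using time_step_exhausts[of t T] assms(1) by auto
    then show "t \<in> \<Union> (range (\<lambda>m. {0..<time_step T m}))" using t by auto
  qed
  fix \<Omega> assume "\<Omega> \<in> range (\<lambda>m. {0..<time_step T m})"
  then obtain m where \<Omega>: "\<Omega> = {0..<time_step T m}" by auto
  have sub: "\<Omega> \<subseteq> {0..<T}" using time_step[OF assms(1), of m] \<Omega> by auto
  then show "\<Omega> \<inter> space (lebesgue_on {0..<T}) \<in> sets (lebesgue_on {0..<T})"
    using \<Omega> by (auto simp: sets_restrict_space intro!: image_eqI[of _ _ \<Omega>])
  have "{0..<T} \<inter> \<Omega> = \<Omega>" using sub by auto
  then have "restrict_space (lebesgue_on {0..<T}) \<Omega> = lebesgue_on \<Omega>"
    using \<Omega> by (subst restrict_restrict_space) auto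
  then show "f \<in> borel_measurable (restrict_space (lebesgue_on {0..<T}) \<Omega>)"
    using assms(2)[OF time_step[OF assms(1)]] \<Omega> by simp
qed auto

text \<open>A violation at \<open>t\<close> would persist on an interval to the right of
  \<open>t\<close>, which is not negligible. The right side is taken because \<open>t\<close> may be
  the left end \<open>a\<close>.\<close>

lemma AE_continuous_le:
  fixes f :: "real \<Rightarrow> real"
  assumes f: "continuous_on {a..<b} f" and AE: "AE t in lebesgue_on {a..<b}. f t \<le> M"
    and t: "t \<in> {a..<b}"
  shows "f t \<le> M"
proof (rule ccontr)
  assume "\<not> f t \<le> M"
  have "continuous (at t within {a..<b}) f"
    using f t by (simp add: continuous_on_eq_continuous_within)
  then obtain d where d: "d > 0" "\<And>s. s \<in> {a..<b} \<Longrightarrow> \<bar>s - t\<bar> < d \<Longrightarrow> \<bar>f s - f t\<bar> < f t - M"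
    using \<open>\<not> f t \<le> M\<close> unfolding continuous_within_eps_delta dist_real_def
    by (metis diff_gt_0_iff_gt not_le)
  define c where "c = min (t + d) b"
  have "AE s in lebesgue. s \<in> {a..<b} \<longrightarrow> f s \<le> M"
    using AE by (simp add: AE_restrict_space_iff)
  moreover have "\<not> f s \<le> M" if "s \<in> {t<..<c}" for s
  proof -
    have "\<bar>f s - f t\<bar> < f t - M" using that t by (intro d(2)) (auto simp: c_def)
    then show ?thesis by linarith
  qed
  moreover have "{t<..<c} \<subseteq> {a..<b}" using t by (auto simp: c_def)
  ultimately have "AE s in lebesgue. s \<notin> {t<..<c}"
    by (auto elim!: eventually_mono)
  then have "negligible {t<..<c}"
    by (simp add: negligible_iff_null_sets AE_iff_null_sets)
  moreover have "(t + c) / 2 \<in> {t<..<c}"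
    using d(1) t by (auto simp: c_def)
  ultimately show False
    using open_not_negligible[OF open_greaterThanLessThan, of t c] by blast
qed

lemma AE_continuous_eq:
  fixes f g :: "real \<Rightarrow> real"
  assumes "continuous_on {a..<b} f" "continuous_on {a..<b} g"
    and AE: "AE t in lebesgue_on {a..<b}. f t = g t" and t: "t \<in> {a..<b}"
  shows "f t = g t"
proof -
  have "\<bar>f t - g t\<bar> \<le> 0"
    by (rule AE_continuous_le[OF _ _ t])
      (use assms in \<open>auto intro!: continuous_intros elim: eventually_mono\<close>)
  then show ?thesis by simp
qed

lemma compact_subset_exhaust:
  fixes K :: "real set"
  assumes "compact K" "K \<subseteq> {0<..<T}" "T > 0"
  obtains T' where "0 < T'" "T' < T" "K \<subseteq> {0<..<T'}"
proof (cases "K = {}")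
  case True
  then show ?thesis using that[of "T / 2"] assms by auto
next
  case False
  then obtain s where s: "s \<in> K" "\<And>t. t \<in> K \<Longrightarrow> t \<le> s"
    using compact_attains_sup[OF assms(1)] by blast
  then show ?thesis
    using assms that[of "(s + T) / 2"] by (force simp: subset_iff)
qed

text \<open>A test function with compact support in \<open>{0<..<T}\<close> is supported in some
  shorter \<open>{0<..<T'}\<close>, where the identity is known.\<close>

lemma weak_time_deriv_exhaust:
  assumes T: "T > 0" and w: "\<And>T'. 0 < T' \<Longrightarrow> T' < T \<Longrightarrow> weak_time_deriv T' g h"
  shows "weak_time_deriv T g h"
  unfolding weak_time_deriv_def
proof (intro conjI allI impI; elim conjE)
  fix K :: "real set" assume "compact K" "K \<subseteq> {0<..<T}"
  then obtain T' where "0 < T'" "T' < T" "K \<subseteq> {0<..<T'}"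
    using compact_subset_exhaust T by blast
  with w \<open>compact K\<close> show "set_integrable lebesgue K g" "set_integrable lebesgue K h"
    unfolding weak_time_deriv_def by blast+
next
  fix \<eta> :: "real \<Rightarrow> real"
  assume \<eta>: "smooth \<eta>" "closure {t. \<eta> t \<noteq> 0} \<subseteq> {0<..<T}"
  let ?K = "closure {t. \<eta> t \<noteq> 0}"
  have "compact ?K"
  proof -
    have "?K \<subseteq> {0..T}" using \<eta>(2) by auto
    then have "bounded ?K" by (rule bounded_subset[OF bounded_closed_interval])
    then show ?thesis by (simp add: compact_eq_bounded_closed)
  qed
  then obtain T' where T': "0 < T'" "T' < T" "?K \<subseteq> {0<..<T'}"
    using compact_subset_exhaust T \<eta>(2) by blast
  have zero: "\<eta> t = 0" "deriv \<eta> t = 0" if "t \<notin> ?K" for t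
  proof -
    show "\<eta> t = 0" using that closure_subset[of "{t. \<eta> t \<noteq> 0}"] by auto
    have "(\<eta> has_real_derivative 0) (at t)"
    proof (rule has_field_derivative_transform_within_open[of "\<lambda>_. 0"])
      show "open (- ?K)" "t \<in> - ?K" using that by auto
      show "0 = \<eta> s" if "s \<in> - ?K" for s
        using that closure_subset[of "{t. \<eta> t \<noteq> 0}"] by auto
    qed simp
    then show "deriv \<eta> t = 0" by (rule DERIV_imp_deriv)
  qed
  have off: "\<eta> t = 0" "deriv \<eta> t = 0" if "t \<in> {0<..<T} - {0<..<T'}" for t
    using zero[of t] that T'(3) by blast+
  have sub: "{0<..<T'} \<subseteq> {0<..<T}" using T'(2) by auto
  have "(LINT t|lebesgue_on {0<..<T}. g t * deriv \<eta> t) = (LINT t|lebesgue_on {0<..<T'}. g t * deriv \<eta> t)"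
    by (rule LINT_lebesgue_on_subset[OF _ _ sub]) (simp_all add: off)
  moreover have "(LINT t|lebesgue_on {0<..<T}. h t * \<eta> t) = (LINT t|lebesgue_on {0<..<T'}. h t * \<eta> t)"
    by (rule LINT_lebesgue_on_subset[OF _ _ sub]) (simp_all add: off)
  ultimately show "(LINT t|lebesgue_on {0<..<T}. g t * deriv \<eta> t) = - (LINT t|lebesgue_on {0<..<T}. h t * \<eta> t)"
    using w[OF T'(1,2)] \<eta>(1) T'(3) by (simp add: weak_time_deriv_def)
qed

text \<open>Two continuous representatives agree everywhere on the shorter of their intervals, so
  those belonging to the stages \<open>time_step T m\<close> glue together.\<close>

lemma continuous_representative_exhaust:
  fixes f :: "real \<Rightarrow> real"
  assumes T: "T > 0"
    and ex: "\<And>T'. 0 < T' \<Longrightarrow> T' < T \<Longrightarrow>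
      \<exists>g. continuous_on {0..<T'} g \<and> (AE t in lebesgue_on {0..<T'}. g t = f t) \<and> g 0 = c"
  shows "\<exists>g. continuous_on {0..<T} g \<and> (AE t in lebesgue_on {0..<T}. g t = f t) \<and> g 0 = c"
proof -
  let ?\<tau> = "time_step T"
  obtain g where g: "\<And>m. continuous_on {0..<?\<tau> m} (g m)" "\<And>m. AE t in lebesgue_on {0..<?\<tau> m}. g m t = f t"
    "\<And>m. g m 0 = c"
    using ex[OF time_step[OF T]] by metis
  have agree: "g m t = g n t" if t: "0 \<le> t" "t < ?\<tau> m" "t < ?\<tau> n" for m n t
  proof -
    let ?r = "min (?\<tau> m) (?\<tau> n)"
    have "continuous_on {0..<?r} (g m)" "continuous_on {0..<?r} (g n)"
      using g(1)[of m] g(1)[of n] by (auto intro: continuous_on_subset)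
    moreover have "AE t in lebesgue_on {0..<?r}. g m t = f t" "AE t in lebesgue_on {0..<?r}. g n t = f t"
      by (rule AE_lebesgue_on_subset[OF g(2)]; auto)+
    then have "AE t in lebesgue_on {0..<?r}. g m t = g n t"
      by eventually_elim simp
    ultimately show ?thesis
      by (rule AE_continuous_eq) (use t in auto)
  qed
  define i where "i t = (LEAST m. t < ?\<tau> m)" for t
  define G where "G t = g (i t) t" for t
  have i: "t < ?\<tau> (i t)" if "t < T" for t
    using time_step_exhausts[OF that T] unfolding i_def by (metis LeastI)
  have G: "G t = g m t" if "0 \<le> t" "t < ?\<tau> m" for t m
    using agree[OF that(1) i that(2)] that time_step[OF T, of m] by (simp add: G_def)
  have "continuous_on {0..<T} G"
    unfolding continuous_on_eq_continuous_within
  proof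
    fix t assume t: "t \<in> {0..<T}"
    obtain m where m: "t < ?\<tau> m" using time_step_exhausts[of t T] t T by auto
    have "continuous_on {0..<?\<tau> m} G"
      using g(1)[of m] by (rule continuous_on_eq) (auto simp: G)
    then have "continuous (at t within {0..<?\<tau> m}) G"
      using t m by (auto simp: continuous_on_eq_continuous_within)
    moreover have "at t within {0..<T} = at t within {0..<?\<tau> m}"
      by (rule at_within_nhd[of _ "{..<?\<tau> m}"]) (use m time_step[OF T, of m] in auto)
    ultimately show "continuous (at t within {0..<T}) G" by simp
  qed
  moreover have "AE t in lebesgue_on {0..<T}. G t = f t"
  proof (rule AE_exhaust[OF T])
    fix T' assume T': "0 < T'" "T' < T"
    obtain m where m: "T' < ?\<tau> m" using time_step_exhausts[OF T'(2) T] by auto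
    have "AE t in lebesgue_on {0..<T'}. g m t = f t"
      by (rule AE_lebesgue_on_subset[OF g(2)[of m]]) (use m in auto)
    moreover have "AE t in lebesgue_on {0..<T'}. t \<in> {0..<T'}"
      by (rule AE_I2) simp
    ultimately show "AE t in lebesgue_on {0..<T'}. G t = f t"
    proof eventually_elim
      case (elim t)
      then show ?case using G[of t m] m by auto
    qed
  qed
  moreover have "G 0 = c"
    using G[of 0 0] g(3)[of 0] time_step[OF T, of 0] by simp
  ultimately show ?thesis by blast
qed

text \<open>A diagonal construction. At time \<open>t\<close> the approximants of the first stage
  \<open>i t\<close> that contains \<open>t\<close> are used, but only from index \<open>i t\<close>
  on, and the fixed value \<open>x0\<close> before. Thus each \<open>s' n\<close> involves finitely
  many stages, hence finitely many values, and every time eventually sees a sequence that converges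
  there for almost every \<open>t\<close>.\<close>

lemma strongly_measurable_exhaust:
  assumes T: "T > 0" and sm: "\<And>T'. 0 < T' \<Longrightarrow> T' < T \<Longrightarrow> strongly_measurable {0..<T'} X N u"
  shows "strongly_measurable {0..<T} X N u"
proof -
  let ?\<tau> = "time_step T"
  define simple where "simple m s \<longleftrightarrow>
     (\<forall>n. finite (s n ` {0..<?\<tau> m}) \<and> s n ` {0..<?\<tau> m} \<subseteq> X \<and> (\<forall>v. {t \<in> {0..<?\<tau> m}. s n t = v} \<in> sets lebesgue)) \<and>
     (AE t in lebesgue_on {0..<?\<tau> m}. (\<lambda>n. N (s n t - u t)) \<longlonglongrightarrow> 0)" for m s
  have "\<exists>s. simple m s" for m
    using sm[OF time_step[OF T, of m]] unfolding strongly_measurable_def simple_def .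
  then obtain s where "simple m (s m)" for m by metis
  then have fin: "finite (s m n ` {0..<?\<tau> m})" and sX: "s m n ` {0..<?\<tau> m} \<subseteq> X"
    and lev: "{t \<in> {0..<?\<tau> m}. s m n t = v} \<in> sets lebesgue"
    and lim: "AE t in lebesgue_on {0..<?\<tau> m}. (\<lambda>n. N (s m n t - u t)) \<longlonglongrightarrow> 0" for m n v
    unfolding simple_def by blast+
  define i where "i t = (LEAST m. t < ?\<tau> m)" for t
  have i: "t < ?\<tau> (i t)" if "t < T" for t
    using time_step_exhausts[OF that T] unfolding i_def by (metis LeastI)
  define x0 where "x0 = s 0 0 0"
  have "x0 \<in> X" using sX[of 0 0] time_step[OF T, of 0] by (auto simp: x0_def)
  define s' where "s' n t = (if i t \<le> n then s (i t) n t else x0)" for n t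
  \<comment> \<open>The stages made disjoint: the level sets of \<open>s' n\<close> are finite
    unions of level sets on pieces, plus the remaining times when the value is
    \<open>x0\<close>.\<close>
  define piece where "piece m = {t \<in> {0..<T}. i t = m}" for m
  have piece_eq: "piece m = {0..<?\<tau> m} - (\<Union>j<m. {0..<?\<tau> j})" for m
  proof -
    have "i t = m \<longleftrightarrow> t < ?\<tau> m \<and> (\<forall>j<m. \<not> t < ?\<tau> j)" if "t < T" for t
    proof
      assume m: "i t = m"
      have "\<not> t < ?\<tau> j" if "j < m" for j
        using not_less_Least[of j "\<lambda>m. t < ?\<tau> m"] that m unfolding i_def by simp
      then show "t < ?\<tau> m \<and> (\<forall>j<m. \<not> t < ?\<tau> j)" using i[OF that] m by simp
    next
      assume m: "t < ?\<tau> m \<and> (\<forall>j<m. \<not> t < ?\<tau> j)"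
      show "i t = m"
        unfolding i_def by (rule Least_equality) (use m in \<open>auto simp: not_less[symmetric]\<close>)
    qed
    note im = this
    show ?thesis
    proof (intro set_eqI iffI)
      fix t assume "t \<in> piece m"
      then show "t \<in> {0..<?\<tau> m} - (\<Union>j<m. {0..<?\<tau> j})" using im[of t] by (auto simp: piece_def)
    next
      fix t assume t: "t \<in> {0..<?\<tau> m} - (\<Union>j<m. {0..<?\<tau> j})"
      then have "t < T" using time_step(2)[OF T, of m] by auto
      then show "t \<in> piece m" using t im[of t] by (auto simp: piece_def)
    qed
  qed
  then have piece_sets: "piece m \<in> sets lebesgue" for m by auto
  have piece_sub: "piece m \<subseteq> {0..<?\<tau> m}" for m using piece_eq by auto
  show ?thesis
    unfolding strongly_measurable_def
  proof (intro exI[of _ s'] conjI allI)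
    fix n
    have vals: "s' n t = x0 \<or> (\<exists>m\<le>n. s' n t \<in> s m n ` {0..<?\<tau> m})" if "t \<in> {0..<T}" for t
      using that i[of t] by (auto simp: s'_def)
    have "s' n ` {0..<T} \<subseteq> insert x0 (\<Union>m\<le>n. s m n ` {0..<?\<tau> m})"
      using vals by blast
    then show "finite (s' n ` {0..<T})"
      by (rule finite_subset) (auto simp: fin)
    show "s' n ` {0..<T} \<subseteq> X"
      using vals sX \<open>x0 \<in> X\<close> by blast
    fix v
    have "{t \<in> {0..<T}. s' n t = v} = (\<Union>m\<le>n. piece m \<inter> {t \<in> {0..<?\<tau> m}. s m n t = v})
        \<union> (if v = x0 then {0..<T} - (\<Union>m\<le>n. piece m) else {})"
      using piece_sub i by (auto simp: s'_def piece_def)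
    also have "\<dots> \<in> sets lebesgue"
    proof -
      have "(\<Union>m\<le>n. piece m \<inter> {t \<in> {0..<?\<tau> m}. s m n t = v}) \<in> sets lebesgue"
        by (intro sets.finite_UN sets.Int piece_sets lev) simp
      moreover have "{0..<T} - (\<Union>m\<le>n. piece m) \<in> sets lebesgue"
        by (intro sets.Diff sets.finite_UN piece_sets) simp_all
      moreover have "A \<union> (if P then B else {}) \<in> sets lebesgue" if "A \<in> sets lebesgue" "B \<in> sets lebesgue"
        for A B :: "real set" and P
        using that by simp
      ultimately show ?thesis by blast
    qed
    finally show "{t \<in> {0..<T}. s' n t = v} \<in> sets lebesgue" .
  next
    have "AE t in lebesgue. t \<in> {0..<?\<tau> m} \<longrightarrow> (\<lambda>n. N (s m n t - u t)) \<longlonglongrightarrow> 0" for m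
      using lim[of m] by (simp add: AE_restrict_space_iff)
    then have "AE t in lebesgue. \<forall>m. t \<in> {0..<?\<tau> m} \<longrightarrow> (\<lambda>n. N (s m n t - u t)) \<longlonglongrightarrow> 0"
      unfolding AE_all_countable by blast
    then have "AE t in lebesgue. t \<in> {0..<T} \<longrightarrow> (\<lambda>n. N (s' n t - u t)) \<longlonglongrightarrow> 0"
    proof (rule eventually_mono)
      fix t assume *: "\<forall>m. t \<in> {0..<?\<tau> m} \<longrightarrow> (\<lambda>n. N (s m n t - u t)) \<longlonglongrightarrow> 0"
      show "t \<in> {0..<T} \<longrightarrow> (\<lambda>n. N (s' n t - u t)) \<longlonglongrightarrow> 0"
      proof
        assume t: "t \<in> {0..<T}"
        then have "(\<lambda>n. N (s (i t) n t - u t)) \<longlonglongrightarrow> 0" using * i[of t] by auto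
        moreover have "eventually (\<lambda>n. N (s (i t) n t - u t) = N (s' n t - u t)) sequentially"
          using eventually_ge_at_top[of "i t"] by eventually_elim (simp add: s'_def)
        ultimately show "(\<lambda>n. N (s' n t - u t)) \<longlonglongrightarrow> 0"
          by (rule Lim_transform_eventually)
      qed
    qed
    then show "AE t in lebesgue_on {0..<T}. (\<lambda>n. N (s' n t - u t)) \<longlonglongrightarrow> 0"
      by (simp add: AE_restrict_space_iff)
  qed
qed

section \<open>From the half-open to the closed time interval\<close>

lemma AE_lebesgue_on_Icc_iff:
  "(AE t in lebesgue_on {0..T}. Q t) \<longleftrightarrow> (AE t in lebesgue_on {0..<T}. Q t)" for T :: real
proof -
  have "AE t in lebesgue. t \<notin> {T}"
    by (rule AE_not_in) (simp add: negligible_iff_null_sets[symmetric])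
  then have "AE t in lebesgue. t \<noteq> T" by simp
  then have "(AE t in lebesgue. t \<in> {0..T} \<longrightarrow> Q t) \<longleftrightarrow> (AE t in lebesgue. t \<in> {0..<T} \<longrightarrow> Q t)"
  proof (intro iffI)
    assume "AE t in lebesgue. t \<noteq> T" "AE t in lebesgue. t \<in> {0..T} \<longrightarrow> Q t"
    then show "AE t in lebesgue. t \<in> {0..<T} \<longrightarrow> Q t" by eventually_elim auto
  next
    assume "AE t in lebesgue. t \<noteq> T" "AE t in lebesgue. t \<in> {0..<T} \<longrightarrow> Q t"
    then show "AE t in lebesgue. t \<in> {0..T} \<longrightarrow> Q t" by eventually_elim auto
  qed
  then show ?thesis by (simp add: AE_restrict_space_iff)
qed

lemma strongly_measurable_Icc:
  assumes "strongly_measurable {0..<T} X N u" "T > 0"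
  shows "strongly_measurable {0..T} X N u"
proof -
  obtain s where s: "\<And>n. finite (s n ` {0..<T})" "\<And>n. s n ` {0..<T} \<subseteq> X"
    "\<And>n v. {t \<in> {0..<T}. s n t = v} \<in> sets lebesgue"
    "AE t in lebesgue_on {0..<T}. (\<lambda>n. N (s n t - u t)) \<longlonglongrightarrow> 0"
    using assms(1) unfolding strongly_measurable_def by blast
  \<comment> \<open>At the null time \<open>T\<close> any value in \<open>X\<close> will do; the
    value at 0 is available because \<open>T > 0\<close>.\<close>
  define s' where "s' n t = (if t = T then s n 0 else s n t)" for n t
  have im: "s' n ` {0..T} \<subseteq> s n ` {0..<T}" for n
    using assms(2) by (auto simp: s'_def)
  have eq: "{t \<in> {0..T}. s' n t = v} = {t \<in> {0..<T}. s n t = v} \<union> (if s n 0 = v then {T} else {})" for n v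
    using assms(2) by (auto simp: s'_def)
  have lev: "{t \<in> {0..T}. s' n t = v} \<in> sets lebesgue" for n v
  proof -
    have "(if s n 0 = v then {T} else {}) \<in> sets lebesgue" by simp
    then show ?thesis unfolding eq by (rule sets.Un[OF s(3)])
  qed
  have "AE t in lebesgue_on {0..<T}. t \<in> {0..<T}" by (rule AE_I2) simp
  with s(4) have "AE t in lebesgue_on {0..<T}. (\<lambda>n. N (s' n t - u t)) \<longlonglongrightarrow> 0"
    by eventually_elim (auto simp: s'_def)
  then have "AE t in lebesgue_on {0..T}. (\<lambda>n. N (s' n t - u t)) \<longlonglongrightarrow> 0"
    by (simp only: AE_lebesgue_on_Icc_iff)
  moreover have "finite (s' n ` {0..T})" "s' n ` {0..T} \<subseteq> X" for n
    using finite_subset[OF im s(1)] order_trans[OF im s(2)] by auto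
  ultimately show ?thesis
    unfolding strongly_measurable_def using lev by (intro exI[of _ s'] conjI allI)
qed

lemma borel_measurable_Icc:
  fixes f :: "real \<Rightarrow> ennreal"
  assumes "f \<in> borel_measurable (lebesgue_on {0..<T})"
  shows "f \<in> borel_measurable (lebesgue_on {0..T})"
proof (rule measurable_piecewise_restrict[where C = "{{0..<T}, {T}}"])
  fix \<Omega> assume \<Omega>: "\<Omega> \<in> {{0..<T}, {T}}"
  show "\<Omega> \<inter> space (lebesgue_on {0..T}) \<in> sets (lebesgue_on {0..T})"
    using \<Omega> by (auto simp: sets_restrict_space_iff)
  show "f \<in> borel_measurable (restrict_space (lebesgue_on {0..T}) \<Omega>)"
  proof (cases "\<Omega> = {T}")
    case False
    then have "\<Omega> = {0..<T}" "{0..T} \<inter> {0..<T} = {0..<T}" using \<Omega> by auto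
    then show ?thesis using assms by (subst restrict_restrict_space) auto
  next
    case True
    then have "f \<in> borel_measurable (restrict_space (lebesgue_on {0..T}) {T}) \<longleftrightarrow>
        (\<lambda>_. f T) \<in> borel_measurable (restrict_space (lebesgue_on {0..T}) {T})"
      by (intro measurable_cong) (auto simp: space_restrict_space)
    then show ?thesis using True by simp
  qed
qed auto

lemma bochner_Lp_Icc:
  assumes u: "u \<in> bochner_Lp p {0..<T} X N" and T: "T > 0" and p: "p = 2 \<or> p = \<infinity>"
  shows "u \<in> bochner_Lp p {0..T} X N"
proof -
  have "AE t in lebesgue_on {0..T}. u t \<in> X" "strongly_measurable {0..T} X N u"
    using u T by (auto simp: bochner_Lp_def AE_lebesgue_on_Icc_iff intro: strongly_measurable_Icc)
  moreover have "Lp_norm p (lebesgue_on {0..T}) (\<lambda>t. N (u t)) < \<infinity>"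
  proof (cases "p = \<infinity>")
    case True
    then have fin: "esssup (lebesgue_on {0..<T}) (\<lambda>t. N (u t)) < \<infinity>"
      using u by (auto simp: bochner_Lp_def Lp_norm_def)
    \<comment> \<open>A finite \<open>esssup\<close> certifies measurability, since its value for a
      nonmeasurable function is \<open>top\<close>.\<close>
    then have "(\<lambda>t. N (u t)) \<in> borel_measurable (lebesgue_on {0..<T})"
      using esssup_non_measurable by fastforce
    then have "esssup (lebesgue_on {0..T}) (\<lambda>t. N (u t)) \<le> esssup (lebesgue_on {0..<T}) (\<lambda>t. N (u t))"
      by (intro esssup_I borel_measurable_Icc) (simp_all add: AE_lebesgue_on_Icc_iff esssup_AE)
    then show ?thesis using True fin by (auto simp: Lp_norm_def intro: le_less_trans)
  next
    case False
    have "(\<integral>\<^sup>+t. (N (u t))\<^sup>2 \<partial>lebesgue_on {0..T}) = (\<integral>\<^sup>+t. (N (u t))\<^sup>2 \<partial>lebesgue_on {0..<T})"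
    proof -
      have "AE t in lebesgue. t \<notin> {T}"
        by (rule AE_not_in) (simp add: negligible_iff_null_sets[symmetric])
      then have "AE t in lebesgue. (N (u t))\<^sup>2 * indicator {0..T} t = (N (u t))\<^sup>2 * indicator {0..<T} t"
        by (rule eventually_mono) (auto simp: indicator_def)
      then show ?thesis
        by (simp add: nn_integral_restrict_space nn_integral_cong_AE)
    qed
    moreover have "Lp_norm 2 M f < \<infinity> \<longleftrightarrow> (\<integral>\<^sup>+x. (f x)\<^sup>2 \<partial>M) < \<infinity>" for M :: "real measure" and f
      unfolding Lp_norm_2_square[symmetric] by (simp add: power_less_top_ennreal)
    moreover have "p = 2" using p False by simp
    ultimately show ?thesis
      using u by (simp add: bochner_Lp_def)
  qed
  ultimately show ?thesis by (simp add: bochner_Lp_def)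
qed

section \<open>An enumeration of the frequencies by finite sets\<close>

lemma countable_lattice: "countable (lattice :: (real^'d) set)"
proof -
  have "lattice \<subseteq> range (\<lambda>g :: 'd \<Rightarrow> int. (\<chi> i. real_of_int (g i)) :: real^'d)"
  proof
    fix k :: "real^'d" assume "k \<in> lattice"
    then have "k = (\<chi> i. real_of_int \<lfloor>k $ i\<rfloor>)" by (auto simp: vec_eq_iff lattice_def)
    then show "k \<in> range (\<lambda>g :: 'd \<Rightarrow> int. (\<chi> i. real_of_int (g i)) :: real^'d)"
      by (rule image_eqI[where x = "\<lambda>i. \<lfloor>k $ i\<rfloor>"]) simp
  qed
  then show ?thesis by (rule countable_subset) simp
qed

text \<open>An increasing sequence that exhausts the lattice, so that suprema over finite sets of
  frequencies become countable suprema and remain measurable in time.\<close>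

definition modes :: "nat \<Rightarrow> (real^'d) set" where
  "modes n = from_nat_into lattice ` {..n}"

lemma finite_modes [simp]: "finite (modes n)"
  by (simp add: modes_def)

lemma modes_subset: "modes n \<subseteq> lattice"
proof -
  have "lattice \<noteq> {}" using lattice_zero by blast
  then show ?thesis using from_nat_into[of lattice] by (auto simp: modes_def)
qed

lemma modes_mono: "m \<le> n \<Longrightarrow> modes m \<subseteq> modes n"
  by (auto simp: modes_def)

lemma modes_exhaust:
  fixes K :: "(real^'d) set"
  assumes "finite K" "K \<subseteq> lattice"
  obtains n where "K \<subseteq> modes n"
proof -
  have "\<exists>n. K \<subseteq> modes n"
    using assms
  proof (induction rule: finite_induct)
    case (insert k K)
    then obtain n where n: "K \<subseteq> modes n" by auto
    obtain m where "k = from_nat_into lattice m"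
      using insert.prems from_nat_into_surj[OF countable_lattice, of k] by auto
    then have "k \<in> modes m" by (auto simp: modes_def)
    then show ?case
      using n modes_mono[of m "max m n"] modes_mono[of n "max m n"] by (intro exI[of _ "max m n"]) auto
  qed simp
  then show ?thesis using that by blast
qed

lemma sum_le_of_modes:
  fixes g :: "real^'d \<Rightarrow> real"
  assumes "\<And>n. (\<Sum>k\<in>modes n. g k) \<le> A" "\<And>k. g k \<ge> 0" "finite K" "K \<subseteq> lattice"
  shows "(\<Sum>k\<in>K. g k) \<le> A"
proof -
  obtain n where "K \<subseteq> modes n" using modes_exhaust assms(3,4) by blast
  then have "(\<Sum>k\<in>K. g k) \<le> (\<Sum>k\<in>modes n. g k)"
    using assms(2) by (intro sum_mono2) auto
  then show ?thesis using assms(1)[of n] by linarith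
qed

section \<open>The energy estimate at a fixed time\<close>

definition ks_rhs :: "real \<Rightarrow> (real^3 \<Rightarrow> real^3) \<Rightarrow> (real^3 \<Rightarrow> real^3) \<Rightarrow> real" where
  "ks_rhs lam v \<psi> = lam * torus_inner (grad v) (grad \<psi>) - torus_inner (advect v v) \<psi>
     - torus_inner (laplacian v) (laplacian \<psi>)"

lemma ks_rhs_hartley:
  assumes "v \<in> sobolev 4" "integrable torus (advect v v)" "k \<in> lattice"
  shows "ks_rhs lam v (\<lambda>x. hartley k x *\<^sub>R e)
    = (lam * (norm k)\<^sup>2 - norm k ^ 4) * (hcoef k v \<bullet> e) - hcoef k (advect v v) \<bullet> e"
  unfolding ks_rhs_def
  using torus_inner_grad_hartley[OF assms(1) _ assms(3)] torus_inner_laplacian_hartley[OF assms(1) _ assms(3)]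
    torus_inner_hartley[OF assms(2)]
  by (simp add: algebra_simps)

text \<open>Here \<open>r\<close> stands for \<open>(norm k)^2\<close>, \<open>w\<close> for the
  weight, \<open>c\<close> for a coefficient of \<open>u\<close> and \<open>b\<close> for one of the
  convection term. The destabilising part is controlled by
  \<open>2 * lam * r \<le> lam^2 + r^2\<close>, which leaves \<open>lam^2 + 1 - w\<close>.\<close>

lemma energy_mode_inequality:
  fixes c b :: "real^3" and r lam :: real
  defines "w \<equiv> 1 + r\<^sup>2"
  shows "w * (2 * ((lam * r - r\<^sup>2) * (norm c)\<^sup>2 - c \<bullet> b))
    \<le> (lam\<^sup>2 + 1) * (w * (norm c)\<^sup>2) - (w\<^sup>2 * (norm c)\<^sup>2) / 2 + 2 * (norm b)\<^sup>2"
proof -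
  have "w \<ge> 0" by (simp add: w_def)
  have "2 * (lam * r - r\<^sup>2) \<le> lam\<^sup>2 + 1 - w"
    using zero_le_power2[of "lam - r"] by (simp add: w_def power2_eq_square algebra_simps)
  then have "w * (norm c)\<^sup>2 * (2 * (lam * r - r\<^sup>2)) \<le> w * (norm c)\<^sup>2 * (lam\<^sup>2 + 1 - w)"
    using \<open>w \<ge> 0\<close> by (intro mult_left_mono) auto
  moreover have "- (c \<bullet> b) \<le> norm c * norm b"
    using Cauchy_Schwarz_ineq2[of c b] by linarith
  then have "2 * w * (- (c \<bullet> b)) \<le> 2 * w * (norm c * norm b)"
    using \<open>w \<ge> 0\<close> by (intro mult_left_mono) auto
  \<comment> \<open>Young's inequality, balanced so that half of the dissipation
    \<open>w^2 * (norm c)^2\<close> survives.\<close>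
  moreover have "2 * w * (norm c * norm b) \<le> (w\<^sup>2 * (norm c)\<^sup>2) / 2 + 2 * (norm b)\<^sup>2"
    using zero_le_power2[of "w * norm c - 2 * norm b"] by (simp add: power2_eq_square algebra_simps)
  ultimately show ?thesis
    by (simp add: power2_eq_square algebra_simps)
qed

text \<open>The velocity is bounded pointwise by \<open>C * sqrt M\<close> and its gradient in
  \<open>L^2\<close> through \<open>A\<close>; the 9 is that of \<open>L2_square_grad_le\<close> for
  vector fields in dimension three.\<close>

lemma advect_bound:
  fixes v :: "real^3 \<Rightarrow> real^3"
  assumes v: "v \<in> sobolev 4" and bnd: "AE x in torus. norm (v x) \<le> C * sqrt M" and CM: "C \<ge> 0" "M \<ge> 0"
    and A: "\<And>K. finite K \<Longrightarrow> K \<subseteq> lattice \<Longrightarrow> (\<Sum>k\<in>K. (norm k)\<^sup>2 * (norm (hcoef k v))\<^sup>2) \<le> A"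
  shows "integrable torus (advect v v)"
    and "finite K \<Longrightarrow> K \<subseteq> lattice \<Longrightarrow> (\<Sum>k\<in>K. (norm (hcoef k (advect v v)))\<^sup>2) \<le> 9 * C\<^sup>2 * A * M"
proof -
  have A0: "A \<ge> 0" using A[of "{}"] by simp
  have m: "advect v v \<in> borel_measurable torus"
    using sobolev_integrable[OF v] v by (intro advect_measurable[of _ _ 4]) auto
  have "L2_square (advect v v) \<le> ennreal ((C * sqrt M)\<^sup>2) * L2_square (grad v)"
    using CM v by (intro L2_square_advect_le[OF bnd]) auto
  also have "L2_square (grad v) \<le> ennreal (9 * A / (2 * pi) ^ 3)"
    using L2_square_grad_le[OF v _ A] by simp
  finally have L2: "L2_square (advect v v) \<le> ennreal (C\<^sup>2 * M * (9 * A / (2 * pi) ^ 3))"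
    using CM A0 by (simp add: mult_left_mono ennreal_mult[symmetric] power_mult_distrib)
  then have fin: "L2_square (advect v v) < \<infinity>" by (rule le_less_trans) simp
  show "integrable torus (advect v v)" by (rule L2_square_integrable(2)[OF m fin])
  assume K: "finite K" "K \<subseteq> lattice"
  have "ennreal (\<Sum>k\<in>K. (norm (hcoef k (advect v v)))\<^sup>2) \<le> ennreal ((2 * pi) ^ 3) * L2_square (advect v v)"
    using bessel_inequality[OF m K] by simp
  also have "\<dots> \<le> ennreal ((2 * pi) ^ 3) * ennreal (C\<^sup>2 * M * (9 * A / (2 * pi) ^ 3))"
    using L2 by (intro mult_left_mono) auto
  also have "\<dots> = ennreal (9 * C\<^sup>2 * A * M)"
    using CM A0 by (subst ennreal_mult[symmetric]) (auto simp: mult_ac)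
  finally show "(\<Sum>k\<in>K. (norm (hcoef k (advect v v)))\<^sup>2) \<le> 9 * C\<^sup>2 * A * M"
    using CM A0 by (subst (asm) ennreal_le_iff) auto
qed

text \<open>The convection coefficients depend on all modes, hence \<open>bnd\<close> and
  \<open>A\<close> concern the whole function although only the modes in \<open>K\<close> are
  summed. The constant 18 is the 9 of \<open>advect_bound\<close> times the 2 left by Young's
  inequality.\<close>

lemma energy_estimate_fixed_time:
  fixes v :: "real^3 \<Rightarrow> real^3"
  assumes v: "v \<in> sobolev 4" and bnd: "AE x in torus. norm (v x) \<le> C * sqrt M" and CM: "C \<ge> 0" "M \<ge> 0"
    and A: "\<And>K. finite K \<Longrightarrow> K \<subseteq> lattice \<Longrightarrow> (\<Sum>k\<in>K. (norm k)\<^sup>2 * (norm (hcoef k v))\<^sup>2) \<le> A"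
    and K: "finite K" "K \<subseteq> lattice"
    and M: "(\<Sum>k\<in>K. (1 + norm k ^ 4) * (norm (hcoef k v))\<^sup>2) \<le> M"
  shows "(\<Sum>k\<in>K. (1 + norm k ^ 4) * (\<Sum>j\<in>UNIV. 2 * hcoef k v $ j * ks_rhs lam v (\<lambda>x. hartley k x *\<^sub>R axis j 1)))
    \<le> M * (lam\<^sup>2 + 1 + 18 * C\<^sup>2 * A) - (\<Sum>k\<in>K. (1 + norm k ^ 4)\<^sup>2 * (norm (hcoef k v))\<^sup>2) / 2"
proof -
  let ?c = "\<lambda>k. hcoef k v" and ?b = "\<lambda>k. hcoef k (advect v v)"
  have B: "integrable torus (advect v v)" by (rule advect_bound(1)[OF v bnd CM]) (rule A)
  have B2: "(\<Sum>k\<in>K. (norm (?b k))\<^sup>2) \<le> 9 * C\<^sup>2 * A * M"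
    by (rule advect_bound(2)[OF v bnd CM _ K]) (rule A)
  have sq: "(norm c)\<^sup>2 = (\<Sum>j\<in>UNIV. c $ j * c $ j)" for c :: "real^3"
    by (simp only: norm_square_axes inner_axis) (simp add: power2_eq_square)
  have "(\<Sum>j\<in>UNIV. 2 * ?c k $ j * ks_rhs lam v (\<lambda>x. hartley k x *\<^sub>R axis j 1))
      = 2 * ((lam * (norm k)\<^sup>2 - ((norm k)\<^sup>2)\<^sup>2) * (norm (?c k))\<^sup>2 - ?c k \<bullet> ?b k)" if "k \<in> K" for k
  proof -
    have "k \<in> lattice" using that K by auto
    have "(\<Sum>j\<in>UNIV. 2 * ?c k $ j * ks_rhs lam v (\<lambda>x. hartley k x *\<^sub>R axis j 1))
        = (\<Sum>j\<in>UNIV. 2 * ((lam * (norm k)\<^sup>2 - norm k ^ 4) * (?c k $ j * ?c k $ j) - ?c k $ j * ?b k $ j))"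
      by (simp add: ks_rhs_hartley[OF v B \<open>k \<in> lattice\<close>] inner_axis algebra_simps)
    also have "\<dots> = 2 * ((lam * (norm k)\<^sup>2 - norm k ^ 4) * (norm (?c k))\<^sup>2 - ?c k \<bullet> ?b k)"
      unfolding sq inner_vec_def by (simp add: sum_distrib_left sum_subtractf)
    finally show ?thesis by (simp add: power_mult[symmetric])
  qed
  then have "(\<Sum>k\<in>K. (1 + norm k ^ 4) * (\<Sum>j\<in>UNIV. 2 * ?c k $ j * ks_rhs lam v (\<lambda>x. hartley k x *\<^sub>R axis j 1)))
      = (\<Sum>k\<in>K. (1 + ((norm k)\<^sup>2)\<^sup>2) * (2 * ((lam * (norm k)\<^sup>2 - ((norm k)\<^sup>2)\<^sup>2) * (norm (?c k))\<^sup>2 - ?c k \<bullet> ?b k)))"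
    by (intro sum.cong) (simp_all add: power_mult[symmetric])
  also have "\<dots> \<le> (\<Sum>k\<in>K. (lam\<^sup>2 + 1) * ((1 + ((norm k)\<^sup>2)\<^sup>2) * (norm (?c k))\<^sup>2)
      - ((1 + ((norm k)\<^sup>2)\<^sup>2)\<^sup>2 * (norm (?c k))\<^sup>2) / 2 + 2 * (norm (?b k))\<^sup>2)"
    by (intro sum_mono energy_mode_inequality)
  also have "\<dots> = (lam\<^sup>2 + 1) * (\<Sum>k\<in>K. (1 + norm k ^ 4) * (norm (?c k))\<^sup>2)
      - (\<Sum>k\<in>K. (1 + norm k ^ 4)\<^sup>2 * (norm (?c k))\<^sup>2) / 2 + 2 * (\<Sum>k\<in>K. (norm (?b k))\<^sup>2)"
    by (simp add: sum.distrib sum_subtractf sum_distrib_left sum_divide_distrib power_mult[symmetric])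
  also have "\<dots> \<le> (lam\<^sup>2 + 1) * M - (\<Sum>k\<in>K. (1 + norm k ^ 4)\<^sup>2 * (norm (?c k))\<^sup>2) / 2 + 2 * (9 * C\<^sup>2 * A * M)"
    using B2 M by (intro add_mono diff_mono mult_left_mono) auto
  finally show ?thesis by (simp add: algebra_simps)
qed

section \<open>Solutions up to a possible blow-up time\<close>

locale ks_solution =
  fixes T lam :: real and u0 :: "real^3 \<Rightarrow> real^3" and u :: "real \<Rightarrow> real^3 \<Rightarrow> real^3"
  assumes T: "T > 0"
    and solution: "\<And>T'. 0 < T' \<Longrightarrow> T' < T \<Longrightarrow> strong_solution lam T' u0 u"
    and grad_L2: "(\<lambda>t. grad (u t)) \<in> bochner_Lp 2 {0<..<T} (torus_Lp 2) (torus_Lp_norm 2)"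
begin

lemma AE_sobolev: "AE t in lebesgue_on {0..<T}. u t \<in> sobolev 4"
  by (rule AE_exhaust[OF T]) (use solution in \<open>auto simp: strong_solution_def bochner_Lp_def\<close>)

lemma weak_formulation:
  "\<psi> \<in> torus_smooth \<Longrightarrow> weak_time_deriv T (\<lambda>t. torus_inner (u t) \<psi>) (\<lambda>t. ks_rhs lam (u t) \<psi>)"
  by (rule weak_time_deriv_exhaust[OF T])
    (use solution in \<open>auto simp: strong_solution_def ks_rhs_def\<close>)

lemma representative:
  "\<psi> \<in> torus_smooth \<Longrightarrow> \<exists>g. continuous_on {0..<T} g \<and>
     (AE t in lebesgue_on {0..<T}. g t = torus_inner (u t) \<psi>) \<and> g 0 = torus_inner u0 \<psi>"
  by (rule continuous_representative_exhaust[OF T])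
    (use solution in \<open>auto simp: strong_solution_def\<close>)

text \<open>The pairings of \<open>u\<close> are meaningful only for almost every time, whereas
  increments between two times need a value at each time.\<close>

definition rep :: "(real^3 \<Rightarrow> real^3) \<Rightarrow> real \<Rightarrow> real" where
  "rep \<psi> = (SOME g. continuous_on {0..<T} g \<and> (AE t in lebesgue_on {0..<T}. g t = torus_inner (u t) \<psi>))"

lemma rep:
  assumes "\<psi> \<in> torus_smooth"
  shows "continuous_on {0..<T} (rep \<psi>)" "AE t in lebesgue_on {0..<T}. rep \<psi> t = torus_inner (u t) \<psi>"
proof -
  have "\<exists>g. continuous_on {0..<T} g \<and> (AE t in lebesgue_on {0..<T}. g t = torus_inner (u t) \<psi>)"
    using representative[OF assms] by blast
  from someI_ex[OF this] show "continuous_on {0..<T} (rep \<psi>)" "AE t in lebesgue_on {0..<T}. rep \<psi> t = torus_inner (u t) \<psi>"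
    by (simp_all add: rep_def)
qed

definition coef :: "real^3 \<Rightarrow> real \<Rightarrow> real^3" where
  "coef k t = (\<chi> j. rep (\<lambda>x. hartley k x *\<^sub>R axis j 1) t)"

lemma continuous_coef:
  assumes "k \<in> lattice"
  shows "continuous_on {0..<T} (coef k)"
  unfolding coef_def[abs_def]
  by (intro continuous_on_vec_lambda rep(1) hartley_torus_smooth assms)

text \<open>The times at which fixed-time estimates apply: there the continuous coefficients really
  belong to the function \<open>u t\<close>.\<close>

definition regular :: "real \<Rightarrow> bool" where
  "regular t \<longleftrightarrow> u t \<in> sobolev 4 \<and> (\<forall>k\<in>lattice. coef k t = hcoef k (u t))"

text \<open>Each mode has its own exceptional null set; countability of the lattice merges them into
  one.\<close>

lemma AE_regular: "AE t in lebesgue_on {0..<T}. regular t"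
proof -
  have "AE t in lebesgue_on {0..<T}. coef k t = hcoef k (u t)" if k: "k \<in> lattice" for k
  proof -
    have "AE t in lebesgue_on {0..<T}. \<forall>j\<in>UNIV. rep (\<lambda>x. hartley k x *\<^sub>R axis j 1) t
        = torus_inner (u t) (\<lambda>x. hartley k x *\<^sub>R axis j 1)"
      by (intro AE_finite_allI rep(2) hartley_torus_smooth k) auto
    with AE_sobolev show ?thesis
    proof eventually_elim
      case (elim t)
      then show ?case
        by (simp add: coef_def vec_eq_iff torus_inner_hartley sobolev_integrable inner_axis)
    qed
  qed
  then have "AE t in lebesgue_on {0..<T}. \<forall>k\<in>lattice. coef k t = hcoef k (u t)"
    by (intro AE_ball_countable' countable_lattice)
  with AE_sobolev show ?thesis
    by eventually_elim (simp add: regular_def)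
qed

text \<open>Up to constants, a truncated squared \<open>H^2\<close> norm for \<open>p = 1\<close>
  and a truncated squared \<open>H^4\<close> norm for \<open>p = 2\<close>.\<close>

definition energy :: "nat \<Rightarrow> nat \<Rightarrow> real \<Rightarrow> real" where
  "energy p n t = (\<Sum>k\<in>modes n. (1 + norm k ^ 4) ^ p * (norm (coef k t))\<^sup>2)"

definition enstrophy :: "nat \<Rightarrow> real \<Rightarrow> real" where
  "enstrophy n t = (\<Sum>k\<in>modes n. (norm k)\<^sup>2 * (norm (coef k t))\<^sup>2)"

definition total_enstrophy :: "real \<Rightarrow> ennreal" where
  "total_enstrophy t = (SUP n. ennreal (enstrophy n t))"

lemma continuous_energy: "continuous_on {0..<T} (energy p n)"
  unfolding energy_def[abs_def] using modes_subset[of n]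
  by (intro continuous_intros continuous_coef) auto

lemma continuous_enstrophy: "continuous_on {0..<T} (enstrophy n)"
  unfolding enstrophy_def[abs_def] using modes_subset[of n]
  by (intro continuous_intros continuous_coef) auto

lemma energy_nonneg: "0 \<le> energy p n t"
  by (auto simp: energy_def intro!: sum_nonneg)

lemma energy_mono: "m \<le> n \<Longrightarrow> energy p m t \<le> energy p n t"
  unfolding energy_def using modes_mono[of m n] by (intro sum_mono2) auto

lemma measurable_interior:
  fixes f :: "real \<Rightarrow> real"
  assumes "continuous_on {0..<T} f"
  shows "f \<in> borel_measurable (lebesgue_on {0<..<T})"
  by (intro continuous_imp_measurable_on_sets_lebesgue continuous_on_subset[OF assms]) auto

lemma AE_interior:
  assumes "AE t in lebesgue_on {0..<T}. Q t" "A \<subseteq> {0..<T}" "A \<in> sets lebesgue"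
  shows "AE t in lebesgue_on A. Q t"
  by (rule AE_lebesgue_on_subset[OF assms(1,2,3)]) auto

lemma total_enstrophy_measurable: "total_enstrophy \<in> borel_measurable (lebesgue_on {0<..<T})"
  unfolding total_enstrophy_def[abs_def]
  by (intro borel_measurable_SUP measurable_compose[OF measurable_interior[OF continuous_enstrophy]]) auto

text \<open>Bessel's inequality for the gradient bounds all truncations at once, and
  \<open>grad_L2\<close> integrates the bound.\<close>

lemma total_enstrophy_finite: "(\<integral>\<^sup>+t. total_enstrophy t \<partial>lebesgue_on {0<..<T}) < \<infinity>"
proof -
  have "AE t in lebesgue_on {0<..<T}. total_enstrophy t \<le> ennreal ((2 * pi) ^ 3) * (torus_Lp_norm 2 (grad (u t)))\<^sup>2"
  proof (rule eventually_mono[OF AE_interior[OF AE_regular]])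
    fix t assume t: "regular t"
    show "total_enstrophy t \<le> ennreal ((2 * pi) ^ 3) * (torus_Lp_norm 2 (grad (u t)))\<^sup>2"
      unfolding total_enstrophy_def torus_Lp_norm_2_square
    proof (rule SUP_least)
      fix n
      have "enstrophy n t = (\<Sum>k\<in>modes n. (norm k)\<^sup>2 * (norm (hcoef k (u t)))\<^sup>2)"
        unfolding enstrophy_def using t modes_subset[of n]
        by (intro sum.cong) (auto simp: regular_def subset_iff)
      then show "ennreal (enstrophy n t) \<le> ennreal ((2 * pi) ^ 3) * L2_square (grad (u t))"
        using hcoef_grad_le[of "u t" 4 "modes n"] t modes_subset[of n] by (simp add: regular_def)
    qed
  qed auto
  \<comment> \<open>The constant is moved to the side of \<open>total_enstrophy\<close>, whose
    measurability has been established, so that it can be taken out of the integral.\<close>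
  moreover have inv: "ennreal (1 / (2 * pi) ^ 3) * ennreal ((2 * pi) ^ 3) = 1"
    by (subst ennreal_mult[symmetric]) auto
  ultimately have "AE t in lebesgue_on {0<..<T}.
      ennreal (1 / (2 * pi) ^ 3) * total_enstrophy t \<le> (torus_Lp_norm 2 (grad (u t)))\<^sup>2"
  proof (elim eventually_mono)
    fix t assume "total_enstrophy t \<le> ennreal ((2 * pi) ^ 3) * (torus_Lp_norm 2 (grad (u t)))\<^sup>2"
    then have "ennreal (1 / (2 * pi) ^ 3) * total_enstrophy t
        \<le> (ennreal (1 / (2 * pi) ^ 3) * ennreal ((2 * pi) ^ 3)) * (torus_Lp_norm 2 (grad (u t)))\<^sup>2"
      unfolding mult.assoc by (rule mult_left_mono) simp
    then show "ennreal (1 / (2 * pi) ^ 3) * total_enstrophy t \<le> (torus_Lp_norm 2 (grad (u t)))\<^sup>2"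
      unfolding inv by simp
  qed
  then have "(\<integral>\<^sup>+t. ennreal (1 / (2 * pi) ^ 3) * total_enstrophy t \<partial>lebesgue_on {0<..<T})
      \<le> (\<integral>\<^sup>+t. (torus_Lp_norm 2 (grad (u t)))\<^sup>2 \<partial>lebesgue_on {0<..<T})"
    by (rule nn_integral_mono_AE)
  also have "\<dots> < \<infinity>"
    using grad_L2 unfolding Lp_norm_2_square[symmetric] by (simp add: bochner_Lp_def power_less_top_ennreal)
  finally have "ennreal (1 / (2 * pi) ^ 3) * (\<integral>\<^sup>+t. total_enstrophy t \<partial>lebesgue_on {0<..<T}) < \<infinity>"
    using total_enstrophy_measurable by (simp add: nn_integral_cmult)
  then show ?thesis
    using pi_gt_zero by (auto simp: ennreal_mult_less_top ennreal_eq_0_iff simp del: pi_gt_zero)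
qed

text \<open>Times at which \<open>total_enstrophy\<close> is infinite receive the value 0 from
  \<open>enn2real\<close>; they form a null set.\<close>

definition enstrophy_real :: "real \<Rightarrow> real" where
  "enstrophy_real t = enn2real (total_enstrophy t)"

lemma enstrophy_real_integrable: "integrable (lebesgue_on {0<..<T}) enstrophy_real"
proof (rule integrableI_nonneg)
  show "enstrophy_real \<in> borel_measurable (lebesgue_on {0<..<T})"
    unfolding enstrophy_real_def[abs_def] using total_enstrophy_measurable by measurable
  have "(\<integral>\<^sup>+t. ennreal (enstrophy_real t) \<partial>lebesgue_on {0<..<T}) \<le> (\<integral>\<^sup>+t. total_enstrophy t \<partial>lebesgue_on {0<..<T})"
    unfolding enstrophy_real_def by (intro nn_integral_mono) (simp add: ennreal_enn2real_if)
  then show "(\<integral>\<^sup>+t. ennreal (enstrophy_real t) \<partial>lebesgue_on {0<..<T}) < \<infinity>"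
    using total_enstrophy_finite by (rule le_less_trans)
qed (simp add: enstrophy_real_def)

lemma AE_enstrophy_le: "AE t in lebesgue_on {0<..<T}. \<forall>n. enstrophy n t \<le> enstrophy_real t"
proof -
  have "AE t in lebesgue_on {0<..<T}. total_enstrophy t \<noteq> \<infinity>"
    using total_enstrophy_finite by (intro nn_integral_PInf_AE total_enstrophy_measurable) simp
  then show ?thesis
  proof eventually_elim
    case (elim t)
    show ?case
    proof
      fix n
      have "ennreal (enstrophy n t) \<le> total_enstrophy t"
        unfolding total_enstrophy_def by (rule SUP_upper) simp
      also have "total_enstrophy t = ennreal (enstrophy_real t)"
        using elim by (simp add: enstrophy_real_def less_top)
      finally show "enstrophy n t \<le> enstrophy_real t"
        by (subst (asm) ennreal_le_iff) (auto simp: enstrophy_real_def)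
    qed
  qed
qed

end

section \<open>Integrals over subintervals of time\<close>

lemma integrable_lebesgue_on_subset:
  fixes f :: "real \<Rightarrow> real"
  assumes "integrable (lebesgue_on B) f" "A \<subseteq> B" "A \<in> sets lebesgue" "B \<in> sets lebesgue"
  shows "integrable (lebesgue_on A) f"
proof -
  have "set_integrable lebesgue B f"
    using assms(1,4) by (simp add: set_integrable_def integrable_restrict_space)
  then have "set_integrable lebesgue A f"
    by (rule set_integrable_subset[OF _ assms(3,2)])
  then show ?thesis
    using assms(3) by (simp add: set_integrable_def integrable_restrict_space)
qed

lemma LINT_lebesgue_on_mono_set:
  fixes f :: "real \<Rightarrow> real"
  assumes f: "integrable (lebesgue_on B) f" and AB: "A \<subseteq> B" "A \<in> sets lebesgue" "B \<in> sets lebesgue"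
    and nonneg: "\<And>t. 0 \<le> f t"
  shows "(LINT t|lebesgue_on A. f t) \<le> (LINT t|lebesgue_on B. f t)"
proof -
  have "(LINT t|lebesgue. indicator A t *\<^sub>R f t) \<le> (LINT t|lebesgue. indicator B t *\<^sub>R f t)"
    using integrable_lebesgue_on_subset[OF f AB] f AB nonneg
    by (intro integral_mono) (auto simp: integrable_restrict_space indicator_def)
  then show ?thesis using AB by (simp add: integral_restrict_space)
qed

text \<open>The tails of \<open>f\<close> beyond \<open>time_step T m\<close> tend to 0 pointwise
  and are dominated by \<open>f\<close>.\<close>

lemma LINT_tail_small:
  fixes f :: "real \<Rightarrow> real"
  assumes f: "integrable (lebesgue_on {0<..<T}) f" and nonneg: "\<And>t. 0 \<le> f t" and "e > 0" "T > 0"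
  obtains t0 where "0 < t0" "t0 < T" "\<And>t. t0 \<le> t \<Longrightarrow> t < T \<Longrightarrow> (LINT s|lebesgue_on {t0..t}. f s) \<le> e"
proof -
  have fm: "f \<in> borel_measurable (lebesgue_on {0<..<T})" using f by auto
  have step: "time_step T \<longlonglongrightarrow> T"
  proof -
    have "(\<lambda>m. T - T * inverse (real (Suc (Suc m)))) \<longlonglongrightarrow> T - T * 0"
      by (intro tendsto_intros LIMSEQ_Suc[OF LIMSEQ_inverse_real_of_nat])
    then show ?thesis by (simp add: time_step_def[abs_def] divide_inverse)
  qed
  have "(\<lambda>m. LINT t|lebesgue_on {0<..<T}. f t * indicator {time_step T m..} t) \<longlonglongrightarrow> (LINT t|lebesgue_on {0<..<T}. 0)"
  proof (rule integral_dominated_convergence[where w = f])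
    show "(\<lambda>t. f t * indicator {time_step T m..} t) \<in> borel_measurable (lebesgue_on {0<..<T})" for m
      by (rule borel_measurable_times[OF fm]) (intro measurable_restrict_space1 borel_measurable_indicator; simp)
    show "AE t in lebesgue_on {0<..<T}. (\<lambda>m. f t * indicator {time_step T m..} t) \<longlonglongrightarrow> 0"
    proof (rule AE_I2)
      fix t assume "t \<in> space (lebesgue_on {0<..<T})"
      then have "t < T" by simp
      then have "eventually (\<lambda>m. t < time_step T m) sequentially"
        using order_tendstoD(1)[OF step] by blast
      then have "eventually (\<lambda>m. f t * indicator {time_step T m..} t = 0) sequentially"
        by eventually_elim simp
      then show "(\<lambda>m. f t * indicator {time_step T m..} t) \<longlonglongrightarrow> 0" by (rule tendsto_eventually)
    qed
    show "AE t in lebesgue_on {0<..<T}. norm (f t * indicator {time_step T m..} t) \<le> f t" for m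
      using nonneg by (intro AE_I2) (auto simp: indicator_def)
  qed (use f in auto)
  then have "eventually (\<lambda>m. (LINT t|lebesgue_on {0<..<T}. f t * indicator {time_step T m..} t) < e) sequentially"
    using \<open>e > 0\<close> by (intro order_tendstoD(2)) auto
  then obtain m where m: "(LINT t|lebesgue_on {0<..<T}. f t * indicator {time_step T m..} t) < e"
    by (auto simp: eventually_sequentially)
  show ?thesis
  proof (rule that[of "time_step T m"])
    fix t assume t: "time_step T m \<le> t" "t < T"
    let ?t0 = "time_step T m"
    have pos: "0 < ?t0" using time_step[OF \<open>T > 0\<close>] by blast
    have "(LINT s|lebesgue_on {?t0..t}. f s) \<le> (LINT s|lebesgue_on {?t0..<T}. f s)"
      using t pos by (intro LINT_lebesgue_on_mono_set nonneg integrable_lebesgue_on_subset[OF f]) auto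
    also have "\<dots> = (LINT s|lebesgue_on {?t0..<T}. f s * indicator {?t0..} s)"
      by (intro Bochner_Integration.integral_cong) auto
    also have "\<dots> = (LINT s|lebesgue_on {0<..<T}. f s * indicator {?t0..} s)"
      using pos by (intro LINT_lebesgue_on_subset[symmetric]) (auto simp: indicator_def)
    finally show "(LINT s|lebesgue_on {?t0..t}. f s) \<le> e" using m by linarith
  qed (use time_step[OF \<open>T > 0\<close>] in auto)
qed

context ks_solution
begin

text \<open>The weak formulation, tested with a single component of a single mode, is an ordinary
  differential equation in integrated form; the square rule of
  \<open>integral_square_increment\<close> turns it into an energy identity. The condition
  \<open>0 < a\<close> is there because the weak derivative lives on an open interval.\<close>

lemma mode_increment:
  fixes j :: 3
  assumes k: "k \<in> lattice" and ab: "0 < a" "a \<le> b" "b < T"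
  defines "\<psi> \<equiv> \<lambda>x. hartley k x *\<^sub>R (axis j 1 :: real^3)"
  shows "integrable (lebesgue_on {a..b}) (\<lambda>s. 2 * coef k s $ j * ks_rhs lam (u s) \<psi>)"
    "(coef k b $ j)\<^sup>2 - (coef k a $ j)\<^sup>2 = (LINT s|lebesgue_on {a..b}. 2 * coef k s $ j * ks_rhs lam (u s) \<psi>)"
proof -
  have \<psi>: "\<psi> \<in> torus_smooth" unfolding \<psi>_def by (rule hartley_torus_smooth[OF k])
  have coef: "coef k s $ j = rep \<psi> s" for s by (simp add: coef_def \<psi>_def)
  have cont: "continuous_on {0<..<T} (rep \<psi>)"
    by (rule continuous_on_subset[OF rep(1)[OF \<psi>]]) auto
  have AE: "AE t in lebesgue_on {0<..<T}. torus_inner (u t) \<psi> = rep \<psi> t"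
    by (rule eventually_mono[OF AE_interior[OF rep(2)[OF \<psi>]]]) auto
  note inc = weak_time_deriv_increment[OF weak_formulation[OF \<psi>] cont AE]
  have contab: "continuous_on {a..b} (rep \<psi>)"
    by (rule continuous_on_subset[OF cont]) (use ab in auto)
  have "rep \<psi> q - rep \<psi> p = (LINT t|lebesgue_on {p..q}. ks_rhs lam (u t) \<psi>)" if "a \<le> p" "p \<le> q" "q \<le> b" for p q
    using that ab by (intro inc(2)) auto
  note sq = integral_square_increment[OF ab(2) contab inc(1)[OF ab] this]
  show "integrable (lebesgue_on {a..b}) (\<lambda>s. 2 * coef k s $ j * ks_rhs lam (u s) \<psi>)"
    "(coef k b $ j)\<^sup>2 - (coef k a $ j)\<^sup>2 = (LINT s|lebesgue_on {a..b}. 2 * coef k s $ j * ks_rhs lam (u s) \<psi>)"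
    unfolding coef by (rule sq; simp)+
qed

lemma regular_energy:
  assumes "regular t"
  shows "energy p n t = (\<Sum>k\<in>modes n. (1 + norm k ^ 4) ^ p * (norm (hcoef k (u t)))\<^sup>2)"
    "enstrophy n t = (\<Sum>k\<in>modes n. (norm k)\<^sup>2 * (norm (hcoef k (u t)))\<^sup>2)"
  unfolding energy_def enstrophy_def using assms modes_subset[of n]
  by (auto simp: regular_def subset_iff intro!: sum.cong)

section \<open>The energy inequality and the bound up to the final time\<close>

definition growth :: "real \<Rightarrow> real \<Rightarrow> real" where
  "growth C t = lam\<^sup>2 + 1 + 18 * C\<^sup>2 * enstrophy_real t"

lemma growth_nonneg: "0 \<le> growth C t"
  by (simp add: growth_def enstrophy_real_def)

lemma growth_integrable: "integrable (lebesgue_on {0<..<T}) (growth C)"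
proof -
  have "finite_measure (lebesgue_on {0<..<T})"
    by (rule finite_measure_lebesgue_on) simp
  then have "integrable (lebesgue_on {0<..<T}) (\<lambda>t. lam\<^sup>2 + 1)"
    by (rule finite_measure.integrable_const)
  then show ?thesis
    unfolding growth_def[abs_def]
    by (rule Bochner_Integration.integrable_add[OF _ integrable_mult_right[OF enstrophy_real_integrable]])
qed

text \<open>The fixed-time estimate is integrated over the regular times of \<open>{a..b}\<close>.
  \<open>M\<close> must bound every truncation, not only the one at hand, since the convection term
  couples all modes.\<close>

lemma energy_inequality:
  assumes C: "embedding_constant TYPE(real^3) C"
    and ab: "0 < a" "a \<le> b" "b < T"
    and M: "\<And>n s. s \<in> {a..b} \<Longrightarrow> energy 1 n s \<le> M"
  shows "energy 1 n b - energy 1 n a + (LINT s|lebesgue_on {a..b}. energy 2 n s) / 2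
    \<le> M * (LINT s|lebesgue_on {a..b}. growth C s)"
proof -
  let ?w = "\<lambda>k::real^3. 1 + norm k ^ 4"
  let ?\<psi> = "\<lambda>k j x. hartley k x *\<^sub>R axis j 1 :: real^3"
  define R where "R s = (\<Sum>k\<in>modes n. ?w k * (\<Sum>j\<in>UNIV. 2 * coef k s $ j * ks_rhs lam (u s) (?\<psi> k j)))" for s
  have M0: "M \<ge> 0" using M[of a 0] energy_nonneg[of 1 0 a] ab by auto
  have lat: "k \<in> lattice" if "k \<in> modes n" for k :: "real^3" and n using that modes_subset by auto
  have IR: "integrable (lebesgue_on {a..b}) R"
    unfolding R_def[abs_def] using ab lat
    by (intro Bochner_Integration.integrable_sum integrable_mult_right mode_increment(1)) auto
  have sq: "(norm c)\<^sup>2 = (\<Sum>j\<in>UNIV. (c $ j)\<^sup>2)" for c :: "real^3"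
    by (simp add: norm_square_axes inner_axis)
  have "energy 1 n b - energy 1 n a = (\<Sum>k\<in>modes n. ?w k * (\<Sum>j\<in>UNIV. (coef k b $ j)\<^sup>2 - (coef k a $ j)\<^sup>2))"
    by (simp add: energy_def sq sum_subtractf right_diff_distrib)
  also have "\<dots> = (\<Sum>k\<in>modes n. ?w k * (\<Sum>j\<in>UNIV. LINT s|lebesgue_on {a..b}. 2 * coef k s $ j * ks_rhs lam (u s) (?\<psi> k j)))"
    using ab lat by (intro sum.cong refl arg_cong2[where f = "(*)"] mode_increment(2)) auto
  also have "\<dots> = (LINT s|lebesgue_on {a..b}. R s)"
  proof -
    have "(LINT s|lebesgue_on {a..b}. R s)
        = (\<Sum>k\<in>modes n. LINT s|lebesgue_on {a..b}. ?w k * (\<Sum>j\<in>UNIV. 2 * coef k s $ j * ks_rhs lam (u s) (?\<psi> k j)))"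
      unfolding R_def using ab lat
      by (intro Bochner_Integration.integral_sum integrable_mult_right Bochner_Integration.integrable_sum mode_increment(1)) auto
    also have "\<dots> = (\<Sum>k\<in>modes n. ?w k * (LINT s|lebesgue_on {a..b}. (\<Sum>j\<in>UNIV. 2 * coef k s $ j * ks_rhs lam (u s) (?\<psi> k j))))"
      by (simp only: integral_mult_right_zero)
    also have "\<dots> = (\<Sum>k\<in>modes n. ?w k * (\<Sum>j\<in>UNIV. LINT s|lebesgue_on {a..b}. 2 * coef k s $ j * ks_rhs lam (u s) (?\<psi> k j)))"
      using ab lat by (intro sum.cong refl arg_cong2[where f = "(*)"] Bochner_Integration.integral_sum mode_increment(1)) auto
    finally show ?thesis by simp
  qed
  also have "\<dots> \<le> (LINT s|lebesgue_on {a..b}. M * growth C s - energy 2 n s / 2)"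
  proof (rule integral_mono_AE[OF IR])
    have Ig: "integrable (lebesgue_on {a..b}) (growth C)"
      by (rule integrable_lebesgue_on_subset[OF growth_integrable]) (use ab in auto)
    have "continuous_on {a..b} (energy 2 n)"
      by (rule continuous_on_subset[OF continuous_energy]) (use ab in auto)
    then have Ie: "integrable (lebesgue_on {a..b}) (energy 2 n)"
      by (rule continuous_imp_integrable_real)
    show "integrable (lebesgue_on {a..b}) (\<lambda>s. M * growth C s - energy 2 n s / 2)"
      using Ig Ie by (intro Bochner_Integration.integrable_diff) auto
    have reg: "AE s in lebesgue_on {a..b}. regular s"
      by (rule AE_interior[OF AE_regular]) (use ab in auto)
    have ens: "AE s in lebesgue_on {a..b}. \<forall>n. enstrophy n s \<le> enstrophy_real s"
      by (rule AE_lebesgue_on_subset[OF AE_enstrophy_le]) (use ab in auto)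
    have "AE s in lebesgue_on {a..b}. s \<in> {a..b}" by (rule AE_I2) simp
    with reg ens show "AE s in lebesgue_on {a..b}. R s \<le> M * growth C s - energy 2 n s / 2"
    proof eventually_elim
      case (elim s)
      have v: "u s \<in> sobolev 4" and c: "\<And>k. k \<in> lattice \<Longrightarrow> coef k s = hcoef k (u s)"
        using elim(1) by (auto simp: regular_def)
      have sumM: "(\<Sum>k\<in>K. (1 + norm k ^ 4) * (norm (hcoef k (u s)))\<^sup>2) \<le> M"
        if "finite K" "K \<subseteq> lattice" for K
        by (rule sum_le_of_modes[OF _ _ that])
          (use M[OF elim(3)] in \<open>auto simp: regular_energy[OF elim(1)]\<close>)
      have sumA: "(\<Sum>k\<in>K. (norm k)\<^sup>2 * (norm (hcoef k (u s)))\<^sup>2) \<le> enstrophy_real s"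
        if "finite K" "K \<subseteq> lattice" for K
        by (rule sum_le_of_modes[OF _ _ that])
          (use elim(2) in \<open>auto simp: regular_energy[OF elim(1)]\<close>)
      have "R s = (\<Sum>k\<in>modes n. ?w k * (\<Sum>j\<in>UNIV. 2 * hcoef k (u s) $ j * ks_rhs lam (u s) (?\<psi> k j)))"
        unfolding R_def by (intro sum.cong refl) (simp add: c lat)
      also have "\<dots> \<le> M * (lam\<^sup>2 + 1 + 18 * C\<^sup>2 * enstrophy_real s)
          - (\<Sum>k\<in>modes n. (1 + norm k ^ 4)\<^sup>2 * (norm (hcoef k (u s)))\<^sup>2) / 2"
      proof (rule energy_estimate_fixed_time[OF v _ _ M0])
        show "C \<ge> 0" using C by (simp add: embedding_constant_def)
        show "AE x in torus. norm (u s x) \<le> C * sqrt M"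
          using C sobolev_integrable[OF v] sumM by (simp add: embedding_constant_def)
        show "(\<Sum>k\<in>modes n. (1 + norm k ^ 4) * (norm (hcoef k (u s)))\<^sup>2) \<le> M"
          by (rule sumM[OF finite_modes modes_subset])
      qed (use sumA modes_subset in auto)
      finally show ?case
        by (simp add: growth_def regular_energy[OF elim(1)])
    qed
  qed
  also have "\<dots> = M * (LINT s|lebesgue_on {a..b}. growth C s) - (LINT s|lebesgue_on {a..b}. energy 2 n s) / 2"
  proof -
    have Ig: "integrable (lebesgue_on {a..b}) (growth C)"
      by (rule integrable_lebesgue_on_subset[OF growth_integrable]) (use ab in auto)
    have "continuous_on {a..b} (energy 2 n)"
      by (rule continuous_on_subset[OF continuous_energy]) (use ab in auto)
    then have "integrable (lebesgue_on {a..b}) (energy 2 n)"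
      by (rule continuous_imp_integrable_real)
    with Ig show ?thesis
      by (subst Bochner_Integration.integral_diff) auto
  qed
  finally show ?thesis by simp
qed

text \<open>The bound in \<open>H^2\<close> on a shorter interval holds for almost every time and
  passes to every time by continuity of the truncated energies. It makes the suprema in
  \<open>energy_bounded\<close> finite.\<close>

lemma energy_locally_bounded:
  assumes T': "0 < T'" "T' < T"
  obtains M where "\<And>n t. t \<in> {0..<T'} \<Longrightarrow> energy 1 n t \<le> M"
proof -
  let ?N = "\<lambda>t. sobolev_norm 2 (u t)"
  define E where "E = esssup (lebesgue_on {0..<T'}) ?N"
  have "E < \<infinity>"
    using solution[OF T'] by (simp add: E_def strong_solution_def bochner_Lp_def Lp_norm_def)
  \<comment> \<open>The 4 is \<open>CARD(3) + 1\<close> from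
    \<open>hcoef_le_sobolev_norm\<close>.\<close>
  define M where "M = 4 * (2 * pi) ^ 3 * (enn2real E)\<^sup>2"
  have "energy 1 n t \<le> M" if "t \<in> {0..<T'}" for n t
  proof (rule AE_continuous_le[OF _ _ that])
    show "continuous_on {0..<T'} (energy 1 n)"
      by (rule continuous_on_subset[OF continuous_energy]) (use T' in auto)
    have reg: "AE t in lebesgue_on {0..<T'}. regular t"
      by (rule AE_interior[OF AE_regular]) (use T' in auto)
    have "AE t in lebesgue_on {0..<T'}. ?N t \<le> E"
      unfolding E_def by (rule esssup_AE)
    with reg show "AE t in lebesgue_on {0..<T'}. energy 1 n t \<le> M"
    proof eventually_elim
      case (elim t)
      have "ennreal (energy 1 n t) \<le> ennreal (4 * (2 * pi) ^ 3) * (?N t)\<^sup>2"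
        using hcoef_le_sobolev_norm[of "u t" 4 "modes n"] elim(1) modes_subset[of n]
        by (simp add: regular_energy[OF elim(1)] regular_def)
      also have "\<dots> \<le> ennreal (4 * (2 * pi) ^ 3) * E\<^sup>2"
        using elim(2) by (intro mult_left_mono power_mono) auto
      also have "E = ennreal (enn2real E)" using \<open>E < \<infinity>\<close> by (simp add: less_top)
      also have "ennreal (4 * (2 * pi) ^ 3) * (ennreal (enn2real E))\<^sup>2 = ennreal M"
        by (simp add: M_def ennreal_power ennreal_mult[symmetric])
      finally show ?case
        by (subst (asm) ennreal_le_iff) (auto simp: M_def)
    qed
  qed
  then show ?thesis by (rule that)
qed

text \<open>Close to \<open>T\<close> the growth rate has integral at most \<open>1/2\<close>, so there the energy at most doubles;
  this replaces Gronwall's inequality.\<close>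

lemma energy_bounded:
  assumes C: "embedding_constant TYPE(real^3) C"
  obtains M where "\<And>n t. t \<in> {0..<T} \<Longrightarrow> energy 1 n t \<le> M"
proof -
  obtain t0 where t0: "0 < t0" "t0 < T"
    and small: "\<And>t. t0 \<le> t \<Longrightarrow> t < T \<Longrightarrow> (LINT s|lebesgue_on {t0..t}. growth C s) \<le> 1 / 2"
    using LINT_tail_small[OF growth_integrable[of C] growth_nonneg, of "1 / 2"] T by (auto simp: growth_nonneg)
  \<comment> \<open>The midpoint of \<open>t0\<close> and \<open>T\<close> places \<open>t0\<close>
    inside the interval, so \<open>Y\<close> also bounds the energy at the starting time
    \<open>t0\<close>.\<close>
  obtain Y where Y: "\<And>n t. t \<in> {0..<(t0 + T) / 2} \<Longrightarrow> energy 1 n t \<le> Y"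
    using energy_locally_bounded[of "(t0 + T) / 2"] t0 by auto
  have late: "energy 1 n t \<le> 2 * Y" if t: "t0 \<le> t" "t < T" for n t
  proof -
    obtain Z where Z: "\<And>n s. s \<in> {0..<(t + T) / 2} \<Longrightarrow> energy 1 n s \<le> Z"
      using energy_locally_bounded[of "(t + T) / 2"] t t0 by auto
    \<comment> \<open>The supremum runs over truncations and times together. Its finiteness comes
      from \<open>Z\<close>, which may depend on \<open>t\<close>; the relation
      \<open>Sup V \<le> Y + Sup V / 2\<close> then removes \<open>Z\<close> from the
      result.\<close>
    define V where "V = (\<lambda>(n, s). energy 1 n s) ` (UNIV \<times> {t0..t})"
    have "energy 1 n s \<le> Z" if "s \<in> {t0..t}" for n s
      using that t t0 by (intro Z) auto
    then have bdd: "bdd_above V"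
      unfolding V_def by (intro bdd_aboveI2[where M = Z]) (auto simp del: One_nat_def)
    have V: "energy 1 n s \<le> Sup V" if "s \<in> {t0..t}" for n s
      using that by (intro cSup_upper[OF _ bdd]) (auto simp: V_def)
    have "Sup V \<ge> 0"
      using V[of t0 0] energy_nonneg[of 1 0 t0] t by auto
    have step: "energy 1 n s \<le> Y + Sup V / 2" if s: "s \<in> {t0..t}" for n s
    proof -
      have "energy 1 n s - energy 1 n t0 + (LINT r|lebesgue_on {t0..s}. energy 2 n r) / 2
          \<le> Sup V * (LINT r|lebesgue_on {t0..s}. growth C r)"
        using t t0 s V by (intro energy_inequality[OF C]) auto
      also have "\<dots> \<le> Sup V * (1 / 2)"
        using small[of s] s t \<open>Sup V \<ge> 0\<close> by (intro mult_left_mono) auto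
      finally have "energy 1 n s - energy 1 n t0 + (LINT r|lebesgue_on {t0..s}. energy 2 n r) / 2 \<le> Sup V / 2"
        by simp
      moreover have "(LINT r|lebesgue_on {t0..s}. energy 2 n r) \<ge> 0"
        by (intro Bochner_Integration.integral_nonneg energy_nonneg)
      moreover have "energy 1 n t0 \<le> Y" using t0 by (intro Y) auto
      ultimately show ?thesis by linarith
    qed
    have "Sup V \<le> Y + Sup V / 2"
      using step t by (intro cSup_least) (auto simp: V_def)
    then show ?thesis using V[of t n] t by auto
  qed
  show ?thesis
  proof (rule that)
    fix n t assume "t \<in> {0..<T}"
    then show "energy 1 n t \<le> max Y (2 * Y)"
      using Y[of t n] late[of t n] t0 by (cases "t < t0") (auto simp: le_max_iff_disj)
  qed
qed

section \<open>The integrated dissipation and the Sobolev bounds up to the final time\<close>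

definition total_energy :: "real \<Rightarrow> ennreal" where
  "total_energy t = (SUP n. ennreal (energy 2 n t))"

lemma measurable_energy: "(\<lambda>t. ennreal (energy p n t)) \<in> borel_measurable (lebesgue_on {0..<T})"
  by (intro measurable_compose[OF continuous_imp_measurable_on_sets_lebesgue[OF continuous_energy]]) auto

lemma total_energy_measurable: "total_energy \<in> borel_measurable (lebesgue_on {0..<T})"
  unfolding total_energy_def[abs_def] by (intro borel_measurable_SUP measurable_energy) auto

text \<open>The dissipation term of \<open>energy_inequality\<close> has a bound independent of both
  the interval and the truncation. Interval and truncation are enlarged together, and Fatou's lemma
  passes to the limit.\<close>

lemma total_energy_finite:
  assumes C: "embedding_constant TYPE(real^3) C"
    and M: "\<And>n t. t \<in> {0..<T} \<Longrightarrow> energy 1 n t \<le> M"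
  shows "(\<integral>\<^sup>+t. total_energy t \<partial>lebesgue_on {0..<T}) < \<infinity>"
proof -
  define a where "a m = T / real (m + 2)" for m
  define b where "b m = time_step T m" for m
  \<comment> \<open>The factor 2 undoes the half in front of the dissipation; the last
    \<open>M\<close> bounds the energy at the left end, that at the right end being
    nonnegative.\<close>
  define B where "B = 2 * (M * (LINT s|lebesgue_on {0<..<T}. growth C s) + M)"
  have M0: "M \<ge> 0" using M[of 0 0] energy_nonneg[of 1 0 0] T by auto
  have ab: "0 < a m" "a m \<le> b m" "b m < T" for m
  proof -
    have "2 * (T / real (m + 2)) \<le> T" using T by (simp add: field_simps)
    then show "0 < a m" "a m \<le> b m" "b m < T"
      using T time_step[OF T, of m] by (auto simp: a_def b_def time_step_def)
  qed
  define f where "f m t = ennreal (energy 2 m t) * indicator {a m..b m} t" for m t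
  have ind: "(indicator {a m..b m} :: real \<Rightarrow> ennreal) \<in> borel_measurable (lebesgue_on {0..<T})" for m
    by (intro measurable_restrict_space1 borel_measurable_indicator) simp
  have f_meas: "f m \<in> borel_measurable (lebesgue_on {0..<T})" for m
    unfolding f_def[abs_def] by (rule borel_measurable_times_ennreal[OF measurable_energy ind])
  have f_int: "(\<integral>\<^sup>+t. f m t \<partial>lebesgue_on {0..<T}) \<le> ennreal B" for m
  proof -
    have "(\<integral>\<^sup>+t. f m t \<partial>lebesgue_on {0..<T}) = (\<integral>\<^sup>+t. ennreal (energy 2 m t) * indicator {a m..b m} t \<partial>lebesgue)"
      using ab[of m] by (auto simp: nn_integral_restrict_space f_def indicator_def intro!: nn_integral_cong)
    also have "\<dots> = (\<integral>\<^sup>+t. ennreal (energy 2 m t) \<partial>lebesgue_on {a m..b m})"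
      by (simp add: nn_integral_restrict_space)
    also have "\<dots> = ennreal (LINT t|lebesgue_on {a m..b m}. energy 2 m t)"
    proof (intro nn_integral_eq_integral)
      have "continuous_on {a m..b m} (energy 2 m)"
        by (rule continuous_on_subset[OF continuous_energy]) (use ab[of m] in auto)
      then show "integrable (lebesgue_on {a m..b m}) (energy 2 m)"
        by (rule continuous_imp_integrable_real)
    qed (simp add: energy_nonneg)
    also have "\<dots> \<le> ennreal B"
    proof (rule ennreal_leI)
      have "energy 1 m (b m) - energy 1 m (a m) + (LINT s|lebesgue_on {a m..b m}. energy 2 m s) / 2
          \<le> M * (LINT s|lebesgue_on {a m..b m}. growth C s)"
        using ab[of m] M by (intro energy_inequality[OF C]) auto
      also have "\<dots> \<le> M * (LINT s|lebesgue_on {0<..<T}. growth C s)"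
        using ab[of m] M0 by (intro mult_left_mono LINT_lebesgue_on_mono_set growth_integrable growth_nonneg) auto
      finally show "(LINT s|lebesgue_on {a m..b m}. energy 2 m s) \<le> B"
        using M[of "a m" m] energy_nonneg[of 1 m "b m"] ab[of m] by (auto simp: B_def)
    qed
    finally show ?thesis .
  qed
  have lim: "a \<longlonglongrightarrow> 0" "b \<longlonglongrightarrow> T"
  proof -
    have *: "(\<lambda>m. T * inverse (real (Suc (Suc m)))) \<longlonglongrightarrow> T * 0"
      by (intro tendsto_intros LIMSEQ_Suc[OF LIMSEQ_inverse_real_of_nat])
    then show "a \<longlonglongrightarrow> 0" by (simp add: a_def[abs_def] divide_inverse)
    then have "(\<lambda>m. T - a m) \<longlonglongrightarrow> T - 0" by (intro tendsto_intros)
    then show "b \<longlonglongrightarrow> T" by (simp add: a_def b_def[abs_def] time_step_def)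
  qed
  \<comment> \<open>The intervals \<open>{a m..b m}\<close> exhaust only the open interval, so time
    0 is discarded.\<close>
  have "AE t in lebesgue. t \<notin> {0::real}"
    by (rule AE_not_in) (simp add: negligible_iff_null_sets[symmetric])
  then have nz: "AE t in lebesgue_on {0..<T}. t \<notin> {0}" by (rule AE_lebesgue_onI) simp
  have "AE t in lebesgue_on {0..<T}. t \<in> {0..<T}" by (rule AE_I2) simp
  with nz have "AE t in lebesgue_on {0..<T}. total_energy t \<le> liminf (\<lambda>m. f m t)"
  proof eventually_elim
    case (elim t)
    then have t: "0 < t" "t < T" by auto
    show ?case
      unfolding total_energy_def
    proof (intro SUP_least Liminf_bounded)
      fix n
      have "eventually (\<lambda>m. a m < t) sequentially" "eventually (\<lambda>m. t < b m) sequentially"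
        using order_tendstoD(2)[OF lim(1) t(1)] order_tendstoD(1)[OF lim(2) t(2)] by auto
      with eventually_ge_at_top[of n] show "eventually (\<lambda>m. ennreal (energy 2 n t) \<le> f m t) sequentially"
        by eventually_elim (auto simp: f_def intro!: ennreal_leI energy_mono)
    qed
  qed
  then have "(\<integral>\<^sup>+t. total_energy t \<partial>lebesgue_on {0..<T}) \<le> (\<integral>\<^sup>+t. liminf (\<lambda>m. f m t) \<partial>lebesgue_on {0..<T})"
    by (rule nn_integral_mono_AE)
  also have "\<dots> \<le> liminf (\<lambda>m. \<integral>\<^sup>+t. f m t \<partial>lebesgue_on {0..<T})"
    by (rule nn_integral_liminf) (rule f_meas)
  also have "\<dots> \<le> ennreal B"
    using f_int by (intro Liminf_le always_eventually) auto
  finally show ?thesis by (rule le_less_trans) simp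
qed

text \<open>Strong measurability is inherited from the shorter intervals; the bound is
  \<open>sobolev_norm_le_hcoef\<close> with \<open>p = 1\<close>, whose constant does not depend on
  time.\<close>

lemma in_H2:
  assumes M: "\<And>n t. t \<in> {0..<T} \<Longrightarrow> energy 1 n t \<le> M"
  shows "u \<in> bochner_Lp \<infinity> {0..<T} (sobolev 2) (sobolev_norm 2)"
proof -
  let ?N = "\<lambda>t. sobolev_norm 2 (u t)"
  have "AE t in lebesgue_on {0..<T}. u t \<in> sobolev 2"
    by (rule eventually_mono[OF AE_sobolev]) (use sobolev_mono[of 2 4] in auto)
  moreover have "strongly_measurable {0..<T} (sobolev 2) (sobolev_norm 2) u"
    by (rule strongly_measurable_exhaust[OF T])
      (use solution in \<open>auto simp: strong_solution_def bochner_Lp_def\<close>)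
  moreover have "Lp_norm \<infinity> (lebesgue_on {0..<T}) ?N < \<infinity>"
  proof -
    define c where "c = real (card {bs :: (real^3) list. bs \<in> lists Basis \<and> length bs \<le> 2}) * (3 * M / (2 * pi) ^ 3)"
    have M0: "M \<ge> 0" using M[of 0 0] energy_nonneg[of 1 0 0] T by auto
    \<comment> \<open>As in \<open>bochner_Lp_Icc\<close>, measurability of the norm is read off
      from the finiteness of \<open>esssup\<close>.\<close>
    have "?N \<in> borel_measurable (lebesgue_on {0..<T'})" if "0 < T'" "T' < T" for T'
    proof (rule ccontr)
      assume "?N \<notin> borel_measurable (lebesgue_on {0..<T'})"
      then have "esssup (lebesgue_on {0..<T'}) ?N = top" by (rule esssup_non_measurable)
      then show False
        using solution[OF that] by (simp add: strong_solution_def bochner_Lp_def Lp_norm_def)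
    qed
    then have meas: "?N \<in> borel_measurable (lebesgue_on {0..<T})"
      by (rule borel_measurable_exhaust[OF T])
    have "AE t in lebesgue_on {0..<T}. t \<in> {0..<T}" by (rule AE_I2) simp
    with AE_regular have "AE t in lebesgue_on {0..<T}. ?N t \<le> ennreal (sqrt c)"
    proof eventually_elim
      case (elim t)
      have "(?N t)\<^sup>2 \<le> of_nat (card {bs :: (real^3) list. bs \<in> lists Basis \<and> length bs \<le> 2})
          * ennreal (DIM(real^3) * M / (2 * pi) ^ CARD(3))"
      proof (rule sobolev_norm_le_hcoef)
        show "u t \<in> sobolev 2" using elim(1) sobolev_mono[of 2 4] by (auto simp: regular_def)
        fix K :: "(real^3) set" assume K: "finite K" "K \<subseteq> lattice"
        show "(\<Sum>k\<in>K. (1 + norm k ^ 4) ^ 1 * (norm (hcoef k (u t)))\<^sup>2) \<le> M"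
          by (rule sum_le_of_modes[OF _ _ K])
            (use M[OF elim(2)] in \<open>auto simp: regular_energy[OF elim(1)]\<close>)
      qed simp
      also have "\<dots> = ennreal c"
        using M0 by (simp add: c_def ennreal_of_nat_eq_real_of_nat ennreal_mult[symmetric])
      finally have "(?N t)\<^sup>2 \<le> ennreal c" .
      then show ?case
      proof (cases "?N t")
        case (real r)
        have "c \<ge> 0" using M0 by (simp add: c_def)
        have "r\<^sup>2 \<le> c"
          using \<open>(?N t)\<^sup>2 \<le> ennreal c\<close> real \<open>c \<ge> 0\<close> by (simp add: ennreal_power)
        then show ?thesis using real by (simp add: real_le_rsqrt ennreal_leI)
      next
        case top
        then show ?thesis using \<open>(?N t)\<^sup>2 \<le> ennreal c\<close> by (simp add: top_unique)
      qed
    qed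
    then have "esssup (lebesgue_on {0..<T}) ?N \<le> ennreal (sqrt c)"
      by (rule esssup_I[OF meas])
    then show ?thesis
      by (auto simp: Lp_norm_def intro: le_less_trans)
  qed
  ultimately show ?thesis by (simp add: bochner_Lp_def)
qed

text \<open>\<open>sobolev_norm_le_hcoef\<close> with \<open>p = 2\<close> bounds the squared
  \<open>H^4\<close> norm by a multiple of \<open>total_energy\<close> at almost every time.\<close>

lemma in_H4:
  assumes Z: "(\<integral>\<^sup>+t. total_energy t \<partial>lebesgue_on {0..<T}) < \<infinity>"
  shows "u \<in> bochner_Lp 2 {0..<T} (sobolev 4) (sobolev_norm 4)"
proof -
  let ?N = "\<lambda>t. sobolev_norm 4 (u t)"
  have "strongly_measurable {0..<T} (sobolev 4) (sobolev_norm 4) u"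
    by (rule strongly_measurable_exhaust[OF T])
      (use solution in \<open>auto simp: strong_solution_def bochner_Lp_def\<close>)
  moreover have "Lp_norm 2 (lebesgue_on {0..<T}) ?N < \<infinity>"
  proof -
    define c where "c = real (card {bs :: (real^3) list. bs \<in> lists Basis \<and> length bs \<le> 4}) * (3 / (2 * pi) ^ 3)"
    have "{bs :: (real^3) list. bs \<in> lists Basis \<and> length bs \<le> 4} \<noteq> {}" by (auto intro: exI[of _ "[]"])
    \<comment> \<open>Positivity matters where \<open>total_energy\<close> is infinite: only a
      nonzero factor keeps the right side infinite, as \<open>0 * top = 0\<close>.\<close>
    then have "c > 0"
      unfolding c_def by (intro mult_pos_pos) (auto simp: card_gt_0_iff finite_multi_indices)
    have "AE t in lebesgue_on {0..<T}. (?N t)\<^sup>2 \<le> ennreal c * total_energy t"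
    proof (rule eventually_mono[OF AE_regular])
      fix t assume reg: "regular t"
      show "(?N t)\<^sup>2 \<le> ennreal c * total_energy t"
      proof (cases "total_energy t")
        case top
        then show ?thesis using \<open>c > 0\<close> by (simp add: ennreal_mult_top)
      next
        case (real z)
        have "energy 2 n t \<le> z" for n
        proof -
          have "ennreal (energy 2 n t) \<le> total_energy t"
            unfolding total_energy_def by (rule SUP_upper) simp
          then show ?thesis using real by (simp add: ennreal_le_iff)
        qed
        note z = this
        have "(?N t)\<^sup>2 \<le> of_nat (card {bs :: (real^3) list. bs \<in> lists Basis \<and> length bs \<le> 4})
            * ennreal (DIM(real^3) * z / (2 * pi) ^ CARD(3))"
        proof (rule sobolev_norm_le_hcoef)
          show "u t \<in> sobolev 4" using reg by (simp add: regular_def)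
          fix K :: "(real^3) set" assume K: "finite K" "K \<subseteq> lattice"
          show "(\<Sum>k\<in>K. (1 + norm k ^ 4) ^ 2 * (norm (hcoef k (u t)))\<^sup>2) \<le> z"
            by (rule sum_le_of_modes[OF _ _ K])
              (use z in \<open>auto simp: regular_energy[OF reg]\<close>)
        qed simp
        also have "\<dots> = ennreal c * total_energy t"
          using real by (simp add: c_def ennreal_of_nat_eq_real_of_nat ennreal_mult[symmetric])
        finally show ?thesis .
      qed
    qed
    then have "(\<integral>\<^sup>+t. (?N t)\<^sup>2 \<partial>lebesgue_on {0..<T}) \<le> (\<integral>\<^sup>+t. ennreal c * total_energy t \<partial>lebesgue_on {0..<T})"
      by (rule nn_integral_mono_AE)
    also have "\<dots> = ennreal c * (\<integral>\<^sup>+t. total_energy t \<partial>lebesgue_on {0..<T})"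
      by (rule nn_integral_cmult[OF total_energy_measurable])
    also have "\<dots> < \<infinity>" using Z by (simp add: ennreal_mult_less_top)
    finally have "(Lp_norm 2 (lebesgue_on {0..<T}) ?N)\<^sup>2 < \<infinity>" unfolding Lp_norm_2_square .
    then show ?thesis by (simp add: power_less_top_ennreal)
  qed
  ultimately show ?thesis using AE_sobolev by (simp add: bochner_Lp_def)
qed

text \<open>The equation and the initial value extend to \<open>T\<close> by exhaustion alone, since
  test functions in time have compact support and representatives live on a half-open interval; the
  estimates are needed for the two norms.\<close>

theorem global_strong_solution:
  "strong_solution lam T u0 u \<and>
   u \<in> bochner_Lp \<infinity> {0..T} (sobolev 2) (sobolev_norm 2) \<and>
   u \<in> bochner_Lp 2 {0..T} (sobolev 4) (sobolev_norm 4)"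
proof -
  obtain C where C: "embedding_constant TYPE(real^3) C"
    by (rule embedding_constant_exists)
  obtain M where M: "\<And>n t. t \<in> {0..<T} \<Longrightarrow> energy 1 n t \<le> M"
    using energy_bounded[OF C] by blast
  have H2: "u \<in> bochner_Lp \<infinity> {0..<T} (sobolev 2) (sobolev_norm 2)"
    by (rule in_H2[OF M])
  have H4: "u \<in> bochner_Lp 2 {0..<T} (sobolev 4) (sobolev_norm 4)"
    by (rule in_H4[OF total_energy_finite[OF C M]])
  have "strong_solution lam T u0 u"
    unfolding strong_solution_def
    using H2 H4 weak_formulation representative by (auto simp: ks_rhs_def)
  then show ?thesis
    using bochner_Lp_Icc[OF H2 T] bochner_Lp_Icc[OF H4 T] by auto
qed

end

theorem theorem3p9:
  fixes T lam :: real
    and u0 :: "real^3 \<Rightarrow> real^3"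
    and u :: "real \<Rightarrow> real^3 \<Rightarrow> real^3"
    and \<phi> :: "real^3 \<Rightarrow> real"
  assumes "T > 0"
    and "lam > 0"
    and "u0 \<in> sobolev 2"
    and "dyadic_cutoff \<phi>"
    and "\<And>T'. 0 < T' \<Longrightarrow> T' < T \<Longrightarrow> strong_solution lam T' u0 u"
    and "(\<lambda>t. grad_dist (u t)) \<in>
           bochner_Lp 2 {0<..<T} (besov_components \<phi> (- 1) \<infinity> \<infinity>) (besov_components_norm \<phi> (- 1) \<infinity> \<infinity>)"
    and "(\<lambda>t. grad (u t)) \<in> bochner_Lp 2 {0<..<T} (torus_Lp 2) (torus_Lp_norm 2)"
  shows "strong_solution lam T u0 u \<and>
         u \<in> bochner_Lp \<infinity> {0..T} (sobolev 2) (sobolev_norm 2) \<and>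
         u \<in> bochner_Lp 2 {0..T} (sobolev 4) (sobolev_norm 4)"
proof -
  interpret ks_solution T lam u0 u
    by standard (use assms in auto)
  show ?thesis by (rule global_strong_solution)
qed

end
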